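(* Let $f:\mathbb T^2\to\mathbb T^2$ be the Katok diffeomorphism, let $\nu_0=\pi_*\mu_1$, and let $0<\epsilon\ll\beta$ and $\widetilde\Lambda(\beta,\beta,\epsilon)=\bigcup_{k\ge1}{\rm supp}(\nu_0|\Lambda_k(\beta,\beta,\epsilon))$ be as described in the context. Then for every $\nu\in\mathscr M_{\rm inv}(\widetilde\Lambda(\beta,\beta,\epsilon),f)$ and every $\psi\in C^0(\mathbb T^2)$, $$P(G_\nu,\psi)=h_\nu(f)+\int\psi\,d\nu .$$
   Context: Katok map: let $f_0$ be the linear automorphism of $\mathbb T^2$ given by $A=\begin{pmatrix}2&1\\1&1\end{pmatrix}$, with eigenvalues $\lambda^{-1}<1<\lambda$, and let $\mu_1$ be its measure of maximal entropy. Let $D_r$ be the disk of small radius $r$ centered at $(0,0)$ with coordinates $(s_1,s_2)$ along the eigendirections, so $A(s_1,s_2)=(\lambda s_1,\lambda^{-1}s_2)$. Let $\chi:[0,1]\to\mathbb R$ satisfy: (1) $\chi$ is $C^\infty$ except at $0$; (2) $\chi(0)=0$ and $\chi(u)=1$ for $u\ge r_0$, where $0<r_0<1$; (3) $\chi'(u)>0$ for $0<u<r_0$; (4) $\int_0^1\frac{du}{\chi(u)}<\infty$. For sufficiently small $r_0<r_1$, let $g$ be the time-1 map of the system $$\frac{ds_1}{dt}=s_1\chi(s_1^2+s_2^2)\log\lambda,\qquad \frac{ds_2}{dt}=-s_2\chi(s_1^2+s_2^2)\log\lambda$$ in $D_{r_1}$, and set $f(x)=g(x)$ for $x\in D_{r_1}$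 and $f(x)=A(x)$ otherwise. Then $f$ is a homeomorphism of $\mathbb T^2$ that is a $C^\infty$ diffeomorphism away from the origin; $\chi$ is further assumed chosen as in Katok's construction ($\int_0^1 du/\chi$ converging sufficiently slowly near $0$) so that $f$ is a diffeomorphism of class $C^{1+\alpha}$ on all of $\mathbb T^2$. There is a homeomorphism $\pi:\mathbb T^2\to\mathbb T^2$ with $\pi\circ f_0=f\circ\pi$; put $\nu_0=\pi_*\mu_1$. Parameters: $0<\epsilon\ll\beta$ ($\epsilon$ sufficiently small relative to $\beta$ and $f$, as is standard in Pesin theory, in particular $3\epsilon<\beta$) are fixed such that there is a neighborhood $U$ of $\nu_0$ in $\mathscr M_{\rm inv}(\mathbb T^2,f)$ (weak-* topology) for which every ergodic $\nu\in U$ satisfies $\nu\in\mathscr M_{\rm inv}(\widetilde\Lambda(\beta,\beta,\epsilon),f)$; such $\beta,\epsilon$ are known to exist. Pesin blocks: with $\beta_1=\beta_2=\beta$, for $k\in\mathbb Z^+$, $\Lambda_k(\beta_1,\beta_2,\epsilon)$ is the set of all $x\in M=\mathbb T^2$ for which there is a decomposition $T_xM=E^s_x\oplus E^u_x$ with $Df^t(E^s_x)=E^s_{f^tx}$, $Df^t(E^u_x)=E^u_{f^tx}$ for $t\in\mathbb Z$, satisfying for all $t\in\mathbb Z$, $n\ge1$: $\|Df^n|E^s_{f^tx}\|\le e^{\epsilon k}e^{-(\beta_1-\epsilon)n}e^{\epsilon|t|}$; $\|Df^{-n}|E^u_{f^tx}\|\le e^{\epsilon k}e^{-(\beta_2-\epsilon)n}e^{\epsilon|t|}$;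 $\tan(\angle(E^s_{f^tx},E^u_{f^tx}))\ge e^{-\epsilon k}e^{-\epsilon|t|}$. Here $\nu_0|\Lambda_k$ is the conditional measure $A\mapsto\nu_0(A\cap\Lambda_k)/\nu_0(\Lambda_k)$ (with support understood as $\emptyset$ if $\nu_0(\Lambda_k)=0$). Other notation: $\mathscr M_{\rm inv}(\mathbb T^2,f)$ is the set of $f$-invariant Borel probability measures; $\mathscr M_{\rm inv}(Z,f)$ is the subset of those $\nu$ with $\nu(Z)=1$. $h_\nu(f)$ is the metric entropy. $G_\nu$ is the set of $x$ such that $\frac1n\sum_{i=0}^{n-1}\delta_{f^ix}\to\nu$ in the weak-* topology. Topological pressure on subsets: put $B_n(x,\rho)=\{y:d(f^ix,f^iy)<\rho,\ 0\le i\le n-1\}$ and $S_n\psi(x)=\sum_{i=0}^{n-1}\psi(f^ix)$. For a Borel set $Z$, $t\in\mathbb R$, $n\in\mathbb N$, $\rho>0$, let $\Gamma_n(Z,\rho)$ be the collection of all finite or countable covers of $Z$ by sets $B_m(x,\rho)$ with $m\ge n$, and $$M(Z,t,\psi,n,\rho)=\inf_{\mathcal C\in\Gamma_n(Z,\rho)}\sum_{B_m(x,\rho)\in\mathcal C}\exp\Big(-tm+\sup_{y\in B_m(x,\rho)}S_m\psi(y)\Big),$$ $M(Z,t,\psi,\rho)=\lim_{n\to\infty}M(Z,t,\psi,n,\rho)$, $P(Z,\psi,\rho)=\inf\{t:M(Z,t,\psi,\rho)=0\}=\sup\{t:M(Z,t,\psi,\rho)=\infty\}$, and $P(Z,\psi)=\lim_{\rho\to0}P(Z,\psi,\rho)$.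 *)

theory Defs
  imports "HOL-Probability.Probability"
begin

section \<open>The flat torus\<close>

definition int_lattice :: "(real^2) set" where
  "int_lattice = {v. \<forall>i. v $ i \<in> \<int>}"

lemma int_lattice_0: "0 \<in> int_lattice"
  by (simp add: int_lattice_def)

lemma int_lattice_add: "u \<in> int_lattice \<Longrightarrow> v \<in> int_lattice \<Longrightarrow> u + v \<in> int_lattice"
  by (simp add: int_lattice_def)

lemma int_lattice_minus: "u \<in> int_lattice \<Longrightarrow> - u \<in> int_lattice"
  by (simp add: int_lattice_def)

lemma closed_int_lattice: "closed int_lattice"
proof -
  have "closed {v::real^2. v $ i \<in> \<int>}" for i
    using closed_vimage[OF closed_Ints, of "\<lambda>v::real^2. v $ i"]
    by (simp add: vimage_def continuous_on_component)
  then show ?thesis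
    unfolding int_lattice_def by (rule closed_Collect_all)
qed

quotient_type torus = "real^2" / "\<lambda>x y. x - y \<in> int_lattice"
  morphisms rep_torus proj
proof (rule equivpI)
  show "reflp (\<lambda>x y. x - y \<in> int_lattice)"
    by (simp add: reflp_def int_lattice_0)
  show "symp (\<lambda>x y. x - y \<in> int_lattice)"
    using int_lattice_minus by (fastforce simp: symp_def)
  show "transp (\<lambda>x y. x - y \<in> int_lattice)"
    using int_lattice_add by (fastforce simp: transp_def)
qed

lemma proj_eq_iff: "proj x = proj y \<longleftrightarrow> x - y \<in> int_lattice"
  by (rule torus.abs_eq_iff)

lemma proj_surj: obtains x where "proj x = p"
  by (metis Quotient3_abs_rep Quotient3_torus)

instantiation torus :: metric_space
begin

definition dist_torus :: "torus \<Rightarrow> torus \<Rightarrow> real" where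
  "dist_torus p q = Inf {dist x y |x y. proj x = p \<and> proj y = q}"

definition uniformity_torus :: "(torus \<times> torus) filter" where
  "uniformity_torus = (INF e\<in>{0<..}. principal {(x, y). dist x y < e})"

definition open_torus :: "torus set \<Rightarrow> bool" where
  "open_torus U \<longleftrightarrow> (\<forall>x\<in>U. \<forall>\<^sub>F (x', y) in uniformity. x' = x \<longrightarrow> y \<in> U)"

lemma dist_proj: "dist (proj x) (proj y) = infdist (x - y) int_lattice"
proof -
  have "{dist x' y' |x' y'. proj x' = proj x \<and> proj y' = proj y} = (\<lambda>z. dist (x - y) z) ` int_lattice"
    (is "?L = ?R")
  proof (intro set_eqI iffI)
    fix d assume "d \<in> ?L"
    then obtain x' y' where d: "d = dist x' y'" and "x' - x \<in> int_lattice" "y' - y \<in> int_lattice"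
      by (auto simp: proj_eq_iff)
    then have "(y' - y) + - (x' - x) \<in> int_lattice"
      by (intro int_lattice_add int_lattice_minus)
    moreover have "d = dist (x - y) ((y' - y) + - (x' - x))"
      by (simp add: d dist_norm algebra_simps)
    ultimately show "d \<in> ?R" by blast
  next
    fix d assume "d \<in> ?R"
    then obtain z where z: "z \<in> int_lattice" and d: "d = dist (x - y) z" by auto
    have "d = dist x (y + z)" by (simp add: d dist_norm algebra_simps)
    moreover have "proj (y + z) = proj y" using z by (simp add: proj_eq_iff)
    ultimately show "d \<in> ?L" by blast
  qed
  then show ?thesis
    using int_lattice_0 by (auto simp: dist_torus_def infdist_def)
qed

instance
proof
  show "uniformity = (INF e\<in>{0<..}. principal {(x::torus, y). dist x y < e})"
    by (rule uniformity_torus_def)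
  show "open U = (\<forall>x\<in>U. \<forall>\<^sub>F (x', y) in uniformity. x' = x \<longrightarrow> y \<in> U)" for U :: "torus set"
    by (rule open_torus_def)
next
  fix p q :: torus
  obtain x where x: "proj x = p" by (rule proj_surj)
  obtain y where y: "proj y = q" by (rule proj_surj)
  have ne: "int_lattice \<noteq> {}" using int_lattice_0 by auto
  have "dist p q = infdist (x - y) int_lattice"
    using dist_proj[of x y] x y by simp
  then show "dist p q = 0 \<longleftrightarrow> p = q"
    using in_closed_iff_infdist_zero[OF closed_int_lattice ne, of "x - y"] proj_eq_iff[of x y] x y
    by simp
next
  fix p q r :: torus
  obtain x where x: "proj x = p" by (rule proj_surj)
  obtain y where y: "proj y = q" by (rule proj_surj)
  obtain z where z: "proj z = r" by (rule proj_surj)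
  have ne: "int_lattice \<noteq> {}" using int_lattice_0 by auto
  have "infdist (x - y) int_lattice \<le> infdist (x - z) int_lattice + infdist (y - z) int_lattice"
  proof -
    obtain u where u: "u \<in> int_lattice" "infdist (x - z) int_lattice = dist (x - z) u"
      using infdist_attains_inf[OF closed_int_lattice ne] by blast
    obtain v where v: "v \<in> int_lattice" "infdist (y - z) int_lattice = dist (y - z) v"
      using infdist_attains_inf[OF closed_int_lattice ne] by blast
    have "u + - v \<in> int_lattice" using u v by (intro int_lattice_add int_lattice_minus)
    then have "infdist (x - y) int_lattice \<le> dist (x - y) (u + - v)" by (rule infdist_le)
    also have "\<dots> = norm ((x - z - u) - (y - z - v))" by (simp add: dist_norm algebra_simps)
    also have "\<dots> \<le> norm (x - z - u) + norm (y - z - v)" by (rule norm_triangle_ineq4)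
    finally show ?thesis using u v by (simp add: dist_norm)
  qed
  then show "dist p q \<le> dist p r + dist q r"
    using dist_proj[of x y] dist_proj[of x z] dist_proj[of y z] x y z by simp
qed

end

subsection \<open>Derivatives, with every tangent space identified with the plane\<close>

text \<open>A derivative of a torus map is the derivative of a local lift to the plane. It does not
  depend on the choice of the lift.\<close>

definition torus_has_derivative ::
    "(torus \<Rightarrow> torus) \<Rightarrow> (real^2 \<Rightarrow> real^2) \<Rightarrow> torus \<Rightarrow> bool" where
  "torus_has_derivative f L p \<longleftrightarrow>
     (\<exists>x F. proj x = p \<and> (\<forall>\<^sub>F y in nhds x. f (proj y) = proj (F y)) \<and> (F has_derivative L) (at x))"

definition torus_deriv :: "(torus \<Rightarrow> torus) \<Rightarrow> torus \<Rightarrow> real^2 \<Rightarrow> real^2" where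
  "torus_deriv f p = (THE L. torus_has_derivative f L p)"

definition C1_holder :: "real \<Rightarrow> (torus \<Rightarrow> torus) \<Rightarrow> bool" where
  "C1_holder \<alpha> f \<longleftrightarrow>
     (\<forall>p. \<exists>L. torus_has_derivative f L p) \<and>
     (\<exists>C. \<forall>p q. onorm (\<lambda>v. torus_deriv f p v - torus_deriv f q v) \<le> C * dist p q powr \<alpha>)"

definition C1_holder_diffeo :: "real \<Rightarrow> (torus \<Rightarrow> torus) \<Rightarrow> bool" where
  "C1_holder_diffeo \<alpha> f \<longleftrightarrow> bij f \<and> C1_holder \<alpha> f \<and> C1_holder \<alpha> (inv f)"

section \<open>The Katok map\<close>

definition cat_matrix :: "real^2^2" where
  "cat_matrix = vector [vector [2, 1], vector [1, 1]]"

lemma cat_matrix_mult: "cat_matrix *v x = vector [2 * x $ 1 + x $ 2, x $ 1 + x $ 2]"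
  by (simp add: vec_eq_iff forall_2 cat_matrix_def matrix_vector_mult_def sum_2)

lift_definition cat_map :: "torus \<Rightarrow> torus" is "\<lambda>x. cat_matrix *v x"
proof -
  fix x y :: "real^2" assume "x - y \<in> int_lattice"
  then have "cat_matrix *v (x - y) \<in> int_lattice"
    unfolding cat_matrix_mult int_lattice_def mem_Collect_eq forall_2 vector_2
    by (intro conjI Ints_add Ints_mult Ints_numeral) simp_all
  then show "cat_matrix *v x - cat_matrix *v y \<in> int_lattice"
    by (simp add: matrix_vector_mult_diff_distrib)
qed

definition cat_eigenvalue :: real where
  "cat_eigenvalue = (3 + sqrt 5) / 2"

definition unstable_vec :: "real^2" where
  "unstable_vec = sgn (vector [1, cat_eigenvalue - 2])"

definition stable_vec :: "real^2" where
  "stable_vec = sgn (vector [2 - cat_eigenvalue, 1])"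

lemma cat_eigenvalue_gt_1: "cat_eigenvalue > 1"
  by (simp add: cat_eigenvalue_def add_pos_nonneg)

lemma cat_eigenvalue_eq: "cat_eigenvalue * cat_eigenvalue = 3 * cat_eigenvalue - 1"
  by (simp add: cat_eigenvalue_def field_simps)

lemma inverse_cat_eigenvalue: "inverse cat_eigenvalue = 3 - cat_eigenvalue"
  by (rule inverse_unique) (simp add: right_diff_distrib cat_eigenvalue_eq)

lemma cat_matrix_unstable: "cat_matrix *v unstable_vec = cat_eigenvalue *\<^sub>R unstable_vec"
proof -
  have "cat_matrix *v vector [1, cat_eigenvalue - 2]
      = cat_eigenvalue *\<^sub>R (vector [1, cat_eigenvalue - 2] :: real^2)"
    by (simp add: cat_matrix_mult vec_eq_iff forall_2 right_diff_distrib cat_eigenvalue_eq)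
  then show ?thesis
    by (simp add: unstable_vec_def sgn_div_norm matrix_vector_mult_scaleR mult.commute)
qed

lemma cat_matrix_stable: "cat_matrix *v stable_vec = inverse cat_eigenvalue *\<^sub>R stable_vec"
proof -
  have "cat_matrix *v vector [2 - cat_eigenvalue, 1]
      = inverse cat_eigenvalue *\<^sub>R (vector [2 - cat_eigenvalue, 1] :: real^2)"
    by (simp add: cat_matrix_mult vec_eq_iff forall_2 inverse_cat_eigenvalue algebra_simps
        cat_eigenvalue_eq)
  then show ?thesis
    by (simp add: stable_vec_def sgn_div_norm matrix_vector_mult_scaleR mult.commute)
qed

lemma eigenvectors_orthonormal:
  "norm unstable_vec = 1" "norm stable_vec = 1" "unstable_vec \<bullet> stable_vec = 0"
proof -
  have "(vector [1, cat_eigenvalue - 2] :: real^2) $ 1 \<noteq> 0"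
       "(vector [2 - cat_eigenvalue, 1] :: real^2) $ 2 \<noteq> 0" by simp_all
  then have "(vector [1, cat_eigenvalue - 2] :: real^2) \<noteq> 0"
       "(vector [2 - cat_eigenvalue, 1] :: real^2) \<noteq> 0" by (metis zero_index)+
  then show "norm unstable_vec = 1" "norm stable_vec = 1"
    by (simp_all add: unstable_vec_def stable_vec_def norm_sgn)
  show "unstable_vec \<bullet> stable_vec = 0"
    by (simp add: unstable_vec_def stable_vec_def sgn_div_norm inner_vec_def sum_2 divide_inverse
        left_diff_distrib algebra_simps)
qed

definition eig_point :: "real \<times> real \<Rightarrow> torus" where
  "eig_point s = proj (fst s *\<^sub>R unstable_vec + snd s *\<^sub>R stable_vec)"

text \<open>Only the restriction of \<open>chi\<close> to the interval from 0 to 1 matters. Smoothness at the endpoint 1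
  is automatic because \<open>chi\<close> is constant near it.\<close>

definition katok_profile :: "(real \<Rightarrow> real) \<Rightarrow> real \<Rightarrow> bool" where
  "katok_profile chi r\<^sub>0 \<longleftrightarrow>
     0 < r\<^sub>0 \<and> r\<^sub>0 < 1 \<and>
     (\<forall>n. \<forall>u\<in>{0<..<1}. ((deriv ^^ n) chi) field_differentiable (at u)) \<and>
     chi 0 = 0 \<and> (\<forall>u\<in>{r\<^sub>0..1}. chi u = 1) \<and>
     (\<forall>u\<in>{0<..<r\<^sub>0}. deriv chi u > 0) \<and>
     set_integrable lborel {0..1} (\<lambda>u. 1 / chi u)"

definition katok_solution :: "(real \<Rightarrow> real) \<Rightarrow> (real \<Rightarrow> real) \<Rightarrow> (real \<Rightarrow> real) \<Rightarrow> bool" where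
  "katok_solution chi s\<^sub>1 s\<^sub>2 \<longleftrightarrow> (\<forall>t\<in>{0..1}.
     (s\<^sub>1 has_real_derivative s\<^sub>1 t * chi ((s\<^sub>1 t)\<^sup>2 + (s\<^sub>2 t)\<^sup>2) * ln cat_eigenvalue) (at t within {0..1}) \<and>
     (s\<^sub>2 has_real_derivative - s\<^sub>2 t * chi ((s\<^sub>1 t)\<^sup>2 + (s\<^sub>2 t)\<^sup>2) * ln cat_eigenvalue) (at t within {0..1}))"

definition katok_time_one :: "(real \<Rightarrow> real) \<Rightarrow> real \<Rightarrow> (real \<times> real \<Rightarrow> real \<times> real) \<Rightarrow> bool" where
  "katok_time_one chi r\<^sub>1 g \<longleftrightarrow> (\<forall>s\<in>cball 0 r\<^sub>1.
     \<exists>s\<^sub>1 s\<^sub>2. katok_solution chi s\<^sub>1 s\<^sub>2 \<and> (s\<^sub>1 0, s\<^sub>2 0) = s \<and> (s\<^sub>1 1, s\<^sub>2 1) = g s)"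

text \<open>The condition \<open>cat_eigenvalue * r\<^sub>1 < 1\<close> on the larger radius ensures that the disk is embedded in the torus
  (its radius is less than 1/2) and that the trajectories of length 1 starting in it stay in the
  unit disk, where \<open>chi (s\<^sub>1\<^sup>2 + s\<^sub>2\<^sup>2)\<close> is prescribed. No smallness of \<open>r\<^sub>0\<close> relative to \<open>r\<^sub>1\<close> is imposed:
  \<open>f\<close> is continuous on the boundary of the disk only if \<open>chi = 1\<close> along all trajectories of length 1
  starting there, so requiring that \<open>f\<close> be a diffeomorphism subsumes it.\<close>

definition katok_map :: "(real \<Rightarrow> real) \<Rightarrow> real \<Rightarrow> real \<Rightarrow> (torus \<Rightarrow> torus) \<Rightarrow> bool" where
  "katok_map chi r\<^sub>0 r\<^sub>1 f \<longleftrightarrow>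
     katok_profile chi r\<^sub>0 \<and> r\<^sub>0 < r\<^sub>1 \<and> cat_eigenvalue * r\<^sub>1 < 1 \<and>
     (\<exists>g. katok_time_one chi r\<^sub>1 g \<and> (\<forall>s\<in>cball 0 r\<^sub>1. f (eig_point s) = eig_point (g s))) \<and>
     (\<forall>x. x \<notin> eig_point ` cball 0 r\<^sub>1 \<longrightarrow> f x = cat_map x)"

section \<open>Invariant measures, entropy and generic points\<close>

definition borel_probs :: "'a::topological_space measure set" where
  "borel_probs = {\<mu>. sets \<mu> = sets borel \<and> prob_space \<mu>}"

definition weak_star :: "'a::topological_space measure topology" where
  "weak_star = topology_generated_by
     {{\<mu> \<in> borel_probs. (\<integral>x. \<phi> x \<partial>\<mu>) \<in> V} |\<phi> V.
        continuous_on UNIV (\<phi> :: 'a \<Rightarrow> real) \<and> bounded (range \<phi>) \<and> open V}"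

definition M_inv :: "'a::topological_space set \<Rightarrow> ('a \<Rightarrow> 'a) \<Rightarrow> 'a measure set" where
  "M_inv Z f = {\<nu> \<in> borel_probs. distr \<nu> borel f = \<nu> \<and> emeasure \<nu> Z = 1}"

definition ergodic :: "('a::topological_space \<Rightarrow> 'a) \<Rightarrow> 'a measure \<Rightarrow> bool" where
  "ergodic f \<nu> \<longleftrightarrow> \<nu> \<in> M_inv UNIV f \<and>
     (\<forall>A\<in>sets borel. f -` A = A \<longrightarrow> emeasure \<nu> A = 0 \<or> emeasure \<nu> A = 1)"

definition partition_entropy :: "'a measure \<Rightarrow> 'a set set \<Rightarrow> real" where
  "partition_entropy \<mu> P = - (\<Sum>A\<in>P. measure \<mu> A * ln (measure \<mu> A))"

definition iterated_join :: "('a \<Rightarrow> 'a) \<Rightarrow> nat \<Rightarrow> 'a set set \<Rightarrow> 'a set set" where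
  "iterated_join f n P = {\<Inter>i<n. (f ^^ i) -` a i |a. \<forall>i<n. a i \<in> P} - {{}}"

definition metric_entropy :: "('a::topological_space \<Rightarrow> 'a) \<Rightarrow> 'a measure \<Rightarrow> ereal" where
  "metric_entropy f \<mu> =
     (SUP P\<in>{P. finite P \<and> P \<subseteq> sets borel \<and> partition_on UNIV P}.
        ereal (lim (\<lambda>n. partition_entropy \<mu> (iterated_join f n P) / real n)))"

definition max_entropy_measure :: "('a::topological_space \<Rightarrow> 'a) \<Rightarrow> 'a measure \<Rightarrow> bool" where
  "max_entropy_measure f \<mu> \<longleftrightarrow>
     \<mu> \<in> M_inv UNIV f \<and> (\<forall>\<nu>\<in>M_inv UNIV f. metric_entropy f \<nu> \<le> metric_entropy f \<mu>)"

definition empirical_measure :: "('a::topological_space \<Rightarrow> 'a) \<Rightarrow> nat \<Rightarrow> 'a \<Rightarrow> 'a measure" where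
  "empirical_measure f n x = distr (uniform_count_measure {..<n}) borel (\<lambda>i. (f ^^ i) x)"

definition generic_points :: "('a::topological_space \<Rightarrow> 'a) \<Rightarrow> 'a measure \<Rightarrow> 'a set" where
  "generic_points f \<nu> = {x. limitin weak_star (\<lambda>n. empirical_measure f n x) \<nu> sequentially}"

definition measure_support :: "'a::topological_space measure \<Rightarrow> 'a set" where
  "measure_support \<mu> = {x. \<forall>U. open U \<longrightarrow> x \<in> U \<longrightarrow> emeasure \<mu> U > 0}"

section \<open>Topological pressure on subsets\<close>

definition bowen_ball :: "('a::metric_space \<Rightarrow> 'a) \<Rightarrow> nat \<Rightarrow> 'a \<Rightarrow> real \<Rightarrow> 'a set" where
  "bowen_ball f n x \<rho> = {y. \<forall>i<n. dist ((f ^^ i) x) ((f ^^ i) y) < \<rho>}"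

definition birkhoff_sum :: "('a \<Rightarrow> 'a) \<Rightarrow> nat \<Rightarrow> ('a \<Rightarrow> real) \<Rightarrow> 'a \<Rightarrow> real" where
  "birkhoff_sum f n \<psi> x = (\<Sum>i<n. \<psi> ((f ^^ i) x))"

text \<open>A cover is given by the set of pairs of a center and a length, since the summands depend on
  the length and not only on the Bowen ball as a set.\<close>

definition bowen_covers :: "('a::metric_space \<Rightarrow> 'a) \<Rightarrow> 'a set \<Rightarrow> nat \<Rightarrow> real \<Rightarrow> ('a \<times> nat) set set" where
  "bowen_covers f Z n \<rho> =
     {C. countable C \<and> (\<forall>(x, m)\<in>C. n \<le> m) \<and> Z \<subseteq> (\<Union>(x, m)\<in>C. bowen_ball f m x \<rho>)}"

definition pressure_sum ::
    "('a::metric_space \<Rightarrow> 'a) \<Rightarrow> 'a set \<Rightarrow> real \<Rightarrow> ('a \<Rightarrow> real) \<Rightarrow> nat \<Rightarrow> real \<Rightarrow> ennreal" where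
  "pressure_sum f Z t \<psi> n \<rho> =
     (INF C\<in>bowen_covers f Z n \<rho>.
        \<Sum>\<^sub>\<infinity>(x, m)\<in>C. ennreal (exp (- t * real m + (SUP y\<in>bowen_ball f m x \<rho>. birkhoff_sum f m \<psi> y))))"

definition pressure_outer ::
    "('a::metric_space \<Rightarrow> 'a) \<Rightarrow> 'a set \<Rightarrow> real \<Rightarrow> ('a \<Rightarrow> real) \<Rightarrow> real \<Rightarrow> ennreal" where
  "pressure_outer f Z t \<psi> \<rho> = lim (\<lambda>n. pressure_sum f Z t \<psi> n \<rho>)"

definition pressure_scale ::
    "('a::metric_space \<Rightarrow> 'a) \<Rightarrow> 'a set \<Rightarrow> ('a \<Rightarrow> real) \<Rightarrow> real \<Rightarrow> ereal" where
  "pressure_scale f Z \<psi> \<rho> = Inf {ereal t |t. pressure_outer f Z t \<psi> \<rho> = 0}"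

definition pressure :: "('a::metric_space \<Rightarrow> 'a) \<Rightarrow> 'a set \<Rightarrow> ('a \<Rightarrow> real) \<Rightarrow> ereal" where
  "pressure f Z \<psi> = Lim (at_right 0) (\<lambda>\<rho>. pressure_scale f Z \<psi> \<rho>)"

section \<open>Pesin blocks\<close>

definition int_iterate :: "('a \<Rightarrow> 'a) \<Rightarrow> int \<Rightarrow> 'a \<Rightarrow> 'a" where
  "int_iterate f t = (if t \<ge> 0 then f ^^ nat t else inv f ^^ nat (- t))"

definition restricted_norm :: "(real^2 \<Rightarrow> real^2) \<Rightarrow> (real^2) set \<Rightarrow> real" where
  "restricted_norm L E = (SUP v\<in>{v \<in> E. norm v \<le> 1}. norm (L v))"

text \<open>All angles are at most \<open>pi / 2\<close>; inserting \<open>pi / 2\<close> only fixes the value when one of the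
  subspaces is trivial.\<close>

definition subspace_angle :: "(real^2) set \<Rightarrow> (real^2) set \<Rightarrow> real" where
  "subspace_angle E F =
     Inf (insert (pi / 2) {arccos (\<bar>v \<bullet> w\<bar> / (norm v * norm w)) |v w. v \<in> E - {0} \<and> w \<in> F - {0}})"

text \<open>The real function \<open>tan\<close> has the value 0 at \<open>pi / 2\<close>, whereas the tangent of a right angle has
  to be infinite here.\<close>

definition tan_angle :: "(real^2) set \<Rightarrow> (real^2) set \<Rightarrow> ereal" where
  "tan_angle E F = (if subspace_angle E F = pi / 2 then \<infinity> else ereal (tan (subspace_angle E F)))"

definition pesin_block :: "(torus \<Rightarrow> torus) \<Rightarrow> real \<Rightarrow> real \<Rightarrow> real \<Rightarrow> nat \<Rightarrow> torus set" where
  "pesin_block f \<beta>\<^sub>1 \<beta>\<^sub>2 \<epsilon> k = {x. \<exists>Es Eu :: torus \<Rightarrow> (real^2) set.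
     subspace (Es x) \<and> subspace (Eu x) \<and> Es x \<inter> Eu x = {0} \<and>
     {v + w |v w. v \<in> Es x \<and> w \<in> Eu x} = UNIV \<and>
     (\<forall>t. Es (int_iterate f t x) = torus_deriv (int_iterate f t) x ` Es x \<and>
          Eu (int_iterate f t x) = torus_deriv (int_iterate f t) x ` Eu x) \<and>
     (\<forall>t. \<forall>n\<ge>1. let y = int_iterate f t x in
        restricted_norm (torus_deriv (int_iterate f (int n)) y) (Es y)
          \<le> exp (\<epsilon> * real k) * exp (- (\<beta>\<^sub>1 - \<epsilon>) * real n) * exp (\<epsilon> * real_of_int \<bar>t\<bar>) \<and>
        restricted_norm (torus_deriv (int_iterate f (- int n)) y) (Eu y)
          \<le> exp (\<epsilon> * real k) * exp (- (\<beta>\<^sub>2 - \<epsilon>) * real n) * exp (\<epsilon> * real_of_int \<bar>t\<bar>) \<and>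
        tan_angle (Es y) (Eu y) \<ge> ereal (exp (- \<epsilon> * real k) * exp (- \<epsilon> * real_of_int \<bar>t\<bar>)))}"

text \<open>If the block is a null set, the conditional measure \<open>uniform_measure\<close> is the null measure,
  whose support is empty.\<close>

definition pesin_support ::
    "(torus \<Rightarrow> torus) \<Rightarrow> torus measure \<Rightarrow> real \<Rightarrow> real \<Rightarrow> real \<Rightarrow> torus set" where
  "pesin_support f \<mu> \<beta>\<^sub>1 \<beta>\<^sub>2 \<epsilon> =
     (\<Union>k\<in>{1..}. measure_support (uniform_measure \<mu> (pesin_block f \<beta>\<^sub>1 \<beta>\<^sub>2 \<epsilon> k)))"

end

(* The map f is topologically conjugate to the cat map, in which orbit segments can be glued with
   arbitrary jumps: the correction is a bounded solution of a linear recursion, and it decays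
   exponentially with the distance to the jumps. This property passes to f and replaces both
   Pesin theory and the specification property.

   Lower bound. Draw orbit segments of the lengths 1, 2, 3, ... independently from \<nu> and glue them. By
   Hoeffding's inequality and the Borel-Cantelli lemma the resulting orbit is almost surely generic for
   \<nu>, although \<nu> need not be ergodic. The probability of a Bowen ball is bounded by the product of
   the \<nu>-measures of the Bowen balls of the segments. The mean of their information is at least the block entropy of
   any finite partition, up to a small error, and a mass distribution argument concludes.

   Upper bound. Along a generic orbit the information of N-blocks, approximated by a continuous
   function, has Birkhoff averages close to the block entropy H N. Averaging over the residue classes
   modulo N bounds the number of separated orbit segments of length k N by exp (k (H N + \<delta>)) up to a
   constant. *)
theory Submission
  imports Defs
begin

section \<open>The torus and shadowing for the cat map\<close>

text \<open>The block lengths grow because every junction spoils a fixed number of times on either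
  side, for each prescribed error: blocks of bounded length would spoil a positive proportion of the
  orbit. With lengths 1, 2, 3, ... the first \<open>k\<close> blocks fill about
  \<open>k^2 / 2\<close> times, while the junctions and the unfinished block cost only a multiple of
  \<open>k\<close>. The averages run over independent draws, so one law of large numbers does the
  work of the ergodic theorem and of the Shannon-McMillan-Breiman theorem, and its limit is the full
  integral instead of that of an ergodic component.

  Two obstacles shape the lower bound. A Bowen ball may meet exponentially many cells of a
  partition, because orbits pass near the boundaries of cells; compact cores make such visits rare
  and a weight makes them cheap. And the information of a Bowen ball may be unbounded, so it is
  truncated at a linear level before Hoeffding's inequality is applied.

  In the upper bound, genericity controls continuous functions, whereas the measure of the cell of a
  point is discontinuous; a continuous majorant replaces it.\<close>

lemma dist_proj_le: "dist (proj x) (proj y) \<le> dist x y"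
  using infdist_le[OF int_lattice_0, of "x - y"] by (simp add: dist_proj dist_norm)

lemma continuous_on_proj: "continuous_on S proj"
  by (rule continuous_onI) (metis dist_proj_le le_less_trans order_less_imp_le)

lemma proj_add_lattice: "z \<in> int_lattice \<Longrightarrow> proj (x + z) = proj x"
  by (simp add: proj_eq_iff)

text \<open>The coordinates of \<open>e\<close> are fractional parts, so the bound is uniform in
  \<open>v\<close> and \<open>p\<close>. It bounds every jump of a lifted pseudo-orbit.\<close>

lemma proj_near:
  obtains e where "proj (v + e) = p" "norm e \<le> 2"
proof -
  obtain w where w: "proj w = p" by (rule proj_surj)
  define e :: "real^2" where "e = (\<chi> i. frac (w $ i - v $ i))"
  have "v + e - w \<in> int_lattice"
    by (auto simp: int_lattice_def e_def frac_def)
  then have "proj (v + e) = p"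
    using w proj_eq_iff by blast
  moreover have "norm e \<le> (\<Sum>i\<in>UNIV. \<bar>e $ i\<bar>)" by (rule norm_le_l1_cart)
  then have "norm e \<le> \<bar>e $ 1\<bar> + \<bar>e $ 2\<bar>" by (simp add: sum_2)
  moreover have "\<bar>e $ i\<bar> \<le> 1" for i
    using frac_ge_0[of "w $ i - v $ i"] frac_lt_1[of "w $ i - v $ i"] by (simp add: e_def)
  moreover note this[of 1] this[of 2]
  ultimately have "norm e \<le> 2" by linarith
  with \<open>proj (v + e) = p\<close> show ?thesis by (rule that)
qed

section \<open>The torus as a compact Polish space\<close>

lemma compact_torus: "compact (UNIV :: torus set)"
proof -
  have "proj ` cball 0 2 = UNIV"
  proof (intro equalityI subsetI)
    fix p :: torus
    obtain e where "proj (0 + e) = p" "norm e \<le> 2" by (rule proj_near)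
    then show "p \<in> proj ` cball 0 2" by (auto intro!: image_eqI[of _ _ e])
  qed simp
  then show ?thesis
    using compact_continuous_image[OF continuous_on_proj compact_cball] by metis
qed

text \<open>Completeness follows from compactness; balls with small radii \<open>1 / Suc n\<close>
  about the projection of a countable dense set form a basis. The class gives access to inner
  regularity by compact sets and to measurability of the distance on products.\<close>

instance torus :: polish_space
proof
  show "convergent X" if "Cauchy X" for X :: "nat \<Rightarrow> torus"
    using compact_imp_complete[OF compact_torus] that by (auto simp: complete_def convergent_def)
  obtain D :: "(real^2) set" where D: "countable D"
    "\<And>X. open X \<Longrightarrow> X \<noteq> {} \<Longrightarrow> \<exists>d\<in>D. d \<in> X"
    using countable_dense_exists by blast
  define B where "B = (\<lambda>(d, n). ball (proj d) (1 / real (Suc n))) ` (D \<times> UNIV)"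
  have "topological_basis B"
    unfolding topological_basis_iff[of B, simplified]
  proof (subst topological_basis_iff)
    show "open B'" if "B' \<in> B" for B' using that by (auto simp: B_def)
    show "\<forall>O'. open O' \<longrightarrow> (\<forall>x\<in>O'. \<exists>B'\<in>B. x \<in> B' \<and> B' \<subseteq> O')"
    proof (intro allI impI ballI)
      fix O' :: "torus set" and p assume O': "open O'" and p: "p \<in> O'"
      obtain e where e: "e > 0" "ball p e \<subseteq> O'" using O' p openE by blast
      obtain n where n: "1 / real (Suc n) < e / 2" using e nat_approx_posE[of "e/2"] by auto
      obtain x where x: "proj x = p" by (rule proj_surj)
      obtain d where d: "d \<in> D" "d \<in> ball x (1 / real (Suc n))"
        using D(2)[of "ball x (1 / real (Suc n))"] by auto
      have "dist (proj d) p < 1 / real (Suc n)"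
        using dist_proj_le[of d x] d x by (simp add: dist_commute)
      moreover have "ball (proj d) (1 / real (Suc n)) \<subseteq> ball p e"
      proof
        fix q assume "q \<in> ball (proj d) (1 / real (Suc n))"
        then show "q \<in> ball p e"
          using calculation n dist_triangle[of p q "proj d"] by (simp add: dist_commute)
      qed
      ultimately show "\<exists>B'\<in>B. p \<in> B' \<and> B' \<subseteq> O'"
        using d e by (intro bexI[of _ "ball (proj d) (1 / real (Suc n))"])
          (auto simp: B_def intro!: image_eqI[of _ _ "(d, n)"])
    qed
  qed
  moreover have "countable B" using D(1) by (auto simp: B_def)
  ultimately show "\<exists>B::torus set set. countable B \<and> open = generate_topology B"
    using topological_basis_imp_subbasis by blast
qed

text \<open>The stable coordinate of the correction, solved forward from 0. Past jumps are forgotten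
  at the rate \<open>c\<close>, so \<open>L\<close> steps without a jump gain the factor
  \<open>c ^ L\<close> over the uniform bound. A window reaching back beyond time 0 is harmless
  because \<open>z 0 = 0\<close>.\<close>

lemma contraction_bound:
  fixes z e :: "nat \<Rightarrow> real"
  assumes c: "0 \<le> c" "c < 1" and z0: "z 0 = 0" and z: "\<And>t. z (Suc t) = c * z t - e t"
    and e: "\<And>t. \<bar>e t\<bar> \<le> B" and quiet: "\<And>s. s < t \<Longrightarrow> t \<le> s + L \<Longrightarrow> e s = 0"
  shows "\<bar>z t\<bar> \<le> B / (1 - c) * c ^ L"
  using quiet
proof (induction L arbitrary: t)
  case 0
  have B: "0 \<le> B" using e[of 0] by linarith
  have "\<bar>z t\<bar> \<le> B / (1 - c)" for t
  proof (induction t)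
    case (Suc t)
    have "\<bar>z (Suc t)\<bar> \<le> c * \<bar>z t\<bar> + \<bar>e t\<bar>"
      unfolding z by (metis abs_mult abs_of_nonneg abs_triangle_ineq4 c(1))
    also have "\<dots> \<le> c * (B / (1 - c)) + B"
      by (intro add_mono mult_left_mono Suc e c)
    also have "\<dots> = B / (1 - c)" using c by (simp add: field_simps)
    finally show ?case .
  qed (use z0 B c in simp)
  then show ?case by simp
next
  case (Suc L)
  show ?case
  proof (cases t)
    case 0
    then show ?thesis using z0 e[of 0] c by simp
  next
    case (Suc s)
    have "z t = c * z s" using Suc.prems[of s] z[of s] by (simp add: Suc)
    moreover have "\<bar>z s\<bar> \<le> B / (1 - c) * c ^ L"
      by (rule Suc.IH) (use Suc.prems Suc in auto)
    then have "c * \<bar>z s\<bar> \<le> c * (B / (1 - c) * c ^ L)" using c by (rule_tac mult_left_mono)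
    ultimately show ?thesis using c by (simp add: abs_mult mult_ac)
  qed
qed

text \<open>The unstable coordinate of the correction. Solving forward would blow up, so the bounded
  solution is the convergent series over the future jumps, and the quiet window lies after
  \<open>t\<close> instead of before it.\<close>

lemma expansion_bounded_orbit:
  fixes e :: "nat \<Rightarrow> real"
  assumes c: "0 \<le> c" "c < 1" and e: "\<And>t. \<bar>e t\<bar> \<le> B"
  obtains z where "\<And>t. z t = c * (z (Suc t) + e t)"
    "\<And>t L. (\<And>s. t \<le> s \<Longrightarrow> s < t + L \<Longrightarrow> e s = 0) \<Longrightarrow> \<bar>z t\<bar> \<le> B / (1 - c) * c ^ L"
proof -
  have B: "0 \<le> B" using e[of 0] by linarith
  have bnd: "\<bar>c ^ Suc j * e (t + j)\<bar> \<le> B * c ^ j" for t j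
  proof -
    have "\<bar>c ^ Suc j * e (t + j)\<bar> = c ^ j * (c * \<bar>e (t + j)\<bar>)"
      using c by (simp add: abs_mult)
    also have "\<dots> \<le> c ^ j * (1 * B)"
      using c e by (intro mult_left_mono mult_mono) auto
    finally show ?thesis by (simp add: mult.commute)
  qed
  have geo: "summable (\<lambda>j. B * c ^ j)" "(\<Sum>j. B * c ^ j) = B / (1 - c)"
    using c suminf_geometric[of c] by (simp_all add: suminf_mult summable_geometric)
  have summ: "summable (\<lambda>j. c ^ Suc j * e (t + j))" for t
    using bnd by (intro summable_comparison_test[OF _ geo(1)]) auto
  define z where "z t = (\<Sum>j. c ^ Suc j * e (t + j))" for t
  have rec: "z t = c * (z (Suc t) + e t)" for t
  proof -
    have "z t = c * e t + (\<Sum>j. c ^ Suc (Suc j) * e (t + Suc j))"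
      unfolding z_def using suminf_split_head[OF summ, of t] by simp
    also have "(\<Sum>j. c ^ Suc (Suc j) * e (t + Suc j)) = c * z (Suc t)"
      unfolding z_def by (subst suminf_mult[OF summ, symmetric]) (simp add: mult.assoc)
    finally show ?thesis by (simp add: algebra_simps)
  qed
  have "\<bar>z t\<bar> \<le> B / (1 - c) * c ^ L" if "\<And>s. t \<le> s \<Longrightarrow> s < t + L \<Longrightarrow> e s = 0" for t L
    using that
  proof (induction L arbitrary: t)
    case 0
    have sa: "summable (\<lambda>j. \<bar>c ^ Suc j * e (t + j)\<bar>)"
      using bnd by (intro summable_comparison_test[OF _ geo(1)]) auto
    have "\<bar>z t\<bar> \<le> (\<Sum>j. \<bar>c ^ Suc j * e (t + j)\<bar>)"
      unfolding z_def by (rule summable_rabs[OF sa])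
    also have "\<dots> \<le> (\<Sum>j. B * c ^ j)" by (rule suminf_le[OF bnd sa geo(1)])
    finally show ?case using geo(2) by simp
  next
    case (Suc L)
    have "z t = c * z (Suc t)" using rec[of t] Suc.prems[of t] by simp
    moreover have "\<bar>z (Suc t)\<bar> \<le> B / (1 - c) * c ^ L"
      by (rule Suc.IH) (use Suc.prems in auto)
    then have "c * \<bar>z (Suc t)\<bar> \<le> c * (B / (1 - c) * c ^ L)" using c by (rule_tac mult_left_mono)
    ultimately show ?case using c by (simp add: abs_mult mult_ac)
  qed
  then show ?thesis using that rec by blast
qed

lemma cat_map_proj: "cat_map (proj x) = proj (cat_matrix *v x)"
  by (rule cat_map.abs_eq)

text \<open>The remainder is orthogonal to both eigenvectors; in coordinates these are two linear
  equations with determinant \<open>1 + c * c\<close>.\<close>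

lemma eigenbasis_decomposition:
  "v = (v \<bullet> unstable_vec) *\<^sub>R unstable_vec + (v \<bullet> stable_vec) *\<^sub>R stable_vec"
proof -
  define r where "r = v - (v \<bullet> unstable_vec) *\<^sub>R unstable_vec - (v \<bullet> stable_vec) *\<^sub>R stable_vec"
  have n: "unstable_vec \<bullet> unstable_vec = 1" "stable_vec \<bullet> stable_vec = 1"
    using eigenvectors_orthonormal by (simp_all add: dot_square_norm)
  have o: "unstable_vec \<bullet> stable_vec = 0" "stable_vec \<bullet> unstable_vec = 0"
    using eigenvectors_orthonormal by (simp_all add: inner_commute)
  have ru: "r \<bullet> unstable_vec = 0" and rs: "r \<bullet> stable_vec = 0"
    using n o by (simp_all add: r_def inner_diff_left)
  define c where "c = cat_eigenvalue - 2"
  have "(vector [1, c] :: real^2) = norm (vector [1, c] :: real^2) *\<^sub>R unstable_vec"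
    by (simp add: unstable_vec_def sgn_div_norm c_def vec_eq_iff forall_2)
  then have "r \<bullet> (vector [1, c] :: real^2) = 0"
    using ru by (metis inner_scaleR_right mult_zero_right)
  then have a: "r $ 1 + c * r $ 2 = 0" by (simp add: inner_vec_def sum_2 mult.commute)
  have "(vector [- c, 1] :: real^2) = norm (vector [- c, 1] :: real^2) *\<^sub>R stable_vec"
    by (simp add: stable_vec_def sgn_div_norm c_def vec_eq_iff forall_2)
  then have "r \<bullet> (vector [- c, 1] :: real^2) = 0"
    using rs by (metis inner_scaleR_right mult_zero_right)
  then have b: "r $ 2 = c * r $ 1" by (simp add: inner_vec_def sum_2 mult.commute)
  have "(1 + c * c) * r $ 1 = 0" using a b by (simp add: algebra_simps)
  moreover have "1 + c * c > 0" by (simp add: add_pos_nonneg)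
  ultimately have "r $ 1 = 0" by auto
  then have "r = 0" using b by (simp add: vec_eq_iff forall_2)
  then show ?thesis unfolding r_def by (simp add: algebra_simps)
qed

text \<open>The pseudo-orbit lifts to a chain \<open>q\<close> in the plane that follows the matrix
  up to errors \<open>e\<close>, and \<open>q + z\<close> is a true orbit iff \<open>z\<close>
  solves a linear recursion driven by \<open>- e\<close>. In the eigenbasis the recursion splits
  into a contraction, governed by past jumps, and an expansion, governed by future ones; hence the
  window on both sides of \<open>t\<close>. The constant 4 counts two coordinates with jumps of size
  at most 2.\<close>

lemma cat_map_shadowing_estimate:
  fixes p :: "nat \<Rightarrow> torus"
  obtains y where "\<And>t L. (\<And>s. s < t + L \<Longrightarrow> t \<le> s + L \<Longrightarrow> p (Suc s) = cat_map (p s)) \<Longrightarrow>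
     dist ((cat_map ^^ t) y) (p t) \<le> 4 / (1 - inverse cat_eigenvalue) * inverse cat_eigenvalue ^ L"
proof -
  let ?A = "\<lambda>x. cat_matrix *v x"
  define c where "c = inverse cat_eigenvalue"
  have c: "0 \<le> c" "c < 1" "c * cat_eigenvalue = 1"
    using cat_eigenvalue_gt_1 by (auto simp: c_def inverse_less_1_iff)
  \<comment> \<open>The last clause forces the error to vanish wherever \<open>p\<close> follows the
    map, so that only jumps drive the recursion.\<close>
  have ex: "\<exists>e. proj (?A q + e) = p' \<and> norm e \<le> 2 \<and> (p' = cat_map (proj q) \<longrightarrow> e = 0)" for q p'
  proof (cases "p' = cat_map (proj q)")
    case True
    then show ?thesis by (intro exI[of _ 0]) (simp add: cat_map_proj)
  next
    case False
    then show ?thesis using proj_near[of "?A q" p'] by metis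
  qed
  define err where "err q p' = (SOME e. proj (?A q + e) = p' \<and> norm e \<le> 2 \<and>
      (p' = cat_map (proj q) \<longrightarrow> e = 0))" for q p'
  have err: "proj (?A q + err q p') = p'" "norm (err q p') \<le> 2"
    "p' = cat_map (proj q) \<Longrightarrow> err q p' = 0" for q p'
    using someI_ex[OF ex[of q p']] unfolding err_def by blast+
  obtain q0 where q0: "proj q0 = p 0" by (rule proj_surj)
  define q where "q = rec_nat q0 (\<lambda>t v. ?A v + err v (p (Suc t)))"
  define e where "e t = err (q t) (p (Suc t))" for t
  have q_Suc: "q (Suc t) = ?A (q t) + e t" and q_0: "q 0 = q0" for t
    by (simp_all add: q_def e_def)
  have qp: "proj (q t) = p t" for t
    by (cases t) (simp_all add: q_0 q0 q_Suc e_def err)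
  have e0: "e t = 0" if "p (Suc t) = cat_map (p t)" for t
    using err(3)[of "p (Suc t)" "q t"] that by (simp add: e_def qp)
  have eB: "\<bar>e t \<bullet> v\<bar> \<le> 2" if "norm v = 1" for t v
    using Cauchy_Schwarz_ineq2[of "e t" v] err(2)[of "q t" "p (Suc t)"] that by (simp add: e_def)
  define zs where "zs = rec_nat 0 (\<lambda>t z. c * z - e t \<bullet> stable_vec)"
  have zs: "zs 0 = 0" "zs (Suc t) = c * zs t - e t \<bullet> stable_vec" for t
    by (simp_all add: zs_def)
  obtain zu where zu: "\<And>t. zu t = c * (zu (Suc t) + e t \<bullet> unstable_vec)"
    "\<And>t L. (\<And>s. t \<le> s \<Longrightarrow> s < t + L \<Longrightarrow> e s \<bullet> unstable_vec = 0) \<Longrightarrow>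
       \<bar>zu t\<bar> \<le> 2 / (1 - c) * c ^ L"
    by (rule expansion_bounded_orbit[OF c(1,2), of "\<lambda>t. e t \<bullet> unstable_vec" 2,
          OF eB[OF eigenvectors_orthonormal(1)]]) blast
  have zu': "zu (Suc t) = cat_eigenvalue * zu t - e t \<bullet> unstable_vec" for t
    using zu(1)[of t] c(3) by (simp add: mult.assoc[symmetric] mult.commute)
  define z where "z t = zu t *\<^sub>R unstable_vec + zs t *\<^sub>R stable_vec" for t
  have z_Suc: "z (Suc t) = ?A (z t) - e t" for t
  proof -
    have "?A (z t) = (cat_eigenvalue * zu t) *\<^sub>R unstable_vec + (c * zs t) *\<^sub>R stable_vec"
      by (simp add: z_def matrix_vector_right_distrib matrix_vector_mult_scaleR cat_matrix_unstable
          cat_matrix_stable c_def mult.commute)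
    then have "?A (z t) - e t = (cat_eigenvalue * zu t) *\<^sub>R unstable_vec + (c * zs t) *\<^sub>R stable_vec
       - ((e t \<bullet> unstable_vec) *\<^sub>R unstable_vec + (e t \<bullet> stable_vec) *\<^sub>R stable_vec)"
      using eigenbasis_decomposition[of "e t"] by simp
    then show ?thesis by (simp add: z_def zu' zs algebra_simps)
  qed
  have orbit: "(cat_map ^^ t) (proj (q 0 + z 0)) = proj (q t + z t)" for t
    by (induction t) (simp_all add: cat_map_proj q_Suc z_Suc matrix_vector_right_distrib)
  show ?thesis
  proof (rule that[of "proj (q 0 + z 0)"])
    fix t L assume quiet: "\<And>s. s < t + L \<Longrightarrow> t \<le> s + L \<Longrightarrow> p (Suc s) = cat_map (p s)"
    have "\<bar>zu t\<bar> \<le> 2 / (1 - c) * c ^ L"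
      by (rule zu(2)) (use quiet e0 in auto)
    moreover have "\<bar>zs t\<bar> \<le> 2 / (1 - c) * c ^ L"
      by (rule contraction_bound[OF c(1,2) zs(1) zs(2) eB[OF eigenvectors_orthonormal(2)]])
        (use quiet e0 in auto)
    moreover have "norm (z t) \<le> \<bar>zu t\<bar> + \<bar>zs t\<bar>"
      unfolding z_def using norm_triangle_ineq[of "zu t *\<^sub>R unstable_vec" "zs t *\<^sub>R stable_vec"]
      by (simp add: eigenvectors_orthonormal)
    ultimately have "norm (z t) \<le> 4 / (1 - c) * c ^ L" by simp
    moreover have "dist (proj (q t + z t)) (p t) \<le> norm (z t)"
      using dist_proj_le[of "q t + z t" "q t"] by (simp add: qp dist_norm)
    ultimately show "dist ((cat_map ^^ t) (proj (q 0 + z 0))) (p t)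
        \<le> 4 / (1 - inverse cat_eigenvalue) * inverse cat_eigenvalue ^ L"
      unfolding orbit by (simp add: c_def)
  qed
qed

section \<open>Invariant measures and block entropies\<close>

text \<open>Fekete's lemma. The second conclusion records that the limit is the infimum, which
  bounds every single term from below.\<close>

lemma subadditive_ratio_limit:
  fixes u :: "nat \<Rightarrow> real"
  assumes sub: "\<And>m n. u (m + n) \<le> u m + u n" and nonneg: "\<And>n. 0 \<le> u n"
  obtains h where "(\<lambda>n. u n / real n) \<longlonglongrightarrow> h" "\<And>n. real n * h \<le> u n"
proof -
  define h where "h = (INF n\<in>{1..}. u n / real n)"
  have bdd: "bdd_below ((\<lambda>n. u n / real n) ` {1..})"
    using nonneg by (intro bdd_belowI[of _ 0]) auto
  have h_le: "h \<le> u n / real n" if "n \<ge> 1" for n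
    unfolding h_def using that by (intro cINF_lower bdd) auto
  have h_le': "real n * h \<le> u n" for n
    using h_le[of n] nonneg[of 0] by (cases "n = 0") (auto simp: field_simps)
  have h0: "0 \<le> h" unfolding h_def using nonneg by (intro cINF_greatest) auto
  have upper: "\<forall>\<^sub>F n in sequentially. u n / real n < h + e" if e: "e > 0" for e
  proof -
    obtain N where N: "N \<ge> 1" "u N / real N < h + e / 2"
      using cINF_less_iff[of "{1..}" "\<lambda>n. u n / real n" "h + e / 2"] bdd e unfolding h_def by auto
    define B where "B = (\<Sum>r<N. u r)"
    have mult: "u (q * N + r) \<le> real q * u N + u r" for q r
    proof (induction q)
      case (Suc q)
      have "u (N + (q * N + r)) \<le> u N + u (q * N + r)" by (rule sub)
      then show ?case using Suc by (simp add: algebra_simps)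
    qed simp
    have bnd: "u n \<le> real n * (h + e / 2) + B" for n
    proof -
      have "u n \<le> real (n div N) * u N + u (n mod N)"
        using mult[of "n div N" "n mod N"] by simp
      also have "u (n mod N) \<le> B"
        unfolding B_def using N(1) nonneg by (intro member_le_sum) auto
      also have "u N \<le> real N * (h + e / 2)" using N by (simp add: field_simps)
      also have "real (n div N) * (real N * (h + e / 2)) = real (n div N * N) * (h + e / 2)"
        by simp
      also have "\<dots> \<le> real n * (h + e / 2)"
        using h0 e by (intro mult_right_mono of_nat_mono) auto
      finally show ?thesis by (simp add: mult_left_mono)
    qed
    have "(\<lambda>n. B / real n) \<longlonglongrightarrow> 0" by (rule lim_const_over_n)
    then have "\<forall>\<^sub>F n in sequentially. B / real n < e / 2" using e by (intro order_tendstoD) auto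
    then show ?thesis
      using eventually_gt_at_top[of 0]
    proof eventually_elim
      case (elim n)
      have "u n / real n \<le> h + e / 2 + B / real n"
        using bnd[of n] elim by (simp add: field_simps)
      then show ?case using elim by linarith
    qed
  qed
  have "(\<lambda>n. u n / real n) \<longlonglongrightarrow> h"
  proof (rule order_tendstoI)
    fix a assume "a < h"
    then show "\<forall>\<^sub>F n in sequentially. a < u n / real n"
      using h_le by (intro eventually_mono[OF eventually_ge_at_top[of 1]]) (metis less_le_trans)
  next
    fix a assume "h < a"
    then show "\<forall>\<^sub>F n in sequentially. u n / real n < a" using upper[of "a - h"] by simp
  qed
  then show ?thesis using h_le' that by blast
qed

section \<open>Invariant measures of continuous maps on compact spaces\<close>

locale compact_system = prob_space \<nu> for \<nu> :: "'a::polish_space measure" +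
  fixes f :: "'a \<Rightarrow> 'a"
  assumes compact_UNIV: "compact (UNIV :: 'a set)"
    and cont_f: "continuous_on UNIV f"
    and sets_nu [measurable_cong]: "sets \<nu> = sets borel"
    and invariant: "distr \<nu> borel f = \<nu>"
begin

lemma space_nu [simp]: "space \<nu> = UNIV"
  using sets_eq_imp_space_eq[OF sets_nu] by simp

lemma cont_iter: "continuous_on UNIV (f ^^ n)"
proof (induction n)
  case (Suc n)
  then show ?case
    using continuous_on_compose[OF Suc, of f] cont_f by (auto intro: continuous_on_subset)
qed (simp add: id_def)

lemma measurable_iter [measurable]: "f ^^ n \<in> borel_measurable borel"
  by (rule borel_measurable_continuous_onI[OF cont_iter])

lemma measurable_f [measurable]: "f \<in> borel_measurable borel"
  by (rule borel_measurable_continuous_onI[OF cont_f])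

lemma invariant_iter: "distr \<nu> borel (f ^^ n) = \<nu>"
proof (induction n)
  case 0
  show ?case by (simp add: distr_id2 sets_nu id_def)
next
  case (Suc n)
  have "distr \<nu> borel (f ^^ Suc n) = distr (distr \<nu> borel (f ^^ n)) borel f"
    by (subst distr_distr) (auto simp: comp_def)
  then show ?case using Suc invariant by metis
qed

lemma prob_iter: "A \<in> sets borel \<Longrightarrow> prob ((f ^^ n) -` A) = prob A"
  using measure_distr[of "f ^^ n" \<nu> borel A] by (simp add: invariant_iter)

lemma integral_iter:
  fixes g :: "'a \<Rightarrow> real"
  assumes [measurable]: "g \<in> borel_measurable borel"
  shows "(\<integral>x. g ((f ^^ n) x) \<partial>\<nu>) = (\<integral>x. g x \<partial>\<nu>)"
  using integral_distr[of "f ^^ n" \<nu> borel g] by (simp add: invariant_iter)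

lemma bounded_continuous:
  fixes \<phi> :: "'a \<Rightarrow> real"
  assumes "continuous_on UNIV \<phi>"
  obtains B where "B > 0" "\<And>x. \<bar>\<phi> x\<bar> \<le> B"
proof -
  have "bounded (range \<phi>)"
    using compact_continuous_image[OF assms compact_UNIV] compact_imp_bounded by blast
  then show ?thesis using that by (auto simp: bounded_pos)
qed

lemma integrable_continuous:
  fixes \<phi> :: "'a \<Rightarrow> real"
  assumes "continuous_on UNIV \<phi>"
  shows "integrable \<nu> \<phi>"
proof -
  obtain B where "\<And>x. \<bar>\<phi> x\<bar> \<le> B" using bounded_continuous[OF assms] by metis
  then show ?thesis
    using borel_measurable_continuous_onI[OF assms]
    by (intro integrable_const_bound[of _ B]) auto
qed

end

text \<open>The codes are extensional functions, so the set of all words is a \<open>PiE\<close> set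
  and sums over words of products over times factorize.\<close>

definition itinerary :: "('a \<Rightarrow> 'a) \<Rightarrow> 'a set set \<Rightarrow> nat \<Rightarrow> 'a \<Rightarrow> nat \<Rightarrow> 'a set" where
  "itinerary f P n x = (\<lambda>i\<in>{..<n}. THE c. c \<in> P \<and> (f ^^ i) x \<in> c)"

locale partitioned_system = compact_system \<nu> f
  for \<nu> :: "'a::polish_space measure" and f +
  fixes P :: "'a set set"
  assumes finite_P: "finite P" and borel_P: "P \<subseteq> sets borel" and part_P: "partition_on UNIV P"
begin

abbreviation "itin \<equiv> itinerary f P"
abbreviation "fiber n l \<equiv> {x. itin n x = l}"
abbreviation "H n \<equiv> partition_entropy \<nu> (iterated_join f n P)"

lemma ex1_cell: "\<exists>!c. c \<in> P \<and> x \<in> c"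
  using part_P by (auto simp: partition_on_def disjoint_def)

lemma itin_eqI: "c \<in> P \<Longrightarrow> (f ^^ i) x \<in> c \<Longrightarrow> i < n \<Longrightarrow> itin n x i = c"
  using the1_equality[OF ex1_cell] by (simp add: itinerary_def)

lemma itin_cell: "i < n \<Longrightarrow> itin n x i \<in> P" "i < n \<Longrightarrow> (f ^^ i) x \<in> itin n x i"
  using theI'[OF ex1_cell] by (simp_all add: itinerary_def)

lemma itin_PiE: "itin n x \<in> {..<n} \<rightarrow>\<^sub>E P"
  using itin_cell by (auto simp: itinerary_def)

lemma itin_eq_iff: "l \<in> {..<n} \<rightarrow>\<^sub>E P \<Longrightarrow> itin n x = l \<longleftrightarrow> (\<forall>i<n. (f ^^ i) x \<in> l i)"
proof
  assume "l \<in> {..<n} \<rightarrow>\<^sub>E P" "\<forall>i<n. (f ^^ i) x \<in> l i"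
  then have "itin n x i = l i" if "i < n" for i
    using that by (intro itin_eqI) auto
  then show "itin n x = l"
    using \<open>l \<in> {..<n} \<rightarrow>\<^sub>E P\<close> by (intro PiE_ext[OF itin_PiE]) auto
qed (use itin_cell in auto)

lemma finite_range_itin: "finite (range (itin n))"
  by (rule finite_subset[of _ "{..<n} \<rightarrow>\<^sub>E P"]) (use itin_PiE finite_P in \<open>auto intro: finite_PiE\<close>)

lemma fiber_eq: "l \<in> {..<n} \<rightarrow>\<^sub>E P \<Longrightarrow> fiber n l = (\<Inter>i<n. (f ^^ i) -` l i)"
  using itin_eq_iff by auto

lemma fiber_measurable [measurable]: "fiber n l \<in> sets borel"
proof (cases "l \<in> {..<n} \<rightarrow>\<^sub>E P")
  case True
  have "(f ^^ i) -` l i \<in> sets borel" if "i < n" for i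
    using measurable_sets[OF measurable_iter, of "l i" i] True borel_P that by auto
  then show ?thesis
    unfolding fiber_eq[OF True] by (cases "n = 0") auto
next
  case False
  then have "fiber n l = {}" using itin_PiE by auto
  then show ?thesis by (metis sets.empty_sets)
qed

lemma simple_itin: "simple_function \<nu> (itin n)"
  unfolding simple_function_def
  using finite_range_itin fiber_measurable[of n] by (auto simp: sets_nu vimage_def)

text \<open>Turns the entropy of the join into the entropy of the random variable
  \<open>itin n\<close>, to which the chain rule applies.\<close>

lemma iterated_join_eq: "iterated_join f n P = fiber n ` range (itin n)"
proof (intro equalityI subsetI)
  fix A assume "A \<in> iterated_join f n P"
  then obtain a where a: "A = (\<Inter>i<n. (f ^^ i) -` a i)" "\<forall>i<n. a i \<in> P" "A \<noteq> {}"
    by (auto simp: iterated_join_def)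
  then obtain x where x: "x \<in> A" by blast
  have r: "restrict a {..<n} \<in> {..<n} \<rightarrow>\<^sub>E P" using a by auto
  have "A = fiber n (restrict a {..<n})" unfolding fiber_eq[OF r] a(1) by simp
  moreover have "itin n x = restrict a {..<n}" using calculation x by simp
  ultimately show "A \<in> fiber n ` range (itin n)" by (metis imageI rangeI)
next
  fix A assume "A \<in> fiber n ` range (itin n)"
  then obtain x where A: "A = fiber n (itin n x)" by auto
  then have "A \<noteq> {}" by blast
  moreover have "A = (\<Inter>i<n. (f ^^ i) -` itin n x i)"
    unfolding A by (rule fiber_eq[OF itin_PiE])
  ultimately show "A \<in> iterated_join f n P"
    using itin_cell by (auto simp: iterated_join_def)
qed

lemma inj_fiber: "inj_on (fiber n) (range (itin n))"
  by (auto simp: inj_on_def)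

lemma H_eq: "H n = - (\<Sum>l\<in>range (itin n). prob (fiber n l) * ln (prob (fiber n l)))"
  unfolding partition_entropy_def iterated_join_eq by (subst sum.reindex[OF inj_fiber]) simp

text \<open>With base \<open>exp 1\<close> the logarithm of the entropy theory is
  \<open>ln\<close>.\<close>

lemma information_space_nu: "information_space \<nu> (exp 1)"
  by unfold_locales simp

lemma entropy_simple:
  assumes "simple_function \<nu> X"
  shows "entropy (exp 1) (count_space (range X)) X
    = - (\<Sum>l\<in>range X. prob (X -` {l}) * ln (prob (X -` {l})))"
  using information_space.entropy_simple_distributed[OF information_space_nu
      simple_distributedI[OF assms measure_nonneg refl]]
  by (simp add: log_def)

lemma H_eq_entropy: "H n = entropy (exp 1) (count_space (range (itin n))) (itin n)"
  unfolding entropy_simple[OF simple_itin] H_eq by (simp add: vimage_def)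

lemma H_nonneg: "0 \<le> H n"
proof -
  have "prob A * ln (prob A) \<le> 0" for A
    by (cases "prob A = 0") (auto intro!: mult_nonneg_nonpos simp: ln_le_zero_iff zero_less_measure_iff)
  then have "(\<Sum>l\<in>range (itin n). prob (fiber n l) * ln (prob (fiber n l))) \<le> 0"
    by (rule sum_nonpos)
  then show ?thesis unfolding H_eq by simp
qed

text \<open>The long itinerary is a function of the pair of \<open>itin m\<close> and the itinerary
  \<open>Y\<close> of the remaining \<open>n\<close> steps. Entropy does not grow under functions,
  joint entropy is at most the sum, and by invariance \<open>Y\<close> has the law of
  \<open>itin n\<close>.\<close>

lemma H_subadditive: "H (m + n) \<le> H m + H n"
proof -
  interpret information_space \<nu> "exp 1" by (rule information_space_nu)
  define Y where "Y x = itin n ((f ^^ m) x)" for x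
  have rY: "range Y \<subseteq> range (itin n)" by (auto simp: Y_def)
  have fY: "Y -` {l} = (f ^^ m) -` fiber n l" for l by (auto simp: Y_def)
  have Y: "simple_function \<nu> Y"
    unfolding simple_function_def space_nu
  proof (intro conjI ballI)
    show "finite (range Y)" using finite_subset[OF rY finite_range_itin] .
    show "Y -` {l} \<inter> UNIV \<in> sets \<nu>" for l
      using measurable_sets[OF measurable_iter fiber_measurable, of m n l] by (simp add: fY sets_nu)
  qed
  have pY: "prob (Y -` {l}) = prob (fiber n l)" for l
    unfolding fY by (rule prob_iter) measurable
  have "entropy (exp 1) (count_space (range Y)) Y
      = - (\<Sum>l\<in>range Y. prob (fiber n l) * ln (prob (fiber n l)))"
    unfolding entropy_simple[OF Y] pY ..
  \<comment> \<open>\<open>Y\<close> may miss values of \<open>itin n\<close>, as \<open>f\<close>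
    need not be surjective here; the missing cells are null and contribute 0.\<close>
  also have "\<dots> = H n"
    unfolding H_eq
  proof -
    have "prob (fiber n l) * ln (prob (fiber n l)) = 0" if "l \<notin> range Y" for l
    proof -
      have "Y -` {l} = {}" using that by blast
      then show ?thesis using pY[of l] by simp
    qed
    then show "- (\<Sum>l\<in>range Y. prob (fiber n l) * ln (prob (fiber n l)))
        = - (\<Sum>l\<in>range (itin n). prob (fiber n l) * ln (prob (fiber n l)))"
      by (subst sum.mono_neutral_left[OF finite_range_itin rY]) auto
  qed
  finally have HY: "entropy (exp 1) (count_space (range Y)) Y = H n" .
  define g where "g = (\<lambda>(a, b). \<lambda>i\<in>{..<m + n}. if i < m then a i else b (i - m) :: 'a set)"
  have eq: "itin (m + n) = g \<circ> (\<lambda>x. (itin m x, Y x))"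
  proof
    fix x
    have "(f ^^ (i - m)) ((f ^^ m) x) = (f ^^ i) x" if "\<not> i < m" for i
      using that funpow_add[of "i - m" m f] by (metis comp_apply le_add_diff_inverse2 not_less)
    then show "itin (m + n) x = (g \<circ> (\<lambda>x. (itin m x, Y x))) x"
      by (auto simp: g_def Y_def itinerary_def fun_eq_iff)
  qed
  have "H (m + n) \<le> entropy (exp 1) (count_space (range (\<lambda>x. (itin m x, Y x)))) (\<lambda>x. (itin m x, Y x))"
    unfolding H_eq_entropy eq
    using entropy_data_processing[OF simple_function_Pair[OF simple_itin Y], of g m] by simp
  also have "\<dots> \<le> H m + H n"
    using entropy_chain_rule[OF Y simple_itin, of m] conditional_entropy_less_eq_entropy[OF simple_itin Y, of m]
      entropy_chain_rule[OF simple_itin Y, of m] conditional_entropy_less_eq_entropy[OF Y simple_itin, of m]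
    by (simp add: HY H_eq_entropy)
  finally show ?thesis .
qed

definition "rate = lim (\<lambda>n. H n / real n)"

lemma H_limit: "(\<lambda>n. H n / real n) \<longlonglongrightarrow> rate" and H_ge: "real n * rate \<le> H n"
proof -
  obtain h' where h': "(\<lambda>n. H n / real n) \<longlonglongrightarrow> h'" "\<And>n. real n * h' \<le> H n"
    using subadditive_ratio_limit[of H, OF H_subadditive H_nonneg] by blast
  moreover have "rate = h'" unfolding rate_def by (rule limI[OF h'(1)])
  ultimately show "(\<lambda>n. H n / real n) \<longlonglongrightarrow> rate" "real n * rate \<le> H n" by simp_all
qed

lemma integral_itin:
  fixes g :: "(nat \<Rightarrow> 'a set) \<Rightarrow> real"
  shows "integrable \<nu> (\<lambda>x. g (itin n x))"
    and "(\<integral>x. g (itin n x) \<partial>\<nu>) = (\<Sum>l\<in>range (itin n). g l * prob (fiber n l))"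
proof -
  have eq: "g (itin n x) = (\<Sum>l\<in>range (itin n). g l * indicator (fiber n l) x)" for x
    using finite_range_itin[of n]
    by (simp add: indicator_def if_distrib[of "\<lambda>c. _ * c"] sum.delta cong: if_cong)
  have fm: "fiber n l \<in> sets \<nu>" for l using fiber_measurable by (simp add: sets_nu)
  show "integrable \<nu> (\<lambda>x. g (itin n x))"
    unfolding eq by (auto intro!: Bochner_Integration.integrable_sum simp: fm emeasure_eq_measure)
  show "(\<integral>x. g (itin n x) \<partial>\<nu>) = (\<Sum>l\<in>range (itin n). g l * prob (fiber n l))"
    unfolding eq by (subst Bochner_Integration.integral_sum) (auto simp: fm emeasure_eq_measure)
qed

text \<open>Excludes the null cells, where the default value \<open>ln 0 = 0\<close> breaks the
  monotonicity of the logarithm.\<close>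

lemma AE_fiber_pos: "AE x in \<nu>. 0 < prob (fiber n (itin n x))"
proof -
  have "AE x in \<nu>. \<forall>l\<in>range (itin n). prob (fiber n l) = 0 \<longrightarrow> itin n x \<noteq> l"
  proof (rule AE_finite_allI[OF finite_range_itin])
    fix l
    show "AE x in \<nu>. prob (fiber n l) = 0 \<longrightarrow> itin n x \<noteq> l"
    proof (cases "prob (fiber n l) = 0")
      case True
      then have "fiber n l \<in> null_sets \<nu>"
        using fiber_measurable[of n l] by (auto simp: null_sets_def sets_nu emeasure_eq_measure)
      then show ?thesis by (rule AE_I') auto
    qed simp
  qed
  then show ?thesis by eventually_elim (auto simp: zero_less_measure_iff)
qed

lemma H_eq_integral: "H n = (\<integral>x. - ln (prob (fiber n (itin n x))) \<partial>\<nu>)"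
  using integral_itin(2)[of "\<lambda>l. - ln (prob (fiber n l))" n]
  by (simp add: H_eq sum_negf mult.commute)

end

section \<open>Block entropy and the measure of Bowen balls\<close>

lemma compact_inner_approximation:
  fixes M :: "'a::polish_space measure"
  assumes M: "finite_measure M" "sets M = sets borel" and A: "A \<in> sets borel" and \<eta>: "\<eta> > 0"
  obtains K where "compact K" "K \<subseteq> A" "measure M A < measure M K + \<eta>"
proof (cases "measure M A < \<eta>")
  \<comment> \<open>Here \<open>measure M A - \<eta>\<close> is negative and \<open>ennreal\<close>
    would truncate it to 0, so the supremum argument is replaced by the empty set.\<close>
  case True
  then show ?thesis using that[of "{}"] by simp
next
  case False
  interpret finite_measure M by (rule M)
  have "ennreal (measure M A - \<eta>) < emeasure M A"
    using False \<eta> by (simp add: emeasure_eq_measure ennreal_less_iff)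
  also have "\<dots> = (SUP K\<in>{K. K \<subseteq> A \<and> compact K}. emeasure M K)"
    by (rule inner_regular) (use M A in auto)
  finally obtain K where "K \<subseteq> A" "compact K" "ennreal (measure M A - \<eta>) < emeasure M K"
    by (auto simp: less_SUP_iff)
  then show ?thesis
    using that[of K] False by (simp add: emeasure_eq_measure ennreal_less_iff)
qed

lemma separate_compact_compact:
  fixes A B :: "'a::metric_space set"
  assumes A: "compact A" and B: "compact B" and disj: "A \<inter> B = {}"
  shows "\<exists>d>0. \<forall>x\<in>A. \<forall>y\<in>B. d \<le> dist x y"
proof (cases "A = {} \<or> B = {}")
  case True
  then show ?thesis by (auto intro: exI[of _ 1])
next
  case False
  have "continuous_on A (\<lambda>x. infdist x B)" by (intro continuous_intros)
  then obtain x where x: "x \<in> A" "\<And>y. y \<in> A \<Longrightarrow> infdist x B \<le> infdist y B"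
    using continuous_attains_inf[OF A] False by blast
  have "infdist x B > 0"
    using infdist_pos_not_in_closed[OF compact_imp_closed[OF B], of x] False disj x by auto
  moreover have "infdist x B \<le> dist y z" if "y \<in> A" "z \<in> B" for y z
    using x(2)[OF that(1)] infdist_le[OF that(2), of y] by simp
  ultimately show ?thesis by blast
qed

section \<open>Measurability of Bowen balls\<close>

context compact_system
begin

lemma measurable_bowen_ball [measurable]: "bowen_ball f n x \<epsilon> \<in> sets borel"
proof -
  have "{y \<in> space borel. \<forall>i<n. dist ((f ^^ i) x) ((f ^^ i) y) < \<epsilon>} \<in> sets borel"
    by measurable
  then show ?thesis by (simp add: bowen_ball_def)
qed

lemma measurable_bowen_relation:
  "{p. \<forall>i<n. dist ((f ^^ i) (fst p)) ((f ^^ i) (snd p)) < \<epsilon>} \<in> sets (\<nu> \<Otimes>\<^sub>M \<nu>)"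
proof -
  have "{p \<in> space (\<nu> \<Otimes>\<^sub>M \<nu>). \<forall>i<n. dist ((f ^^ i) (fst p)) ((f ^^ i) (snd p)) < \<epsilon>} \<in> sets (\<nu> \<Otimes>\<^sub>M \<nu>)"
    by measurable
  then show ?thesis by (simp add: space_pair_measure)
qed

lemma measurable_prob_bowen_ball [measurable]:
  "(\<lambda>x. prob (bowen_ball f n x \<epsilon>)) \<in> borel_measurable borel"
proof -
  let ?D = "{p. \<forall>i<n. dist ((f ^^ i) (fst p)) ((f ^^ i) (snd p)) < \<epsilon>}"
  have "(\<lambda>x. emeasure \<nu> (Pair x -` ?D)) \<in> borel_measurable \<nu>"
    by (rule measurable_emeasure_Pair[OF measurable_bowen_relation])
  moreover have "Pair x -` ?D = bowen_ball f n x \<epsilon>" for x by (auto simp: bowen_ball_def)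
  ultimately have "(\<lambda>x. emeasure \<nu> (bowen_ball f n x \<epsilon>)) \<in> borel_measurable \<nu>" by (simp only:)
  then have "(\<lambda>x. enn2real (emeasure \<nu> (bowen_ball f n x \<epsilon>))) \<in> borel_measurable \<nu>" by measurable
  then show ?thesis by (simp add: measure_def measurable_cong_sets[OF sets_nu refl])
qed

end

context partitioned_system
begin

lemma card_P_pos: "card P > 0"
  using ex1_cell finite_P by (auto simp: card_gt_0_iff)

lemma sum_prob_P: "(\<Sum>a\<in>P. prob a) = 1"
proof -
  have "prob (\<Union>P) = (\<Sum>a\<in>P. prob a)"
    using part_P borel_P finite_P
    by (intro finite_measure_finite_Union[of _ "\<lambda>a. a", simplified])
       (auto simp: partition_on_def disjoint_family_on_def disjoint_def sets_nu)
  moreover have "\<Union>P = space \<nu>" using part_P by (simp add: partition_on_def)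
  ultimately show ?thesis using prob_space by simp
qed

text \<open>The boundaries of cells may carry mass and no distance separates the cells. Inner
  regularity shrinks them to compact cores at a total loss of \<open>\<eta>\<close>; disjoint
  compact sets have positive distance, so a small ball about any point \<open>z\<close> meets at
  most one core.\<close>

lemma separated_cores:
  assumes "\<eta> > 0"
  obtains K \<epsilon> where "\<epsilon> > 0" "\<And>a. a \<in> P \<Longrightarrow> compact (K a)" "\<And>a. a \<in> P \<Longrightarrow> K a \<subseteq> a"
    "\<And>a b x y z. a \<in> P \<Longrightarrow> b \<in> P \<Longrightarrow> x \<in> K a \<Longrightarrow> y \<in> K b \<Longrightarrow> dist x z < \<epsilon> \<Longrightarrow> dist y z < \<epsilon> \<Longrightarrow> a = b"
    "prob (- (\<Union>a\<in>P. K a)) \<le> \<eta>"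
proof -
  have "\<exists>K. compact K \<and> K \<subseteq> a \<and> prob a < prob K + \<eta> / card P" if "a \<in> P" for a
  proof -
    have "a \<in> sets borel" "\<eta> / card P > 0" using that borel_P assms card_P_pos by auto
    then show ?thesis by (rule compact_inner_approximation[OF finite_measure_axioms sets_nu]) blast
  qed
  then obtain K where K: "\<And>a. a \<in> P \<Longrightarrow> compact (K a)" "\<And>a. a \<in> P \<Longrightarrow> K a \<subseteq> a"
    "\<And>a. a \<in> P \<Longrightarrow> prob a < prob (K a) + \<eta> / card P" by metis
  have Km: "K a \<in> sets \<nu>" if "a \<in> P" for a
    using K(1)[OF that] by (simp add: sets_nu borel_compact)
  have disj: "K a \<inter> K b = {}" if "a \<in> P" "b \<in> P" "a \<noteq> b" for a b
    using that K(2)[of a] K(2)[of b] ex1_cell by blast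
  have "prob (\<Union>a\<in>P. K a) = (\<Sum>a\<in>P. prob (K a))"
    using disj Km finite_P by (intro finite_measure_finite_Union) (auto simp: disjoint_family_on_def)
  also have "\<dots> \<ge> (\<Sum>a\<in>P. prob a - \<eta> / card P)"
    using K(3) by (intro sum_mono) (simp add: less_imp_le less_diff_eq algebra_simps)
  also have "(\<Sum>a\<in>P. prob a - \<eta> / card P) = 1 - \<eta>"
    using card_P_pos by (simp add: sum_subtractf sum_prob_P)
  finally have "1 - \<eta> \<le> prob (\<Union>a\<in>P. K a)" .
  moreover have "(\<Union>a\<in>P. K a) \<in> sets \<nu>" using Km finite_P by auto
  ultimately have small: "prob (- (\<Union>a\<in>P. K a)) \<le> \<eta>"
    using prob_compl[of "\<Union>a\<in>P. K a"] by (simp add: Compl_eq_Diff_UNIV)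
  define sep where "sep p d \<longleftrightarrow> d > 0 \<and> (\<forall>x\<in>K (fst p). \<forall>y\<in>K (snd p). d \<le> dist x y)" for p d
  have ex: "\<forall>p\<in>{p \<in> P \<times> P. fst p \<noteq> snd p}. \<exists>d. sep p d"
    unfolding sep_def by (intro ballI separate_compact_compact K(1) disj) auto
  obtain d where d': "\<forall>p\<in>{p \<in> P \<times> P. fst p \<noteq> snd p}. sep p (d p)"
    using bchoice[OF ex] by (rule exE)
  have d: "d p > 0 \<and> (\<forall>x\<in>K (fst p). \<forall>y\<in>K (snd p). d p \<le> dist x y)"
    if "p \<in> {p \<in> P \<times> P. fst p \<noteq> snd p}" for p
    using bspec[OF d' that] unfolding sep_def .
  \<comment> \<open>Halved, since two points within \<open>\<epsilon>\<close> of \<open>z\<close>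
    are less than \<open>2 * \<epsilon>\<close> apart. The inserted 1 covers a partition with a
    single cell, where there are no pairs.\<close>
  define \<epsilon> where "\<epsilon> = Min (insert 1 (d ` {p \<in> P \<times> P. fst p \<noteq> snd p})) / 2"
  have fin: "finite (insert 1 (d ` {p \<in> P \<times> P. fst p \<noteq> snd p}))" using finite_P by auto
  show ?thesis
  proof (rule that[OF _ K(1,2) _ small])
    show "\<epsilon> > 0" unfolding \<epsilon>_def using d fin by (auto simp: Min_gr_iff)
    fix a b x y z
    assume *: "a \<in> P" "b \<in> P" "x \<in> K a" "y \<in> K b" "dist x z < \<epsilon>" "dist y z < \<epsilon>"
    show "a = b"
    proof (rule ccontr)
      assume "a \<noteq> b"
      then have "(a, b) \<in> {p \<in> P \<times> P. fst p \<noteq> snd p}" using * by auto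
      then have "2 * \<epsilon> \<le> d (a, b)" "d (a, b) \<le> dist x y"
        unfolding \<epsilon>_def using fin d[of "(a, b)"] * by (auto intro!: Min_le)
      moreover have "dist x y < 2 * \<epsilon>"
        using * dist_triangle[of x y z] by (simp add: dist_commute)
      ultimately show False by simp
    qed
  qed assumption+
qed

text \<open>Dividing by the measure of the cell turns the integral into a sum over cells. Null
  cells, where the quotient is 0 by convention, and words that do not occur only enlarge the
  right-hand side.\<close>

lemma integral_itin_over_fiber_le:
  assumes "\<And>l. 0 \<le> \<phi> l"
  shows "(\<integral>\<^sup>+x. ennreal (\<phi> (itin n x) / prob (fiber n (itin n x))) \<partial>\<nu>)
    \<le> ennreal (\<Sum>l\<in>{..<n} \<rightarrow>\<^sub>E P. \<phi> l)"
proof -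
  let ?g = "\<lambda>l. \<phi> l / prob (fiber n l)"
  have "(\<integral>\<^sup>+x. ennreal (?g (itin n x)) \<partial>\<nu>) = ennreal (\<Sum>l\<in>range (itin n). ?g l * prob (fiber n l))"
    using assms by (subst nn_integral_eq_integral[OF integral_itin(1)[of ?g]]) (auto simp: integral_itin(2)[of ?g])
  also have "(\<Sum>l\<in>range (itin n). ?g l * prob (fiber n l)) \<le> (\<Sum>l\<in>range (itin n). \<phi> l)"
    using assms by (intro sum_mono) (auto simp: field_simps)
  also have "\<dots> \<le> (\<Sum>l\<in>{..<n} \<rightarrow>\<^sub>E P. \<phi> l)"
    using itin_PiE finite_P assms by (intro sum_mono2) (auto intro: finite_PiE)
  finally show ?thesis by (simp add: ennreal_leI)
qed

text \<open>By \<open>ln u \<le> u - 1\<close> it suffices to bound the mean of the quotient of the measures of the Bowen ball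
  and of the cell of a point. Visits to the bad set, where one ball meets several cells, are
  discounted by the factor \<open>1 / Q\<close>, so that a ball meets only \<open>(1 + card P / Q) ^ N\<close> cells, counted with
  weights.\<close>

proposition bowen_ball_entropy:
  assumes \<delta>: "\<delta> > 0"
  obtains \<epsilon> C where "\<epsilon> > 0" "C \<ge> 0"
    "\<And>N. H N - 2 * \<delta> * real N - ln 2
      \<le> (\<integral>x. - ln (prob (bowen_ball f N x \<epsilon>) + exp (- C * real N)) \<partial>\<nu>)"
proof -
  \<comment> \<open>\<open>Q\<close> makes the discounted cells contribute at most
    \<open>\<delta>\<close> per time step to the count. Then \<open>\<eta>\<close> is chosen so
    small that the mean cost \<open>ln Q * \<eta>\<close> of the discounts per step is at most
    \<open>\<delta>\<close> as well. Together they form the loss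
    \<open>2 * \<delta>\<close>.\<close>
  define Q where "Q = max 1 (card P / \<delta>)"
  have Q: "Q \<ge> 1" "card P / Q \<le> \<delta>"
  proof -
    show "Q \<ge> 1" by (simp add: Q_def)
    have "card P / \<delta> \<le> Q" by (simp add: Q_def)
    then show "card P / Q \<le> \<delta>" using \<delta> \<open>Q \<ge> 1\<close> by (simp add: field_simps)
  qed
  define \<eta> where "\<eta> = \<delta> / (ln Q + 1)"
  have \<eta>: "\<eta> > 0" "ln Q * \<eta> \<le> \<delta>"
    using \<delta> Q(1) by (auto simp: \<eta>_def field_simps add_pos_nonneg ln_ge_zero)
  obtain K \<epsilon> where K: "\<epsilon> > 0" "\<And>a. a \<in> P \<Longrightarrow> compact (K a)" "\<And>a. a \<in> P \<Longrightarrow> K a \<subseteq> a"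
    "\<And>a b x y z. a \<in> P \<Longrightarrow> b \<in> P \<Longrightarrow> x \<in> K a \<Longrightarrow> y \<in> K b \<Longrightarrow> dist x z < \<epsilon> \<Longrightarrow> dist y z < \<epsilon> \<Longrightarrow> a = b"
    "prob (- (\<Union>a\<in>P. K a)) \<le> \<eta>"
    by (rule separated_cores[OF \<eta>(1)]) blast
  define G where "G = (\<Union>a\<in>P. K a)"
  have G [measurable]: "G \<in> sets borel"
    unfolding G_def using K(2) finite_P by (auto intro!: sets.finite_UN borel_compact)
  \<comment> \<open>With this \<open>C\<close> the truncation term \<open>exp (- C * real N)\<close>
    is the reciprocal of the number of words of length \<open>N\<close>. Summed over all words it
    adds just 1 to the mean, whence the constant \<open>ln 2\<close>.\<close>
  define C where "C = ln (card P)"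
  have C0: "C \<ge> 0" unfolding C_def using card_P_pos by (intro ln_ge_zero) simp
  have Cexp: "exp (- C * real N) * real (card P) ^ N = 1" for N
  proof -
    have "exp (- C * real N) = inverse (exp C ^ N)"
      by (simp add: exp_minus exp_of_nat2_mult[symmetric] mult.commute)
    then show ?thesis using card_P_pos by (simp add: C_def)
  qed
  show ?thesis
  proof (rule that[OF K(1) C0])
    fix N
    define q where "q x = (if x \<in> G then 1 else 1 / Q)" for x
    define W where "W x = (\<Prod>i<N. q ((f ^^ i) x))" for x
    define \<mu> where "\<mu> x = prob (fiber N (itin N x))" for x
    define \<beta> where "\<beta> x = prob (bowen_ball f N x \<epsilon>)" for x
    define e where "e = exp (- C * real N)"
    define R where "R = exp (\<delta> * real N) + 1"
    have q: "0 < q x" "q x \<le> 1" "1 / Q \<le> q x" for x using Q(1) by (auto simp: q_def)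
    have W: "0 < W x" "W x \<le> 1" for x
      unfolding W_def using q by (auto intro!: prod_pos prod_le_1 simp: less_imp_le)
    have e: "0 < e" by (simp add: e_def)
    have \<beta>: "0 \<le> \<beta> x" "\<beta> x \<le> 1" for x by (simp_all add: \<beta>_def)
    have \<mu>0: "0 \<le> \<mu> x" for x by (simp add: \<mu>_def)
    have [measurable]: "q \<in> borel_measurable borel" unfolding q_def by measurable
    have [measurable]: "W \<in> borel_measurable borel" unfolding W_def by measurable
    have [measurable]: "\<beta> \<in> borel_measurable borel" unfolding \<beta>_def by measurable
    have [measurable]: "\<mu> \<in> borel_measurable borel"
      unfolding \<mu>_def using borel_measurable_integrable[OF integral_itin(1)[of "\<lambda>l. prob (fiber N l)" N]]
      by (simp add: measurable_cong_sets[OF sets_nu refl])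
    \<comment> \<open>A bound for the weight of a point of the cell \<open>a\<close> close to
      \<open>y\<close> that depends only on \<open>y\<close> and \<open>a\<close>; therefore the sum
      over words becomes a product over times.\<close>
    define k where "k y a = (if \<exists>x\<in>K a. dist x y < \<epsilon> then 1 else 1 / Q)" for y a
    have k0: "0 \<le> k y a" for y a using Q(1) by (simp add: k_def)
    have qk: "q x \<le> k y a" if "a \<in> P" "x \<in> a" "dist x y < \<epsilon>" for x y a
    proof (cases "x \<in> G")
      case True
      then obtain b where b: "b \<in> P" "x \<in> K b" by (auto simp: G_def)
      then have "b = a" using K(3)[of b] that ex1_cell[of x] by blast
      then show ?thesis using b that True by (auto simp: k_def q_def)
    next
      case False
      then show ?thesis using Q(1) by (auto simp: k_def q_def)
    qed
    have sum_k: "(\<Sum>a\<in>P. k y a) \<le> 1 + \<delta>" for y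
    proof -
      have "(\<Sum>a\<in>P. k y a) \<le> (\<Sum>a\<in>P. (if \<exists>x\<in>K a. dist x y < \<epsilon> then 1 else 0) + 1 / Q)"
        using Q(1) by (intro sum_mono) (auto simp: k_def)
      also have "\<dots> = real (card {a \<in> P. \<exists>x\<in>K a. dist x y < \<epsilon>}) + card P / Q"
        using finite_P by (simp add: sum.distrib sum.If_cases Int_def)
      also have "card {a \<in> P. \<exists>x\<in>K a. dist x y < \<epsilon>} \<le> 1"
      proof -
        have "\<forall>a\<in>{a \<in> P. \<exists>x\<in>K a. dist x y < \<epsilon>}. \<forall>b\<in>{a \<in> P. \<exists>x\<in>K a. dist x y < \<epsilon>}. a = b"
          using K(4) by blast
        then show ?thesis
          using card_le_Suc0_iff_eq[of "{a \<in> P. \<exists>x\<in>K a. dist x y < \<epsilon>}"] finite_P by simp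
      qed
      finally show ?thesis using Q(2) by simp
    qed
    have inner: "(\<integral>\<^sup>+x. ennreal (indicator (bowen_ball f N y \<epsilon>) x * W x / \<mu> x) \<partial>\<nu>)
        \<le> ennreal (exp (\<delta> * real N))" for y
    proof -
      define \<kappa> where "\<kappa> l = (\<Prod>i<N. k ((f ^^ i) y) (l i))" for l
      have \<kappa>0: "0 \<le> \<kappa> l" for l unfolding \<kappa>_def by (intro prod_nonneg ballI k0)
      have "indicator (bowen_ball f N y \<epsilon>) x * W x \<le> \<kappa> (itin N x)" for x
      proof (cases "x \<in> bowen_ball f N y \<epsilon>")
        case True
        then show ?thesis
          unfolding \<kappa>_def W_def using q
          by (auto simp: bowen_ball_def dist_commute less_imp_le intro!: prod_mono qk itin_cell)
      qed (simp add: \<kappa>0)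
      then have "(\<integral>\<^sup>+x. ennreal (indicator (bowen_ball f N y \<epsilon>) x * W x / \<mu> x) \<partial>\<nu>)
          \<le> (\<integral>\<^sup>+x. ennreal (\<kappa> (itin N x) / prob (fiber N (itin N x))) \<partial>\<nu>)"
        by (intro nn_integral_mono ennreal_leI) (simp add: \<mu>_def divide_right_mono)
      also have "\<dots> \<le> ennreal (\<Sum>l\<in>{..<N} \<rightarrow>\<^sub>E P. \<kappa> l)"
        by (rule integral_itin_over_fiber_le[OF \<kappa>0])
      also have "(\<Sum>l\<in>{..<N} \<rightarrow>\<^sub>E P. \<kappa> l) = (\<Prod>i<N. \<Sum>a\<in>P. k ((f ^^ i) y) a)"
        unfolding \<kappa>_def by (rule prod_sum_PiE[symmetric]) (use finite_P in auto)
      also have "\<dots> \<le> (\<Prod>i<N. exp \<delta>)"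
        using order_trans[OF sum_k exp_ge_add_one_self] by (intro prod_mono) (auto intro!: sum_nonneg k0)
      also have "\<dots> = exp (\<delta> * real N)" by (simp add: exp_of_nat2_mult)
      finally show ?thesis by (simp add: ennreal_leI)
    qed
    \<comment> \<open>\<open>\<beta> x\<close> is itself an integral over the points
      \<open>y\<close> of the ball about \<open>x\<close>. Closeness is symmetric, so after
      exchanging the integrals \<open>x\<close> runs through the ball about a fixed
      \<open>y\<close>.\<close>
    have main: "(\<integral>\<^sup>+x. ennreal (\<beta> x * W x / \<mu> x) \<partial>\<nu>) \<le> ennreal (exp (\<delta> * real N))"
    proof -
      interpret pair_sigma_finite \<nu> \<nu> ..
      let ?D = "{p. \<forall>i<N. dist ((f ^^ i) (fst p)) ((f ^^ i) (snd p)) < \<epsilon>}"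
      let ?g = "\<lambda>x y. indicator ?D (x, y) * ennreal (W x / \<mu> x)"
      have D: "?D \<in> sets (\<nu> \<Otimes>\<^sub>M \<nu>)" by (rule measurable_bowen_relation)
      have g: "case_prod ?g \<in> borel_measurable (\<nu> \<Otimes>\<^sub>M \<nu>)"
        using D by (simp add: case_prod_unfold) measurable
      have "(\<integral>\<^sup>+x. ennreal (\<beta> x * W x / \<mu> x) \<partial>\<nu>) = (\<integral>\<^sup>+x. \<integral>\<^sup>+y. ?g x y \<partial>\<nu> \<partial>\<nu>)"
      proof (rule nn_integral_cong)
        fix x
        have "(\<integral>\<^sup>+y. ?g x y \<partial>\<nu>) = (\<integral>\<^sup>+y. ennreal (W x / \<mu> x) * indicator (bowen_ball f N x \<epsilon>) y \<partial>\<nu>)"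
          by (intro nn_integral_cong) (auto simp: bowen_ball_def indicator_def)
        also have "\<dots> = ennreal (W x / \<mu> x) * ennreal (\<beta> x)"
          by (subst nn_integral_cmult_indicator) (simp_all add: sets_nu emeasure_eq_measure \<beta>_def)
        also have "\<dots> = ennreal (\<beta> x * W x / \<mu> x)"
          using \<beta>[of x] W[of x] \<mu>0[of x] by (simp add: ennreal_mult[symmetric] less_imp_le mult.commute)
        finally show "ennreal (\<beta> x * W x / \<mu> x) = (\<integral>\<^sup>+y. ?g x y \<partial>\<nu>)" ..
      qed
      also have "\<dots> = (\<integral>\<^sup>+y. \<integral>\<^sup>+x. ?g x y \<partial>\<nu> \<partial>\<nu>)" by (rule Fubini'[OF g, symmetric])
      also have "\<dots> \<le> (\<integral>\<^sup>+y. ennreal (exp (\<delta> * real N)) \<partial>\<nu>)"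
      proof (rule nn_integral_mono)
        fix y
        have "(\<integral>\<^sup>+x. ?g x y \<partial>\<nu>)
            = (\<integral>\<^sup>+x. ennreal (indicator (bowen_ball f N y \<epsilon>) x * W x / \<mu> x) \<partial>\<nu>)"
          by (intro nn_integral_cong) (auto simp: bowen_ball_def indicator_def dist_commute)
        also have "\<dots> \<le> ennreal (exp (\<delta> * real N))" by (rule inner)
        finally show "(\<integral>\<^sup>+x. ?g x y \<partial>\<nu>) \<le> ennreal (exp (\<delta> * real N))" .
      qed
      also have "\<dots> = ennreal (exp (\<delta> * real N))" using emeasure_space_1 by simp
      finally show ?thesis .
    qed
    have rest: "(\<integral>\<^sup>+x. ennreal (e * W x / \<mu> x) \<partial>\<nu>) \<le> 1"
    proof -
      have "(\<integral>\<^sup>+x. ennreal (e * W x / \<mu> x) \<partial>\<nu>)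
          \<le> (\<integral>\<^sup>+x. ennreal (e / prob (fiber N (itin N x))) \<partial>\<nu>)"
        using W e by (intro nn_integral_mono ennreal_leI) (auto simp: \<mu>_def intro!: divide_right_mono)
      also have "\<dots> \<le> ennreal (\<Sum>l\<in>{..<N} \<rightarrow>\<^sub>E P. e)"
        by (rule integral_itin_over_fiber_le) (use e in simp)
      also have "(\<Sum>l\<in>{..<N} \<rightarrow>\<^sub>E P. e) = 1"
        using Cexp[of N] by (simp add: card_PiE e_def mult.commute)
      finally show ?thesis by simp
    qed
    define F where "F x = (\<beta> x + e) * W x / \<mu> x" for x
    have F0: "0 \<le> F x" for x using \<beta> e W \<mu>0 by (simp add: F_def less_imp_le)
    have [measurable]: "F \<in> borel_measurable borel" unfolding F_def by measurable
    have nnF: "(\<integral>\<^sup>+x. ennreal (F x) \<partial>\<nu>) \<le> ennreal R"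
    proof -
      have "(\<integral>\<^sup>+x. ennreal (F x) \<partial>\<nu>)
          = (\<integral>\<^sup>+x. ennreal (\<beta> x * W x / \<mu> x) + ennreal (e * W x / \<mu> x) \<partial>\<nu>)"
        unfolding F_def using \<beta> e W \<mu>0
        by (intro nn_integral_cong) (simp add: ennreal_plus[symmetric] add_divide_distrib algebra_simps less_imp_le del: ennreal_plus)
      also have "\<dots> = (\<integral>\<^sup>+x. ennreal (\<beta> x * W x / \<mu> x) \<partial>\<nu>) + (\<integral>\<^sup>+x. ennreal (e * W x / \<mu> x) \<partial>\<nu>)"
        by (rule nn_integral_add) measurable
      also have "\<dots> \<le> ennreal (exp (\<delta> * real N)) + ennreal 1" using main rest by (intro add_mono) auto
      also have "\<dots> = ennreal R" unfolding R_def by (subst ennreal_plus) auto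
      finally show ?thesis .
    qed
    have R: "R > 0" by (simp add: R_def add_pos_pos)
    have intF: "integrable \<nu> F" and F_le: "(\<integral>x. F x \<partial>\<nu>) \<le> R"
    proof -
      show "integrable \<nu> F"
        by (rule integrableI_nonneg) (use F0 nnF in \<open>auto simp: sets_nu intro: le_less_trans\<close>)
      then show "(\<integral>x. F x \<partial>\<nu>) \<le> R"
        using nnF F0 R by (subst (asm) nn_integral_eq_integral) auto
    qed
    have int\<mu>: "integrable \<nu> (\<lambda>x. ln (\<mu> x))" and int\<mu>': "(\<integral>x. ln (\<mu> x) \<partial>\<nu>) = - H N"
      using integral_itin(1)[of "\<lambda>l. ln (prob (fiber N l))" N] H_eq_integral[of N] by (simp_all add: \<mu>_def)
    have int\<beta>: "integrable \<nu> (\<lambda>x. ln (\<beta> x + e))"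
    proof (rule integrable_const_bound[of _ "max (ln (1 + e)) (- ln e)"])
      show "AE x in \<nu>. norm (ln (\<beta> x + e)) \<le> max (ln (1 + e)) (- ln e)"
      proof (rule AE_I2)
        fix x
        have "ln e \<le> ln (\<beta> x + e)" "ln (\<beta> x + e) \<le> ln (1 + e)" using \<beta>[of x] e by simp_all
        then show "norm (ln (\<beta> x + e)) \<le> max (ln (1 + e)) (- ln e)" by (simp add: abs_le_iff max_def)
      qed
    qed measurable
    have lnW: "ln (W x) = - ln Q * (\<Sum>i<N. indicator (- G) ((f ^^ i) x))" for x
    proof -
      have "ln (W x) = (\<Sum>i<N. ln (q ((f ^^ i) x)))"
        unfolding W_def using q by (intro ln_prod) (auto simp: less_le)
      also have "\<dots> = (\<Sum>i<N. - ln Q * indicator (- G) ((f ^^ i) x))"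
        using Q(1) by (intro sum.cong) (auto simp: q_def ln_div)
      finally show ?thesis by (simp add: sum_distrib_left)
    qed
    have intind: "integrable \<nu> (\<lambda>x. indicator (- G) ((f ^^ i) x) :: real)" for i
      by (rule integrable_const_bound[of _ 1]) (auto simp: indicator_def)
    have intW: "integrable \<nu> (\<lambda>x. ln (W x))" unfolding lnW using intind by simp
    have "(\<integral>x. ln (W x) \<partial>\<nu>) = - ln Q * (\<Sum>i<N. \<integral>x. indicator (- G) ((f ^^ i) x) \<partial>\<nu>)"
      unfolding lnW using intind by (simp add: Bochner_Integration.integral_sum)
    also have "\<dots> = - ln Q * (real N * prob (- G))"
      by (subst integral_iter) (simp_all add: sets_nu)
    also have "\<dots> \<ge> - (\<delta> * real N)"
    proof -
      have "ln Q * prob (- G) \<le> ln Q * \<eta>"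
        using K(5) Q(1) by (intro mult_left_mono) (auto simp: G_def)
      then have "ln Q * prob (- G) * real N \<le> \<delta> * real N" using \<eta> by (intro mult_right_mono) auto
      then show ?thesis by (simp add: algebra_simps)
    qed
    finally have W_ge: "- (\<delta> * real N) \<le> (\<integral>x. ln (W x) \<partial>\<nu>)" .
    \<comment> \<open>The logarithm inequality is applied to \<open>F x / R\<close>, whose mean is
      at most 1; only \<open>ln R\<close> is lost.\<close>
    have "(\<integral>x. ln (\<beta> x + e) + ln (W x) - ln (\<mu> x) \<partial>\<nu>) \<le> (\<integral>x. F x / R - 1 + ln R \<partial>\<nu>)"
    proof (rule integral_mono_AE)
      show "AE x in \<nu>. ln (\<beta> x + e) + ln (W x) - ln (\<mu> x) \<le> F x / R - 1 + ln R"
        using AE_fiber_pos[of N]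
      proof eventually_elim
        case (elim x)
        then have \<mu>: "0 < \<mu> x" by (simp add: \<mu>_def)
        have pos: "0 < \<beta> x + e" using \<beta>[of x] e by simp
        have "ln (\<beta> x + e) + ln (W x) - ln (\<mu> x) - ln R = ln (F x / R)"
          unfolding F_def using \<mu> W[of x] R pos by (simp add: ln_div ln_mult)
        also have "\<dots> \<le> F x / R - 1"
          using \<mu> W[of x] R pos by (intro ln_le_minus_one) (simp add: F_def)
        finally show ?case by simp
      qed
    qed (use int\<beta> intW int\<mu> intF in auto)
    also have "\<dots> \<le> ln R"
      using F_le R intF by (simp add: prob_space[simplified])
    also have "ln R \<le> \<delta> * real N + ln 2"
    proof -
      have "R \<le> 2 * exp (\<delta> * real N)" using \<delta> by (simp add: R_def)
      then have "ln R \<le> ln (2 * exp (\<delta> * real N))" using R by simp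
      then show ?thesis by (simp add: ln_mult)
    qed
    finally have "(\<integral>x. ln (\<beta> x + e) \<partial>\<nu>) + (\<integral>x. ln (W x) \<partial>\<nu>) + H N \<le> \<delta> * real N + ln 2"
      using int\<beta> intW int\<mu> int\<mu>' by simp
    then show "H N - 2 * \<delta> * real N - ln 2
        \<le> (\<integral>x. - ln (prob (bowen_ball f N x \<epsilon>) + exp (- C * real N)) \<partial>\<nu>)"
      using W_ge by (simp add: \<beta>_def e_def)
  qed
qed

end

section \<open>Gluing independent orbit segments\<close>

text \<open>Block \<open>j\<close> has length \<open>Suc j\<close>.\<close>

definition block_start :: "nat \<Rightarrow> nat" where
  "block_start k = (\<Sum>j<k. Suc j)"

lemma block_start_0 [simp]: "block_start 0 = 0"
  and block_start_Suc: "block_start (Suc k) = block_start k + Suc k"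
  by (simp_all add: block_start_def)

lemma real_block_start: "real (block_start k) = real k * (real k + 1) / 2"
  by (induction k) (simp_all add: block_start_Suc field_simps)

lemma block_start_ge: "k \<le> block_start k"
  by (induction k) (simp_all add: block_start_Suc)

lemma block_start_mono: "k \<le> l \<Longrightarrow> block_start k \<le> block_start l"
  by (rule lift_Suc_mono_le[of block_start]) (simp_all add: block_start_Suc)

definition block_index :: "nat \<Rightarrow> nat" where
  "block_index t = (LEAST k. t < block_start (Suc k))"

lemma block_index: "block_start (block_index t) \<le> t" "t < block_start (Suc (block_index t))"
proof -
  have ex: "t < block_start (Suc t)" using block_start_ge[of "Suc t"] by simp
  then show "t < block_start (Suc (block_index t))"
    unfolding block_index_def by (rule LeastI)
  show "block_start (block_index t) \<le> t"
  proof (cases "block_index t")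
    case (Suc k)
    then have "\<not> t < block_start (Suc k)"
      unfolding block_index_def by (intro not_less_Least) simp
    then show ?thesis using Suc by simp
  qed simp
qed

lemma block_index_eqI:
  assumes "block_start k \<le> t" "t < block_start (Suc k)"
  shows "block_index t = k"
proof (rule antisym)
  show "block_index t \<le> k" unfolding block_index_def by (rule Least_le) (rule assms)
  show "k \<le> block_index t"
  proof (rule ccontr)
    assume "\<not> k \<le> block_index t"
    then have "block_start (Suc (block_index t)) \<le> block_start k" by (intro block_start_mono) simp
    then show False using assms(1) block_index(2)[of t] by simp
  qed
qed

text \<open>Independence is characterised by the joint law being the product of the marginal laws;
  here the joint law of the coordinates is the product measure itself.\<close>

lemma indep_vars_sequence_space:
  assumes "prob_space M"
  shows "prob_space.indep_vars (PiM UNIV (\<lambda>_::nat. M)) (\<lambda>_. M) (\<lambda>j \<omega>. \<omega> j) UNIV"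
proof -
  interpret M: prob_space M by fact
  interpret P: product_prob_space "\<lambda>_::nat. M" UNIV by unfold_locales
  have "distr (PiM UNIV (\<lambda>_::nat. M)) (PiM UNIV (\<lambda>_. M)) (\<lambda>\<omega>. \<lambda>i\<in>UNIV. \<omega> i) = PiM UNIV (\<lambda>_. M)"
    by (simp add: restrict_UNIV distr_id2)
  moreover have "distr (PiM UNIV (\<lambda>_::nat. M)) M (\<lambda>\<omega>. \<omega> i) = M" for i :: nat
    using P.PiM_component[of i] by simp
  ultimately show ?thesis
    by (subst P.P.indep_vars_iff_distr_eq_PiM) auto
qed

text \<open>Since the \<open>k\<close>th partial sum is normalised by \<open>block_start k\<close>, which is of order \<open>k^2\<close>,
  Hoeffding's inequality bounds the probability of a deviation by a geometric sequence.\<close>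

proposition strong_law_linear_growth:
  fixes X :: "nat \<Rightarrow> 'a \<Rightarrow> real"
  assumes M: "prob_space M" and X [measurable]: "\<And>j. X j \<in> borel_measurable M"
    and bound: "\<And>j x. x \<in> space M \<Longrightarrow> \<bar>X j x\<bar> \<le> C * real (Suc j)"
  shows "AE \<omega> in PiM UNIV (\<lambda>_::nat. M).
    (\<lambda>k. (\<Sum>j<k. X j (\<omega> j) - (\<integral>x. X j x \<partial>M)) / real (block_start k)) \<longlonglongrightarrow> 0"
proof -
  let ?\<Omega> = "PiM UNIV (\<lambda>_::nat. M)"
  interpret M: prob_space M by fact
  interpret P: product_prob_space "\<lambda>_::nat. M" UNIV by unfold_locales
  \<comment> \<open>The maximum with 1 makes all ranges nondegenerate, so that \<open>V\<close>
    below is positive.\<close>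
  define D where "D = max C 1"
  have D: "D \<ge> 1" by (simp add: D_def)
  have bound': "\<bar>X j x\<bar> \<le> D * real (Suc j)" if "x \<in> space M" for j x
    using bound[OF that, of j] by (rule order_trans) (simp add: D_def mult_right_mono)
  have comp: "\<omega> j \<in> space M" if "\<omega> \<in> space ?\<Omega>" for \<omega> j
    using that by (auto simp: space_PiM)
  have expect: "P.P.expectation (\<lambda>\<omega>. X j (\<omega> j)) = (\<integral>x. X j x \<partial>M)" for j
    using integral_distr[of "\<lambda>\<omega>. \<omega> j" ?\<Omega> M "X j"] P.PiM_component[of j] by simp
  define B where "B e k = {\<omega> \<in> space ?\<Omega>. e * real (block_start k)
      \<le> \<bar>(\<Sum>j<k. X j (\<omega> j)) - (\<Sum>j<k. \<integral>x. X j x \<partial>M)\<bar>}" for e k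
  have Bm: "B e k \<in> sets ?\<Omega>" for e k unfolding B_def by measurable
  have prob_B: "measure ?\<Omega> (B e k) \<le> 2 * exp (- e\<^sup>2 / (4 * D\<^sup>2)) ^ k" if e: "e > 0" for e k
  proof (cases "k = 0")
    case True
    then show ?thesis by (intro order_trans[OF P.P.prob_le_1]) simp
  next
    case False
    interpret H: Hoeffding_ineq ?\<Omega> "{..<k}" "\<lambda>j \<omega>. X j (\<omega> j)" "\<lambda>j. - (D * real (Suc j))"
      "\<lambda>j. D * real (Suc j)" "\<Sum>j<k. \<integral>x. X j x \<partial>M"
    proof unfold_locales
      show "P.P.indep_vars (\<lambda>_. borel) (\<lambda>j \<omega>. X j (\<omega> j)) {..<k}"
        by (rule P.P.indep_vars_compose2[OF P.P.indep_vars_subset[OF indep_vars_sequence_space[OF M]]])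
          auto
      show "AE \<omega> in ?\<Omega>. X j (\<omega> j) \<in> {- (D * real (Suc j))..D * real (Suc j)}" for j
      proof (rule AE_I2)
        fix \<omega> assume "\<omega> \<in> space ?\<Omega>"
        from bound'[OF comp[OF this], of j j]
        show "X j (\<omega> j) \<in> {- (D * real (Suc j))..D * real (Suc j)}" unfolding atLeastAtMost_iff by linarith
      qed
    qed (simp_all add: expect)
    \<comment> \<open>The sum of the squared ranges in Hoeffding's inequality. It is of order
      \<open>k^3\<close>, the squared deviation is of order \<open>k^4\<close>, and so the exponent
      is linear in \<open>k\<close>.\<close>
    define V where "V = (\<Sum>j<k. (D * real (Suc j) - - (D * real (Suc j)))\<^sup>2)"
    have "V = (\<Sum>j<k. 4 * D\<^sup>2 * (real (Suc j) * real (Suc j)))"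
      unfolding V_def by (intro sum.cong) (auto simp: power2_eq_square algebra_simps)
    also have "\<dots> \<le> (\<Sum>j<k. 4 * D\<^sup>2 * (real k * real (Suc j)))"
      by (intro sum_mono mult_left_mono mult_right_mono) auto
    also have "\<dots> = 4 * D\<^sup>2 * real k * real (block_start k)"
      by (simp add: block_start_def sum_distrib_left mult_ac)
    finally have V: "V \<le> 4 * D\<^sup>2 * real k * real (block_start k)" .
    have V0: "V > 0" unfolding V_def using False D by (intro sum_pos) auto
    have bs: "real (block_start k) > 0" using block_start_ge[of k] False by simp
    have "- 2 * (e * real (block_start k))\<^sup>2 / V
        \<le> - 2 * (e * real (block_start k))\<^sup>2 / (4 * D\<^sup>2 * real k * real (block_start k))"
      using V V0 bs False D by (intro divide_left_mono_neg) auto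
    also have "\<dots> = - e\<^sup>2 / (2 * D\<^sup>2) * (real (block_start k) / real k)"
      using bs by (simp add: power2_eq_square field_simps)
    also have "\<dots> \<le> - e\<^sup>2 / (2 * D\<^sup>2) * (real k / 2)"
      using False by (intro mult_left_mono_neg) (auto simp: real_block_start field_simps)
    also have "\<dots> = real k * (- e\<^sup>2 / (4 * D\<^sup>2))" by simp
    finally have "exp (- 2 * (e * real (block_start k))\<^sup>2 / V) \<le> exp (- e\<^sup>2 / (4 * D\<^sup>2)) ^ k"
      by (simp only: exp_of_nat_mult[symmetric] exp_le_cancel_iff)
    moreover have "measure ?\<Omega> (B e k) \<le> 2 * exp (- 2 * (e * real (block_start k))\<^sup>2 / V)"
      unfolding B_def using H.Hoeffding_ineq_abs_ge[of "e * real (block_start k)"] e V0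
      by (simp add: V_def)
    ultimately show ?thesis by simp
  qed
  have ev: "AE \<omega> in ?\<Omega>. \<forall>\<^sub>F k in sequentially. \<omega> \<notin> B e k" if e: "e > 0" for e
  proof -
    have "summable (\<lambda>k. measure ?\<Omega> (B e k))"
    proof (rule summable_comparison_test)
      show "\<exists>N. \<forall>k\<ge>N. norm (measure ?\<Omega> (B e k)) \<le> 2 * exp (- e\<^sup>2 / (4 * D\<^sup>2)) ^ k"
        using prob_B[OF e] by auto
      have "norm (exp (- e\<^sup>2 / (4 * D\<^sup>2))) < 1" using e D by simp
      then show "summable (\<lambda>k. 2 * exp (- e\<^sup>2 / (4 * D\<^sup>2)) ^ k)"
        by (intro summable_mult summable_geometric)
    qed
    then have "AE \<omega> in ?\<Omega>. \<forall>\<^sub>F k in sequentially. \<omega> \<in> space ?\<Omega> - B e k"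
      by (intro borel_cantelli_AE1 Bm) (auto simp: P.P.emeasure_eq_measure)
    then show ?thesis by eventually_elim (auto elim: eventually_mono)
  qed
  have "AE \<omega> in ?\<Omega>. \<forall>n. \<forall>\<^sub>F k in sequentially. \<omega> \<notin> B (1 / real (Suc n)) k"
    unfolding AE_all_countable using ev by simp
  then show ?thesis
    using AE_space
  proof eventually_elim
    case (elim \<omega>)
    show ?case
    proof (rule tendstoI)
      fix e :: real assume "e > 0"
      then obtain n where n: "1 / real (Suc n) < e" using nat_approx_posE by blast
      have "\<forall>\<^sub>F k in sequentially. \<omega> \<notin> B (1 / real (Suc n)) k" using elim by blast
      then show "\<forall>\<^sub>F k in sequentially.
          dist ((\<Sum>j<k. X j (\<omega> j) - (\<integral>x. X j x \<partial>M)) / real (block_start k)) 0 < e"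
        using eventually_gt_at_top[of 0]
      proof eventually_elim
        case (elim k)
        have bs: "real (block_start k) > 0" using block_start_ge[of k] elim(2) by simp
        have "\<bar>\<Sum>j<k. X j (\<omega> j) - (\<integral>x. X j x \<partial>M)\<bar> < 1 / real (Suc n) * real (block_start k)"
          using elim(1) \<open>\<omega> \<in> space ?\<Omega>\<close> by (simp add: B_def sum_subtractf)
        also have "\<dots> \<le> e * real (block_start k)" using n by (intro mult_right_mono) auto
        finally show ?case using bs by (simp add: field_simps)
      qed
    qed
  qed
qed

text \<open>The jumps of \<open>p\<close> may have any size: the error is less than \<open>\<epsilon>\<close> at all times whose distance to the
  jumps is at least \<open>L \<epsilon>\<close>. The same orbit serves all \<open>\<epsilon>\<close>.\<close>

definition jump_shadowing :: "('a::metric_space \<Rightarrow> 'a) \<Rightarrow> bool" where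
  "jump_shadowing f \<longleftrightarrow> (\<exists>L :: real \<Rightarrow> nat. \<forall>p. \<exists>y. \<forall>\<epsilon>>0. \<forall>t.
     (\<forall>s. s < t + L \<epsilon> \<and> t \<le> s + L \<epsilon> \<longrightarrow> p (Suc s) = f (p s)) \<longrightarrow> dist ((f ^^ t) y) (p t) < \<epsilon>)"

text \<open>The condition is void for blocks with \<open>k < 2 * L \<epsilon>\<close>, which are too
  short to be followed; for each \<open>\<epsilon>\<close> there are finitely many of them.\<close>

definition glues :: "('a::metric_space \<Rightarrow> 'a) \<Rightarrow> (real \<Rightarrow> nat) \<Rightarrow> ((nat \<Rightarrow> 'a) \<Rightarrow> 'a) \<Rightarrow> bool" where
  "glues f L Y \<longleftrightarrow> (\<forall>\<omega> \<epsilon> k i. 0 < \<epsilon> \<longrightarrow> L \<epsilon> \<le> i \<longrightarrow> i + L \<epsilon> \<le> k \<longrightarrow>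
     dist ((f ^^ (block_start k + i)) (Y \<omega>)) ((f ^^ i) (\<omega> k)) < \<epsilon>)"

lemma gluesD:
  "glues f L Y \<Longrightarrow> 0 < \<epsilon> \<Longrightarrow> L \<epsilon> \<le> i \<Longrightarrow> i + L \<epsilon> \<le> k \<Longrightarrow>
     dist ((f ^^ (block_start k + i)) (Y \<omega>)) ((f ^^ i) (\<omega> k)) < \<epsilon>"
  by (simp add: glues_def)

lemma jump_shadowing_glue:
  assumes "jump_shadowing f"
  obtains L Y where "glues f L Y"
proof -
  obtain L where L: "\<forall>p. \<exists>y. \<forall>\<epsilon>>0. \<forall>t.
     (\<forall>s. s < t + L \<epsilon> \<and> t \<le> s + L \<epsilon> \<longrightarrow> p (Suc s) = f (p s)) \<longrightarrow> dist ((f ^^ t) y) (p t) < \<epsilon>"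
    using assms unfolding jump_shadowing_def by (rule exE)
  from choice[OF L] obtain y where y: "\<forall>p. \<forall>\<epsilon>>0. \<forall>t.
     (\<forall>s. s < t + L \<epsilon> \<and> t \<le> s + L \<epsilon> \<longrightarrow> p (Suc s) = f (p s)) \<longrightarrow> dist ((f ^^ t) (y p)) (p t) < \<epsilon>"
    by (rule exE)
  \<comment> \<open>The concatenation of the segments; it can jump only from the last time of a
    block to the first time of the next.\<close>
  define p where "p \<omega> t = (f ^^ (t - block_start (block_index t))) (\<omega> (block_index t))" for \<omega> t
  have p: "p \<omega> (block_start k + i) = (f ^^ i) (\<omega> k)" if "i \<le> k" for \<omega> k i
    using block_index_eqI[of k "block_start k + i"] that by (simp add: p_def block_start_Suc)
  show ?thesis
  proof (rule that[of L "\<lambda>\<omega>. y (p \<omega>)"], unfold glues_def, intro allI impI)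
    fix \<omega> \<epsilon> k i assume *: "0 < \<epsilon>" "L \<epsilon> \<le> i" "i + L \<epsilon> \<le> k"
    have "p \<omega> (Suc s) = f (p \<omega> s)"
      if "s < block_start k + i + L \<epsilon>" "block_start k + i \<le> s + L \<epsilon>" for s
    proof -
      \<comment> \<open>Block \<open>k\<close> ends at time \<open>block_start k + k\<close>, so
        both \<open>s\<close> and \<open>Suc s\<close> lie inside it and there is no jump between
        them.\<close>
      have "block_start k \<le> s" "s < block_start k + k" using that * by auto
      then obtain i' where i': "s = block_start k + i'" "i' < k"
        by (metis add_less_cancel_left le_iff_add)
      show ?thesis using p[of i' k \<omega>] p[of "Suc i'" k \<omega>] i' by simp
    qed
    then have "dist ((f ^^ (block_start k + i)) (y (p \<omega>))) (p \<omega> (block_start k + i)) < \<epsilon>"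
      using y *(1) by blast
    then show "dist ((f ^^ (block_start k + i)) (y (p \<omega>))) ((f ^^ i) (\<omega> k)) < \<epsilon>"
      using p[of i k \<omega>] * by simp
  qed
qed

section \<open>Birkhoff sums along glued orbits\<close>

lemma birkhoff_sum_add:
  "birkhoff_sum f (m + n) \<phi> x = birkhoff_sum f m \<phi> x + birkhoff_sum f n \<phi> ((f ^^ m) x)"
  by (induction n) (simp_all add: birkhoff_sum_def funpow_add add.commute[of m] flip: add.assoc)

lemma birkhoff_sum_block_start:
  "birkhoff_sum f (block_start k) \<phi> x = (\<Sum>j<k. birkhoff_sum f (Suc j) \<phi> ((f ^^ block_start j) x))"
proof (induction k)
  case (Suc k)
  then show ?case by (simp only: block_start_Suc birkhoff_sum_add sum.lessThan_Suc)
qed (simp add: birkhoff_sum_def)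

lemma abs_birkhoff_sum_le:
  assumes "\<And>x. \<bar>\<phi> x\<bar> \<le> B"
  shows "\<bar>birkhoff_sum f n \<phi> x\<bar> \<le> B * real n"
proof -
  have "\<bar>birkhoff_sum f n \<phi> x\<bar> \<le> (\<Sum>i<n. B)"
    unfolding birkhoff_sum_def by (rule order_trans[OF sum_abs]) (intro sum_mono assms)
  then show ?thesis by (simp add: mult.commute)
qed

context compact_system
begin

lemma uniform_continuity:
  fixes \<phi> :: "'a \<Rightarrow> real"
  assumes "continuous_on UNIV \<phi>" "\<delta> > 0"
  obtains \<eta> where "\<eta> > 0" "\<And>x y. dist x y < \<eta> \<Longrightarrow> \<bar>\<phi> x - \<phi> y\<bar> < \<delta>"
  using compact_uniformly_continuous[OF assms(1) compact_UNIV] assms(2)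
  unfolding uniformly_continuous_on_def dist_real_def by (metis UNIV_I dist_commute)

text \<open>Each block has at most \<open>2 * l\<close> uncontrolled times, each costing at most
  \<open>2 * B\<close>, and the unfinished block costs at most \<open>B\<close> per step. The total
  is linear in \<open>k\<close> while \<open>m\<close> is quadratic. The threshold depends on
  \<open>\<phi>\<close> and \<open>\<delta>\<close> but not on \<open>\<omega>\<close>, which later
  makes the estimate uniform over covers.\<close>

lemma glued_birkhoff_sum:
  fixes \<phi> :: "'a \<Rightarrow> real"
  assumes glue: "glues f L Y"
    and \<phi>: "continuous_on UNIV \<phi>" and \<delta>: "\<delta> > 0"
  obtains K where "\<And>\<omega> k m. K \<le> k \<Longrightarrow> block_start k \<le> m \<Longrightarrow> m < block_start (Suc k) \<Longrightarrow>
    \<bar>birkhoff_sum f m \<phi> (Y \<omega>) - (\<Sum>j<k. birkhoff_sum f (Suc j) \<phi> (\<omega> j))\<bar> \<le> \<delta> * real m"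
proof -
  obtain B where B: "B > 0" "\<And>x. \<bar>\<phi> x\<bar> \<le> B" using bounded_continuous[OF \<phi>] by blast
  obtain \<eta> where \<eta>: "\<eta> > 0" "\<And>x y. dist x y < \<eta> \<Longrightarrow> \<bar>\<phi> x - \<phi> y\<bar> < \<delta> / 2"
    using uniform_continuity[OF \<phi>, of "\<delta> / 2"] \<delta> by auto
  define l where "l = L \<eta>"
  \<comment> \<open>For \<open>k \<ge> K\<close> the linear cost
    \<open>(4 * l + 1) * B * (k + 1)\<close> is at most \<open>\<delta> / 4 * k * (k + 1)\<close>,
    which is \<open>\<delta> / 2 * block_start k\<close>.\<close>
  obtain K :: nat where K: "(4 * real l + 1) * B * 4 / \<delta> \<le> real K" using real_arch_simple by blast
  show ?thesis
  proof (rule that[of K])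
    fix \<omega> k m assume k: "K \<le> k" and m: "block_start k \<le> m" "m < block_start (Suc k)"
    have block: "\<bar>birkhoff_sum f (Suc j) \<phi> ((f ^^ block_start j) (Y \<omega>)) - birkhoff_sum f (Suc j) \<phi> (\<omega> j)\<bar>
        \<le> \<delta> / 2 * real (Suc j) + 4 * B * real l" for j
    proof -
      \<comment> \<open>The uncontrolled times at both ends. In short blocks the two pieces overlap
        or the subtraction is cut off at 0, and the count \<open>2 * l\<close> still holds.\<close>
      define S where "S = {..<l} \<union> {Suc j - l..<Suc j}"
      have pt: "\<bar>\<phi> ((f ^^ i) ((f ^^ block_start j) (Y \<omega>))) - \<phi> ((f ^^ i) (\<omega> j))\<bar>
          \<le> \<delta> / 2 + (if i \<in> S then 2 * B else 0)" if "i < Suc j" for i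
      proof (cases "i \<in> S")
        case True
        then show ?thesis
          using B(2)[of "(f ^^ i) ((f ^^ block_start j) (Y \<omega>))"] B(2)[of "(f ^^ i) (\<omega> j)"] \<delta> by simp
      next
        case False
        then have "l \<le> i" "i + l \<le> j" using that by (auto simp: S_def)
        then have "dist ((f ^^ (block_start j + i)) (Y \<omega>)) ((f ^^ i) (\<omega> j)) < \<eta>"
          unfolding l_def by (rule gluesD[OF glue \<eta>(1)])
        then have "\<bar>\<phi> ((f ^^ (i + block_start j)) (Y \<omega>)) - \<phi> ((f ^^ i) (\<omega> j))\<bar> < \<delta> / 2"
          using \<eta>(2) by (simp add: add.commute)
        then show ?thesis using False by (simp add: funpow_add )
      qed
      have "\<bar>birkhoff_sum f (Suc j) \<phi> ((f ^^ block_start j) (Y \<omega>)) - birkhoff_sum f (Suc j) \<phi> (\<omega> j)\<bar>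
          \<le> (\<Sum>i<Suc j. \<delta> / 2 + (if i \<in> S then 2 * B else 0))"
        unfolding birkhoff_sum_def sum_subtractf[symmetric]
        by (rule order_trans[OF sum_abs]) (intro sum_mono pt, simp)
      also have "\<dots> = \<delta> / 2 * real (Suc j)
          + 2 * B * real (card ({..<Suc j} \<inter> S))"
        by (simp add: sum.distrib sum.If_cases del: sum.lessThan_Suc)
      also have "card ({..<Suc j} \<inter> S) \<le> card {..<l} + card {Suc j - l..<Suc j}"
        unfolding S_def by (rule order_trans[OF card_mono card_Un_le]) auto
      also have "\<dots> \<le> 2 * l" by auto
      finally show ?thesis using B(1) by (simp add: mult_left_mono)
    qed
    have "\<bar>birkhoff_sum f (block_start k) \<phi> (Y \<omega>) - (\<Sum>j<k. birkhoff_sum f (Suc j) \<phi> (\<omega> j))\<bar>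
        \<le> (\<Sum>j<k. \<delta> / 2 * real (Suc j) + 4 * B * real l)"
      unfolding birkhoff_sum_block_start sum_subtractf[symmetric]
      by (rule order_trans[OF sum_abs]) (intro sum_mono block)
    also have "\<dots> = \<delta> / 2 * real (block_start k) + 4 * B * real l * real k"
      by (simp only: sum.distrib block_start_def of_nat_sum sum_distrib_left) simp
    finally have 1: "\<bar>birkhoff_sum f (block_start k) \<phi> (Y \<omega>) - (\<Sum>j<k. birkhoff_sum f (Suc j) \<phi> (\<omega> j))\<bar>
        \<le> \<delta> / 2 * real (block_start k) + 4 * B * real l * real k" .
    have "birkhoff_sum f m \<phi> (Y \<omega>) = birkhoff_sum f (block_start k) \<phi> (Y \<omega>)
        + birkhoff_sum f (m - block_start k) \<phi> ((f ^^ block_start k) (Y \<omega>))"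
      using birkhoff_sum_add[of f "block_start k" "m - block_start k"] m by simp
    moreover have "\<bar>birkhoff_sum f (m - block_start k) \<phi> ((f ^^ block_start k) (Y \<omega>))\<bar>
        \<le> B * real (m - block_start k)"
      by (rule abs_birkhoff_sum_le[OF B(2)])
    moreover have "B * real (m - block_start k) \<le> B * (real k + 1)"
      using m B by (intro mult_left_mono) (auto simp: block_start_Suc)
    ultimately have "\<bar>birkhoff_sum f m \<phi> (Y \<omega>) - (\<Sum>j<k. birkhoff_sum f (Suc j) \<phi> (\<omega> j))\<bar>
        \<le> \<delta> / 2 * real (block_start k) + (4 * B * real l * real k + B * (real k + 1))"
      using 1 by linarith
    also have "4 * B * real l * real k + B * (real k + 1) \<le> (4 * real l + 1) * B * (real k + 1)"
      using B by (simp add: algebra_simps)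
    also have "(4 * real l + 1) * B \<le> \<delta> / 4 * real k"
      using K k \<delta> by (simp add: field_simps order_trans[OF _ mult_left_mono[of "real K" "real k" \<delta>]])
    also have "\<delta> / 4 * real k * (real k + 1) = \<delta> / 2 * real (block_start k)"
      by (simp add: real_block_start)
    finally have "\<bar>birkhoff_sum f m \<phi> (Y \<omega>) - (\<Sum>j<k. birkhoff_sum f (Suc j) \<phi> (\<omega> j))\<bar>
        \<le> \<delta> * real (block_start k)" by simp
    also have "\<dots> \<le> \<delta> * real m" using m \<delta> by simp
    finally show "\<bar>birkhoff_sum f m \<phi> (Y \<omega>) - (\<Sum>j<k. birkhoff_sum f (Suc j) \<phi> (\<omega> j))\<bar> \<le> \<delta> * real m" .
  qed
qed

end

section \<open>Generic points\<close>

text \<open>Countable subadditivity in terms of unordered sums, the form in which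
  \<open>pressure_sum\<close> adds up a cover.\<close>

lemma emeasure_UN_le_infsum:
  fixes D :: "'i \<Rightarrow> 'a set"
  assumes "countable C" and D: "\<And>c. c \<in> C \<Longrightarrow> D c \<in> sets M"
  shows "emeasure M (\<Union>c\<in>C. D c) \<le> (\<Sum>\<^sub>\<infinity>c\<in>C. emeasure M (D c))"
proof (cases "finite C")
  case True
  then show ?thesis using D emeasure_subadditive_finite[of C D M] by auto
next
  case False
  let ?e = "from_nat_into C"
  have bij: "bij_betw ?e UNIV C" using assms(1) False by (rule bij_betw_from_nat_into)
  have "(\<Union>c\<in>C. D c) = (\<Union>c\<in>range ?e. D c)" using bij by (simp add: bij_betw_def)
  also have "\<dots> = (\<Union>i. D (?e i))" by simp
  also have "emeasure M \<dots> \<le> (\<Sum>i. emeasure M (D (?e i)))"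
    using bij D by (intro emeasure_subadditive_countably) (auto simp: bij_betw_def)
  also have "\<dots> = (SUP n. \<Sum>i<n. emeasure M (D (?e i)))" by (rule suminf_eq_SUP)
  also have "\<dots> \<le> (SUP F\<in>{F. finite F \<and> F \<subseteq> C}. \<Sum>c\<in>F. emeasure M (D c))"
  proof (rule SUP_mono)
    fix n
    have inj: "inj_on ?e {..<n}" using bij by (auto simp: bij_betw_def intro: inj_on_subset)
    show "\<exists>F\<in>{F. finite F \<and> F \<subseteq> C}. (\<Sum>i<n. emeasure M (D (?e i))) \<le> (\<Sum>c\<in>F. emeasure M (D c))"
      using bij by (intro bexI[of _ "?e ` {..<n}"]) (auto simp: sum.reindex[OF inj] bij_betw_def)
  qed
  also have "\<dots> = (\<Sum>\<^sub>\<infinity>c\<in>C. emeasure M (D c))"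
    by (rule nonneg_infsum_complete[symmetric]) simp
  finally show ?thesis .
qed

lemma limitin_topology_generated_by:
  assumes "l \<in> \<Union>S" "\<And>U. U \<in> S \<Longrightarrow> l \<in> U \<Longrightarrow> \<forall>\<^sub>F n in F. X n \<in> U"
  shows "limitin (topology_generated_by S) X l F"
  unfolding limitin_def
proof (intro conjI allI impI)
  show "l \<in> topspace (topology_generated_by S)" using assms(1) by simp
  fix U assume U: "openin (topology_generated_by S) U \<and> l \<in> U"
  then have "generate_topology_on S U" by (simp add: openin_topology_generated_by_iff)
  then have "l \<in> U \<longrightarrow> (\<forall>\<^sub>F n in F. X n \<in> U)"
  proof induction
    case (Int a b)
    then show ?case by (auto elim: eventually_elim2)
  next
    case (UN K)
    show ?case
    proof
      assume "l \<in> \<Union>K"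
      then obtain k where k: "k \<in> K" "l \<in> k" by blast
      then have "\<forall>\<^sub>F n in F. X n \<in> k" using UN.IH by blast
      then show "\<forall>\<^sub>F n in F. X n \<in> \<Union>K" by (rule eventually_mono) (use k in blast)
    qed
  qed (use assms(2) in auto)
  then show "\<forall>\<^sub>F n in F. X n \<in> U" using U by blast
qed

lemma integral_empirical_measure:
  fixes \<phi> :: "'a::topological_space \<Rightarrow> real"
  assumes "\<phi> \<in> borel_measurable borel" "n > 0"
  shows "(\<integral>x. \<phi> x \<partial>empirical_measure f n x0) = birkhoff_sum f n \<phi> x0 / real n"
proof -
  have "(\<integral>x. \<phi> x \<partial>empirical_measure f n x0)
      = (\<integral>i. \<phi> ((f ^^ i) x0) \<partial>uniform_count_measure {..<n})"
    unfolding empirical_measure_def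
    by (rule integral_distr[OF _ assms(1)])
      (auto simp: measurable_def sets_uniform_count_measure space_uniform_count_measure)
  also have "\<dots> = birkhoff_sum f n \<phi> x0 / real n"
    using assms(2)
    by (simp add: uniform_count_measure_def lebesgue_integral_point_measure_finite birkhoff_sum_def
        sum_divide_distrib)
  finally show ?thesis .
qed

lemma empirical_measure_probs: "n > 0 \<Longrightarrow> empirical_measure f n x \<in> borel_probs"
proof -
  assume n: "n > 0"
  interpret prob_space "uniform_count_measure {..<n}"
    by (rule prob_space_uniform_count_measure) (use n in auto)
  have "prob_space (empirical_measure f n x)"
    unfolding empirical_measure_def
    by (rule prob_space_distr) (auto simp: measurable_def sets_uniform_count_measure space_uniform_count_measure)
  then show ?thesis by (simp add: borel_probs_def empirical_measure_def)
qed

context compact_system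
begin

lemma nu_probs: "\<nu> \<in> borel_probs"
  using prob_space_axioms by (simp add: borel_probs_def sets_nu)

text \<open>The subbasis of \<open>weak_star\<close> is indexed by bounded continuous functions, and
  compactness makes every continuous function bounded.\<close>

lemma generic_points_iff:
  "x \<in> generic_points f \<nu> \<longleftrightarrow>
    (\<forall>\<phi> :: 'a \<Rightarrow> real. continuous_on UNIV \<phi> \<longrightarrow>
       (\<lambda>n. birkhoff_sum f n \<phi> x / real n) \<longlonglongrightarrow> (\<integral>x. \<phi> x \<partial>\<nu>))"
proof -
  define S where "S = {{\<mu> \<in> borel_probs. (\<integral>x. \<phi> x \<partial>\<mu>) \<in> V} |\<phi> V.
        continuous_on UNIV (\<phi> :: 'a \<Rightarrow> real) \<and> bounded (range \<phi>) \<and> open V}"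
  have weak: "weak_star = topology_generated_by S" by (simp add: weak_star_def S_def)
  have bdd: "bounded (range \<phi>)" if "continuous_on UNIV \<phi>" for \<phi> :: "'a \<Rightarrow> real"
    using compact_continuous_image[OF that compact_UNIV] compact_imp_bounded by blast
  \<comment> \<open>Stated eventually, because for \<open>n = 0\<close> the empirical measure is the
    null measure and no probability.\<close>
  have int: "\<forall>\<^sub>F n in sequentially. empirical_measure f n x \<in> borel_probs \<and>
     (\<integral>x. \<phi> x \<partial>empirical_measure f n x) = birkhoff_sum f n \<phi> x / real n"
    if "continuous_on UNIV \<phi>" for \<phi> :: "'a \<Rightarrow> real"
    using eventually_gt_at_top[of 0]
    by eventually_elim (use that empirical_measure_probs integral_empirical_measure[OF borel_measurable_continuous_onI] in auto)
  show ?thesis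
  proof (intro iffI allI impI)
    fix \<phi> :: "'a \<Rightarrow> real"
    assume x: "x \<in> generic_points f \<nu>" and \<phi>: "continuous_on UNIV \<phi>"
    show "(\<lambda>n. birkhoff_sum f n \<phi> x / real n) \<longlonglongrightarrow> (\<integral>x. \<phi> x \<partial>\<nu>)"
    proof (rule topological_tendstoI)
      fix V :: "real set" assume V: "open V" "(\<integral>x. \<phi> x \<partial>\<nu>) \<in> V"
      let ?U = "{\<mu> \<in> borel_probs. (\<integral>x. \<phi> x \<partial>\<mu>) \<in> V}"
      have "?U \<in> S" unfolding S_def using \<phi> V bdd by blast
      then have "openin weak_star ?U" unfolding weak by (rule topology_generated_by_Basis)
      then have "\<forall>\<^sub>F n in sequentially. empirical_measure f n x \<in> ?U"
        using x V nu_probs by (auto simp: generic_points_def limitin_def)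
      then show "\<forall>\<^sub>F n in sequentially. birkhoff_sum f n \<phi> x / real n \<in> V"
        using int[OF \<phi>] by eventually_elim auto
    qed
  next
    assume conv: "\<forall>\<phi> :: 'a \<Rightarrow> real. continuous_on UNIV \<phi> \<longrightarrow>
       (\<lambda>n. birkhoff_sum f n \<phi> x / real n) \<longlonglongrightarrow> (\<integral>x. \<phi> x \<partial>\<nu>)"
    have "limitin (topology_generated_by S) (\<lambda>n. empirical_measure f n x) \<nu> sequentially"
    proof (rule limitin_topology_generated_by)
      have "{\<mu> \<in> borel_probs. (\<integral>x. (0::real) \<partial>\<mu>) \<in> UNIV} \<in> S"
        unfolding S_def by (intro CollectI exI[of _ "\<lambda>_. 0"] exI[of _ UNIV]) auto
      then show "\<nu> \<in> \<Union>S" using nu_probs by blast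
      fix U assume "U \<in> S" "\<nu> \<in> U"
      then obtain \<phi> V where U: "U = {\<mu> \<in> borel_probs. (\<integral>x. \<phi> x \<partial>\<mu>) \<in> V}"
        "continuous_on UNIV (\<phi> :: 'a \<Rightarrow> real)" "open V" "(\<integral>x. \<phi> x \<partial>\<nu>) \<in> V"
        by (auto simp: S_def)
      then have "\<forall>\<^sub>F n in sequentially. birkhoff_sum f n \<phi> x / real n \<in> V"
        using conv by (intro topological_tendstoD) auto
      then show "\<forall>\<^sub>F n in sequentially. empirical_measure f n x \<in> U"
        using int[OF U(2)] by eventually_elim (auto simp: U(1))
    qed
    then show "x \<in> generic_points f \<nu>" by (simp add: generic_points_def weak)
  qed
qed

text \<open>The set \<open>F\<close> consists of the members of partitions of unity, one for each scale \<open>1 / Suc k\<close>.\<close>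

lemma countable_dense_span:
  obtains F :: "('a \<Rightarrow> real) set" where "countable F" "\<And>\<theta>. \<theta> \<in> F \<Longrightarrow> continuous_on UNIV \<theta>"
    "\<And>\<phi> \<delta>. continuous_on UNIV \<phi> \<Longrightarrow> \<delta> > 0 \<Longrightarrow>
       \<exists>S c. finite S \<and> S \<subseteq> F \<and> (\<forall>x. \<bar>\<phi> x - (\<Sum>\<theta>\<in>S. c \<theta> * \<theta> x)\<bar> \<le> \<delta>)"
proof -
  have "\<exists>N :: 'a set. finite N \<and> (\<forall>x. \<exists>q\<in>N. dist q x < 1 / real (Suc k))" for k
  proof -
    have "\<forall>e>0. \<exists>N :: 'a set. finite N \<and> UNIV \<subseteq> (\<Union>q\<in>N. ball q e)"
      using compact_UNIV compact_eq_totally_bounded[of UNIV] by blast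
    then obtain N :: "'a set" where "finite N" "UNIV \<subseteq> (\<Union>q\<in>N. ball q (1 / real (Suc k)))"
      by (metis of_nat_0_less_iff zero_less_Suc zero_less_divide_1_iff)
    then show ?thesis by (intro exI[of _ N]) (auto simp: subset_iff)
  qed
  then obtain N :: "nat \<Rightarrow> 'a set" where N: "\<And>k. finite (N k)" "\<And>k x. \<exists>q\<in>N k. dist q x < 1 / real (Suc k)"
    by metis
  \<comment> \<open>Tents of radius \<open>1 / Suc k\<close> about the points of a finite net. Their
    sum is positive since the net meets every ball of this radius, so they can be
    normalised.\<close>
  define b where "b k q x = max 0 (1 / real (Suc k) - dist q x)" for k q and x :: 'a
  define s where "s k x = (\<Sum>q\<in>N k. b k q x)" for k x
  define \<theta> where "\<theta> k q x = b k q x / s k x" for k q x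
  have b0: "0 \<le> b k q x" for k q x by (simp add: b_def)
  have s: "s k x > 0" for k x
  proof -
    obtain q where "q \<in> N k" "dist q x < 1 / real (Suc k)" using N(2) by blast
    then show ?thesis unfolding s_def using N(1) b0 by (intro sum_pos2[of _ q]) (auto simp: b_def)
  qed
  have cb: "continuous_on UNIV (b k q)" for k q unfolding b_def by (intro continuous_intros)
  have c\<theta>: "continuous_on UNIV (\<theta> k q)" for k q
    unfolding \<theta>_def s_def using s cb by (intro continuous_intros) (auto simp: s_def less_le)
  have sum1: "(\<Sum>q\<in>N k. \<theta> k q x) = 1" for k x
    using s[of k x] by (simp add: \<theta>_def s_def flip: sum_divide_distrib)
  have \<theta>0: "0 \<le> \<theta> k q x" for k q x
    using b0[of k q x] s[of k x] by (simp add: \<theta>_def)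
  show ?thesis
  proof (rule that[of "\<Union>k. \<theta> k ` N k"])
    show "countable (\<Union>k. \<theta> k ` N k)" using N(1) by (simp add: countable_finite)
    show "continuous_on UNIV \<phi>" if "\<phi> \<in> (\<Union>k. \<theta> k ` N k)" for \<phi> using that c\<theta> by auto
    fix \<phi> :: "'a \<Rightarrow> real" and \<delta> :: real assume \<phi>: "continuous_on UNIV \<phi>" "\<delta> > 0"
    obtain \<eta> where \<eta>: "\<eta> > 0" "\<And>x y. dist x y < \<eta> \<Longrightarrow> \<bar>\<phi> x - \<phi> y\<bar> < \<delta>"
      using uniform_continuity[OF \<phi>] by blast
    obtain k where k: "1 / real (Suc k) < \<eta>" using nat_approx_posE[OF \<eta>(1)] by blast
    \<comment> \<open>Different net points may give the same function, so the coefficient of a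
      function collects the values at all of them.\<close>
    define c where "c t = (\<Sum>q\<in>{q \<in> N k. \<theta> k q = t}. \<phi> q)" for t
    show "\<exists>S c. finite S \<and> S \<subseteq> (\<Union>k. \<theta> k ` N k) \<and> (\<forall>x. \<bar>\<phi> x - (\<Sum>\<theta>\<in>S. c \<theta> * \<theta> x)\<bar> \<le> \<delta>)"
    proof (intro exI conjI allI)
      show "finite (\<theta> k ` N k)" using N(1) by simp
      show "\<theta> k ` N k \<subseteq> (\<Union>k. \<theta> k ` N k)" by auto
      fix x
      have "(\<Sum>t\<in>\<theta> k ` N k. c t * t x) = (\<Sum>t\<in>\<theta> k ` N k. \<Sum>q\<in>{q \<in> N k. \<theta> k q = t}. \<phi> q * \<theta> k q x)"
        by (intro sum.cong refl) (auto simp: c_def sum_distrib_right intro!: sum.cong)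
      also have "\<dots> = (\<Sum>q\<in>N k. \<phi> q * \<theta> k q x)" by (rule sum.image_gen[OF N(1), symmetric])
      finally have "\<phi> x - (\<Sum>t\<in>\<theta> k ` N k. c t * t x) = (\<Sum>q\<in>N k. (\<phi> x - \<phi> q) * \<theta> k q x)"
        using sum1[of k x] by (simp add: left_diff_distrib sum_subtractf flip: sum_distrib_left)
      also have "\<bar>\<dots>\<bar> \<le> (\<Sum>q\<in>N k. \<delta> * \<theta> k q x)"
      proof (rule order_trans[OF sum_abs sum_mono])
        fix q
        show "\<bar>(\<phi> x - \<phi> q) * \<theta> k q x\<bar> \<le> \<delta> * \<theta> k q x"
        proof (cases "dist q x < 1 / real (Suc k)")
          case True
          then have "\<bar>\<phi> x - \<phi> q\<bar> \<le> \<delta>" using k \<eta>(2)[of x q] by (simp add: dist_commute)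
          then show ?thesis using \<theta>0[of k q x] by (simp add: abs_mult mult_right_mono)
        next
          case False
          then have "\<theta> k q x = 0" by (simp add: \<theta>_def b_def)
          then show ?thesis by simp
        qed
      qed
      also have "\<dots> = \<delta>" using sum1[of k x] by (simp flip: sum_distrib_left)
      finally show "\<bar>\<phi> x - (\<Sum>t\<in>\<theta> k ` N k. c t * t x)\<bar> \<le> \<delta>" .
    qed
  qed
qed

text \<open>Uniform approximation transfers the limit from \<open>F\<close> to all continuous
  functions. For countable \<open>F\<close> genericity thus follows from countably many limits, and
  almost sure statements about single functions can be combined.\<close>

lemma generic_points_criterion:
  fixes F :: "('a \<Rightarrow> real) set"
  assumes F: "\<And>\<theta>. \<theta> \<in> F \<Longrightarrow> continuous_on UNIV \<theta>"
    and dense: "\<And>\<phi> \<delta>. continuous_on UNIV \<phi> \<Longrightarrow> \<delta> > 0 \<Longrightarrow>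
       \<exists>S c. finite S \<and> S \<subseteq> F \<and> (\<forall>x. \<bar>\<phi> x - (\<Sum>\<theta>\<in>S. c \<theta> * \<theta> x)\<bar> \<le> \<delta>)"
    and lim: "\<And>\<theta>. \<theta> \<in> F \<Longrightarrow> (\<lambda>n. birkhoff_sum f n \<theta> x / real n) \<longlonglongrightarrow> (\<integral>x. \<theta> x \<partial>\<nu>)"
  shows "x \<in> generic_points f \<nu>"
  unfolding generic_points_iff
proof (intro allI impI)
  fix \<phi> :: "'a \<Rightarrow> real" assume \<phi>: "continuous_on UNIV \<phi>"
  show "(\<lambda>n. birkhoff_sum f n \<phi> x / real n) \<longlonglongrightarrow> (\<integral>x. \<phi> x \<partial>\<nu>)"
  proof (rule tendstoI)
    fix e :: real assume e: "e > 0"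
    obtain S c where S: "finite S" "S \<subseteq> F" "\<And>x. \<bar>\<phi> x - (\<Sum>\<theta>\<in>S. c \<theta> * \<theta> x)\<bar> \<le> e / 4"
      using dense[OF \<phi>, of "e / 4"] e by auto
    let ?\<psi> = "\<lambda>x. \<Sum>\<theta>\<in>S. c \<theta> * \<theta> x"
    have c\<psi>: "continuous_on UNIV ?\<psi>" using S F by (intro continuous_intros) auto
    have "(\<lambda>n. \<Sum>\<theta>\<in>S. c \<theta> * (birkhoff_sum f n \<theta> x / real n)) \<longlonglongrightarrow> (\<Sum>\<theta>\<in>S. c \<theta> * (\<integral>x. \<theta> x \<partial>\<nu>))"
      using S lim by (intro tendsto_intros) auto
    moreover have "(\<Sum>\<theta>\<in>S. c \<theta> * (birkhoff_sum f n \<theta> x / real n)) = birkhoff_sum f n ?\<psi> x / real n" for n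
      unfolding birkhoff_sum_def
      by (subst sum.swap) (simp add: sum_distrib_left sum_divide_distrib)
    moreover have "(\<Sum>\<theta>\<in>S. c \<theta> * (\<integral>x. \<theta> x \<partial>\<nu>)) = (\<integral>x. ?\<psi> x \<partial>\<nu>)"
      using S F integrable_continuous by (subst Bochner_Integration.integral_sum) auto
    ultimately have "(\<lambda>n. birkhoff_sum f n ?\<psi> x / real n) \<longlonglongrightarrow> (\<integral>x. ?\<psi> x \<partial>\<nu>)" by simp
    then have "\<forall>\<^sub>F n in sequentially. dist (birkhoff_sum f n ?\<psi> x / real n) (\<integral>x. ?\<psi> x \<partial>\<nu>) < e / 4"
      using e by (intro tendstoD) auto
    then show "\<forall>\<^sub>F n in sequentially. dist (birkhoff_sum f n \<phi> x / real n) (\<integral>x. \<phi> x \<partial>\<nu>) < e"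
      using eventually_gt_at_top[of 0]
    proof eventually_elim
      case (elim n)
      have "birkhoff_sum f n \<phi> x - birkhoff_sum f n ?\<psi> x = birkhoff_sum f n (\<lambda>x. \<phi> x - ?\<psi> x) x"
        by (simp add: birkhoff_sum_def sum_subtractf)
      then have "\<bar>birkhoff_sum f n \<phi> x - birkhoff_sum f n ?\<psi> x\<bar> \<le> e / 4 * real n"
        using abs_birkhoff_sum_le[of "\<lambda>x. \<phi> x - ?\<psi> x" "e / 4" f n x] S(3) by simp
      then have 1: "\<bar>birkhoff_sum f n \<phi> x / real n - birkhoff_sum f n ?\<psi> x / real n\<bar> \<le> e / 4"
        using elim(2) by (simp add: field_simps flip: diff_divide_distrib)
      have "\<bar>(\<integral>x. \<phi> x - ?\<psi> x \<partial>\<nu>)\<bar> \<le> (\<integral>x. e / 4 \<partial>\<nu>)"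
        using S(3) integrable_continuous[OF \<phi>] integrable_continuous[OF c\<psi>]
        by (intro order_trans[OF integral_abs_bound integral_mono]) auto
      then have 2: "\<bar>(\<integral>x. \<phi> x \<partial>\<nu>) - (\<integral>x. ?\<psi> x \<partial>\<nu>)\<bar> \<le> e / 4"
        using integrable_continuous[OF \<phi>] integrable_continuous[OF c\<psi>] by (simp add: prob_space[simplified])
      show ?case using 1 2 elim(1) e unfolding dist_real_def by linarith
    qed
  qed
qed

end

section \<open>The lower bound\<close>

text \<open>A larger \<open>n\<close> admits fewer covers, so the infima increase and the
  \<open>lim\<close> of the definition exists.\<close>

lemma pressure_outer_eq_SUP: "pressure_outer f Z t \<psi> \<rho> = (SUP n. pressure_sum f Z t \<psi> n \<rho>)"
proof -
  have "incseq (\<lambda>n. pressure_sum f Z t \<psi> n \<rho>)"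
    unfolding incseq_def pressure_sum_def
    by (auto intro!: INF_superset_mono simp: bowen_covers_def)
  then show ?thesis unfolding pressure_outer_def by (intro limI LIMSEQ_SUP)
qed

text \<open>Any cost proportional to the number of blocks is absorbed by the quadratic growth of
  \<open>block_start\<close>.\<close>

lemma eventually_linear_le_block_start:
  assumes "\<delta> > 0"
  shows "\<forall>\<^sub>F k in sequentially. c * (real k + 1) \<le> \<delta> * real (block_start k)"
proof -
  obtain K :: nat where K: "2 * c / \<delta> \<le> real K" using real_arch_simple by blast
  show ?thesis
    using eventually_ge_at_top[of K]
  proof eventually_elim
    case (elim k)
    have "c \<le> \<delta> * real K / 2" using K assms by (simp add: field_simps)
    also have "\<dots> \<le> \<delta> * real k / 2" using elim assms by (intro divide_right_mono mult_left_mono) auto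
    finally have "c * (real k + 1) \<le> \<delta> * real k / 2 * (real k + 1)" by (intro mult_right_mono) auto
    then show ?case by (simp add: real_block_start)
  qed
qed

lemma filterlim_block_index: "filterlim block_index at_top sequentially"
  unfolding filterlim_at_top
proof
  fix K
  show "\<forall>\<^sub>F n in sequentially. K \<le> block_index n"
    using eventually_ge_at_top[of "block_start K"]
  proof eventually_elim
    case (elim n)
    show ?case
    proof (rule ccontr)
      assume "\<not> K \<le> block_index n"
      then have "block_start (Suc (block_index n)) \<le> block_start K" by (intro block_start_mono) simp
      then show False using elim block_index(2)[of n] by simp
    qed
  qed
qed

section \<open>Almost sure averages over independent blocks\<close>

context compact_system
begin

lemma measurable_birkhoff_sum [measurable]:
  assumes [measurable]: "(\<phi> :: 'a \<Rightarrow> real) \<in> borel_measurable borel"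
  shows "birkhoff_sum f n \<phi> \<in> borel_measurable borel"
  unfolding birkhoff_sum_def by measurable

lemma integral_birkhoff_sum:
  fixes \<phi> :: "'a \<Rightarrow> real"
  assumes \<phi>: "continuous_on UNIV \<phi>"
  shows "(\<integral>x. birkhoff_sum f n \<phi> x \<partial>\<nu>) = real n * (\<integral>x. \<phi> x \<partial>\<nu>)"
proof -
  have "continuous_on UNIV (\<lambda>x. \<phi> ((f ^^ i) x))" for i
    by (rule continuous_on_compose2[OF \<phi> cont_iter]) auto
  then show ?thesis
    unfolding birkhoff_sum_def
    by (simp add: Bochner_Integration.integral_sum integrable_continuous integral_iter
        borel_measurable_continuous_onI[OF \<phi>])
qed

text \<open>By invariance a Birkhoff sum of length \<open>n\<close> has mean \<open>n\<close> times
  the integral, and it is bounded by a multiple of \<open>n\<close>, as the law of large numbers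
  requires.\<close>

lemma block_average_limit:
  fixes \<phi> :: "'a \<Rightarrow> real"
  assumes "continuous_on UNIV \<phi>"
  shows "AE \<omega> in PiM UNIV (\<lambda>_::nat. \<nu>).
    (\<lambda>k. ((\<Sum>j<k. birkhoff_sum f (Suc j) \<phi> (\<omega> j)) - real (block_start k) * (\<integral>x. \<phi> x \<partial>\<nu>))
      / real (block_start k)) \<longlonglongrightarrow> 0"
proof -
  obtain B where B: "\<And>x. \<bar>\<phi> x\<bar> \<le> B" using bounded_continuous[OF assms] by blast
  have "AE \<omega> in PiM UNIV (\<lambda>_::nat. \<nu>). (\<lambda>k. (\<Sum>j<k. birkhoff_sum f (Suc j) \<phi> (\<omega> j)
      - (\<integral>x. birkhoff_sum f (Suc j) \<phi> x \<partial>\<nu>)) / real (block_start k)) \<longlonglongrightarrow> 0"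
  proof (rule strong_law_linear_growth[OF prob_space_axioms, of _ B])
    show "birkhoff_sum f (Suc j) \<phi> \<in> borel_measurable \<nu>" for j
      using measurable_birkhoff_sum[OF borel_measurable_continuous_onI[OF assms]]
      by (simp add: measurable_cong_sets[OF sets_nu refl])
  qed (rule abs_birkhoff_sum_le[OF B])
  moreover have "(\<Sum>j<k. birkhoff_sum f (Suc j) \<phi> (\<omega> j) - (\<integral>x. birkhoff_sum f (Suc j) \<phi> x \<partial>\<nu>))
      = (\<Sum>j<k. birkhoff_sum f (Suc j) \<phi> (\<omega> j)) - real (block_start k) * (\<integral>x. \<phi> x \<partial>\<nu>)" for k \<omega>
    unfolding integral_birkhoff_sum[OF assms] by (simp only: sum_subtractf block_start_def of_nat_sum sum_distrib_right)
  ultimately show ?thesis by simp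
qed

text \<open>Three errors of at most a quarter of \<open>\<delta>\<close> add up: gluing, the
  deviation of the block averages, and the times in the unfinished block.\<close>

lemma glued_limit:
  fixes \<phi> :: "'a \<Rightarrow> real"
  assumes glue: "glues f L Y"
    and \<phi>: "continuous_on UNIV \<phi>"
    and lim: "(\<lambda>k. ((\<Sum>j<k. birkhoff_sum f (Suc j) \<phi> (\<omega> j)) - real (block_start k) * I)
      / real (block_start k)) \<longlonglongrightarrow> 0"
  shows "(\<lambda>n. birkhoff_sum f n \<phi> (Y \<omega>) / real n) \<longlonglongrightarrow> I"
proof (rule tendstoI)
  fix \<delta> :: real assume \<delta>: "\<delta> > 0"
  let ?S = "\<lambda>k. \<Sum>j<k. birkhoff_sum f (Suc j) \<phi> (\<omega> j)"
  obtain K where K: "\<And>\<omega> k m. K \<le> k \<Longrightarrow> block_start k \<le> m \<Longrightarrow> m < block_start (Suc k) \<Longrightarrow>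
    \<bar>birkhoff_sum f m \<phi> (Y \<omega>) - (\<Sum>j<k. birkhoff_sum f (Suc j) \<phi> (\<omega> j))\<bar> \<le> \<delta> / 4 * real m"
    using glued_birkhoff_sum[OF glue \<phi>, of "\<delta> / 4"] \<delta> by force
  have "\<forall>\<^sub>F k in sequentially. dist ((?S k - real (block_start k) * I) / real (block_start k)) 0 < \<delta> / 4"
    using lim \<delta> by (intro tendstoD) auto
  moreover have "\<forall>\<^sub>F k in sequentially. \<bar>I\<bar> * (real k + 1) \<le> \<delta> / 4 * real (block_start k)"
    using \<delta> by (intro eventually_linear_le_block_start) auto
  ultimately have "\<forall>\<^sub>F k in sequentially. K \<le> k \<and> 0 < k \<and> \<bar>I\<bar> * (real k + 1) \<le> \<delta> / 4 * real (block_start k)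
      \<and> \<bar>?S k - real (block_start k) * I\<bar> \<le> \<delta> / 4 * real (block_start k)"
    using eventually_ge_at_top[of K] eventually_gt_at_top[of 0]
  proof eventually_elim
    case (elim k)
    then have "0 < real (block_start k)" using block_start_ge[of k] by simp
    then show ?case using elim by (simp add: field_simps)
  qed
  then have "\<forall>\<^sub>F n in sequentially. K \<le> block_index n \<and> 0 < block_index n
      \<and> \<bar>I\<bar> * (real (block_index n) + 1) \<le> \<delta> / 4 * real (block_start (block_index n))
      \<and> \<bar>?S (block_index n) - real (block_start (block_index n)) * I\<bar> \<le> \<delta> / 4 * real (block_start (block_index n))"
    by (rule eventually_compose_filterlim[OF _ filterlim_block_index])
  then show "\<forall>\<^sub>F n in sequentially. dist (birkhoff_sum f n \<phi> (Y \<omega>) / real n) I < \<delta>"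
  proof eventually_elim
    case (elim n)
    let ?k = "block_index n"
    have bs: "block_start ?k \<le> n" "n < block_start ?k + Suc ?k"
      using block_index[of n] by (simp_all add: block_start_Suc)
    have n: "0 < real n" using elim bs(1) block_start_ge[of ?k] by simp
    have bs': "\<delta> / 4 * real (block_start ?k) \<le> \<delta> / 4 * real n" using bs \<delta> by simp
    have "real (block_start ?k) * I - real n * I = - (I * (real n - real (block_start ?k)))"
      by (simp add: algebra_simps)
    then have "\<bar>real (block_start ?k) * I - real n * I\<bar> = \<bar>I\<bar> * (real n - real (block_start ?k))"
      using bs by (simp add: abs_mult)
    also have "\<dots> \<le> \<bar>I\<bar> * (real ?k + 1)" using bs by (intro mult_left_mono) auto
    finally have "\<bar>birkhoff_sum f n \<phi> (Y \<omega>) - real n * I\<bar> \<le> 3 * (\<delta> / 4 * real n)"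
      using elim K[of ?k n \<omega>] block_index[of n] bs' by linarith
    also have "\<dots> < \<delta> * real n" using n \<delta> by simp
    finally show ?case using n by (simp add: dist_real_def field_simps)
  qed
qed

text \<open>The information of a Bowen ball truncated at about \<open>C * N\<close>. The measure of
  a ball may be arbitrarily small, but Hoeffding's inequality needs a bound linear in the
  length.\<close>

definition ball_info :: "real \<Rightarrow> real \<Rightarrow> nat \<Rightarrow> 'a \<Rightarrow> real" where
  "ball_info \<epsilon> C N x = - ln (prob (bowen_ball f N x \<epsilon>) + exp (- C * real N))"

lemma measurable_ball_info [measurable]: "ball_info \<epsilon> C N \<in> borel_measurable borel"
  unfolding ball_info_def by measurable

lemma prob_bowen_ball_le: "prob (bowen_ball f N x \<epsilon>) \<le> exp (- ball_info \<epsilon> C N x)"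
proof -
  have "prob (bowen_ball f N x \<epsilon>) + exp (- C * real N) > 0" by (simp add: add_nonneg_pos)
  then show ?thesis by (simp add: ball_info_def)
qed

lemma abs_ball_info_le:
  assumes "C \<ge> 0"
  shows "\<bar>ball_info \<epsilon> C N x\<bar> \<le> C * real N + 1"
proof -
  let ?p = "prob (bowen_ball f N x \<epsilon>)" and ?e = "exp (- C * real N)"
  have "ln ?e \<le> ln (?p + ?e)" by (subst ln_le_cancel_iff) (auto simp: add_nonneg_pos)
  moreover have "ln (?p + ?e) \<le> ?p + ?e - 1" by (rule ln_le_minus_one) (simp add: add_nonneg_pos)
  moreover have "?p \<le> 1" "?e \<le> 1" using assms by auto
  moreover have "0 \<le> C * real N" "ln ?e = - (C * real N)" using assms by simp_all
  ultimately show ?thesis unfolding ball_info_def abs_le_iff by linarith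
qed

end

text \<open>If all \<open>A K\<close> were null, so would be their union. This makes a random
  threshold uniform on a set of positive measure.\<close>

lemma (in prob_space) AE_eventually_imp_positive:
  assumes "AE \<omega> in M. \<exists>K. \<omega> \<in> A K" and A: "\<And>K. A K \<in> sets M"
  obtains K :: nat where "emeasure M (A K) > 0"
proof (rule ccontr)
  assume "\<not> thesis"
  then have "emeasure M (A K) = 0" for K using that by (metis not_gr_zero)
  then have "AE \<omega> in M. \<omega> \<notin> A K" for K
    using A by (intro AE_not_in) auto
  then have "AE \<omega> in M. \<forall>K. \<omega> \<notin> A K" by (simp add: AE_all_countable)
  then have "AE \<omega> in M. False" using assms(1) by eventually_elim auto
  then show False by simp
qed

context partitioned_system
begin

text \<open>Gluing controls nothing within \<open>l\<close> steps of the ends of a segment, so the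
  information is taken along its middle part only, which starts at
  \<open>(f ^^ l) (\<omega> j)\<close>. By invariance the shift does not change the mean.\<close>

lemma typical_sequences:
  assumes glue: "glues f L Y"
    and \<psi>: "continuous_on UNIV (\<psi> :: 'a \<Rightarrow> real)" and \<delta>: "\<delta> > 0" and C: "C \<ge> 0"
    and info: "\<And>N. H N - 2 * \<delta> * real N - ln 2 \<le> (\<integral>x. ball_info \<epsilon> C N x \<partial>\<nu>)"
  obtains G K where "G \<in> sets (PiM UNIV (\<lambda>_::nat. \<nu>))" "emeasure (PiM UNIV (\<lambda>_::nat. \<nu>)) G > 0"
    "\<And>\<omega>. \<omega> \<in> G \<Longrightarrow> Y \<omega> \<in> generic_points f \<nu>"
    "\<And>\<omega> k. \<omega> \<in> G \<Longrightarrow> K \<le> k \<Longrightarrow>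
       (rate - 3 * \<delta>) * real (block_start k) \<le> (\<Sum>j<k. ball_info \<epsilon> C (Suc j - 2 * l) ((f ^^ l) (\<omega> j)))"
    "\<And>\<omega> k. \<omega> \<in> G \<Longrightarrow> K \<le> k \<Longrightarrow>
       ((\<integral>x. \<psi> x \<partial>\<nu>) - \<delta>) * real (block_start k) \<le> (\<Sum>j<k. birkhoff_sum f (Suc j) \<psi> (\<omega> j))"
proof -
  let ?\<Omega> = "PiM UNIV (\<lambda>_::nat. \<nu>)"
  interpret P: product_prob_space "\<lambda>_::nat. \<nu>" UNIV by unfold_locales
  define I where "I = (\<integral>x. \<psi> x \<partial>\<nu>)"
  define X where "X j x = ball_info \<epsilon> C (Suc j - 2 * l) ((f ^^ l) x)" for j x
  have X [measurable]: "X j \<in> borel_measurable borel" for j unfolding X_def by measurable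
  have [measurable]: "\<psi> \<in> borel_measurable borel" by (rule borel_measurable_continuous_onI[OF \<psi>])
  obtain F :: "('a \<Rightarrow> real) set" where F: "countable F" "\<And>\<theta>. \<theta> \<in> F \<Longrightarrow> continuous_on UNIV \<theta>"
    "\<And>\<phi> \<delta>. continuous_on UNIV \<phi> \<Longrightarrow> \<delta> > 0 \<Longrightarrow>
       \<exists>S c. finite S \<and> S \<subseteq> F \<and> (\<forall>x. \<bar>\<phi> x - (\<Sum>\<theta>\<in>S. c \<theta> * \<theta> x)\<bar> \<le> \<delta>)"
    by (rule countable_dense_span) blast
  have gen: "AE \<omega> in ?\<Omega>. Y \<omega> \<in> generic_points f \<nu>"
  proof -
    have "AE \<omega> in ?\<Omega>. \<forall>\<theta>\<in>F. (\<lambda>k. ((\<Sum>j<k. birkhoff_sum f (Suc j) \<theta> (\<omega> j))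
        - real (block_start k) * (\<integral>x. \<theta> x \<partial>\<nu>)) / real (block_start k)) \<longlonglongrightarrow> 0"
      using F by (subst AE_ball_countable) (auto intro: block_average_limit)
    then show ?thesis
    proof eventually_elim
      case (elim \<omega>)
      show ?case
        by (rule generic_points_criterion[OF F(2,3)]) (use elim F(2) glued_limit[OF glue] in blast)+
    qed
  qed
  \<comment> \<open>Dropping up to \<open>2 * l\<close> times of a segment changes the main term by
    at most \<open>2 * l * \<bar>rate - 2 * \<delta>\<bar>\<close>; the summand \<open>ln 2\<close>
    is the constant in \<open>info\<close>. The cost is thus bounded per block.\<close>
  define c where "c = 2 * real l * \<bar>rate - 2 * \<delta>\<bar> + ln 2"
  have EX: "(rate - 2 * \<delta>) * real (Suc j) - c \<le> (\<integral>x. X j x \<partial>\<nu>)" for j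
  proof -
    let ?N = "Suc j - 2 * l"
    have "(rate - 2 * \<delta>) * (real (Suc j) - real ?N) \<le> \<bar>rate - 2 * \<delta>\<bar> * (2 * real l)"
      by (intro mult_mono) auto
    then have "(rate - 2 * \<delta>) * real (Suc j) - c \<le> (rate - 2 * \<delta>) * real ?N - ln 2"
      by (simp add: c_def algebra_simps)
    also have "\<dots> \<le> H ?N - 2 * \<delta> * real ?N - ln 2" using H_ge[of ?N] by (simp add: algebra_simps)
    also have "\<dots> \<le> (\<integral>x. X j x \<partial>\<nu>)"
      unfolding X_def using info[of ?N] integral_iter[of "ball_info \<epsilon> C ?N" l] by simp
    finally show ?thesis .
  qed
  have EX_sum: "(rate - 2 * \<delta>) * real (block_start k) - c * real k \<le> (\<Sum>j<k. \<integral>x. X j x \<partial>\<nu>)" for k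
  proof -
    have "(rate - 2 * \<delta>) * real (block_start k) - c * real k = (\<Sum>j<k. (rate - 2 * \<delta>) * real (Suc j) - c)"
      by (simp only: block_start_def of_nat_sum sum_distrib_left sum_subtractf) simp
    then show ?thesis using sum_mono[of "{..<k}", OF EX] by simp
  qed
  have c0: "c \<ge> 0" by (simp add: c_def)
  have lawX: "AE \<omega> in ?\<Omega>. (\<lambda>k. (\<Sum>j<k. X j (\<omega> j) - (\<integral>x. X j x \<partial>\<nu>)) / real (block_start k)) \<longlonglongrightarrow> 0"
  proof (rule strong_law_linear_growth[OF prob_space_axioms, of _ "C + 1"])
    fix j x
    have "\<bar>X j x\<bar> \<le> C * real (Suc j - 2 * l) + 1" unfolding X_def by (rule abs_ball_info_le[OF C])
    also have "\<dots> \<le> C * real (Suc j) + real (Suc j)" using C by (intro add_mono mult_left_mono) auto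
    finally show "\<bar>X j x\<bar> \<le> (C + 1) * real (Suc j)" by (simp add: algebra_simps)
  qed measurable
  define good where "good k \<omega> \<longleftrightarrow> (rate - 3 * \<delta>) * real (block_start k) \<le> (\<Sum>j<k. X j (\<omega> j))
      \<and> (I - \<delta>) * real (block_start k) \<le> (\<Sum>j<k. birkhoff_sum f (Suc j) \<psi> (\<omega> j))" for k \<omega>
  define A where "A K = {\<omega> \<in> space ?\<Omega>. \<forall>k\<ge>K. good k \<omega>}" for K
  have A: "A K \<in> sets ?\<Omega>" for K unfolding A_def good_def by measurable
  have "AE \<omega> in ?\<Omega>. \<exists>K. \<omega> \<in> A K"
    using lawX block_average_limit[OF \<psi>] AE_space
  proof eventually_elim
    case (elim \<omega>)
    have "\<forall>\<^sub>F k in sequentially. dist ((\<Sum>j<k. X j (\<omega> j) - (\<integral>x. X j x \<partial>\<nu>)) / real (block_start k)) 0 < \<delta> / 2"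
      using elim \<delta> by (intro tendstoD) auto
    moreover have "\<forall>\<^sub>F k in sequentially. dist (((\<Sum>j<k. birkhoff_sum f (Suc j) \<psi> (\<omega> j))
        - real (block_start k) * I) / real (block_start k)) 0 < \<delta>"
      using elim \<delta> unfolding I_def by (intro tendstoD) auto
    moreover have "\<forall>\<^sub>F k in sequentially. c * (real k + 1) \<le> \<delta> / 2 * real (block_start k)"
      using \<delta> by (intro eventually_linear_le_block_start) auto
    ultimately have "\<forall>\<^sub>F k in sequentially. good k \<omega>"
      using eventually_gt_at_top[of 0]
    proof eventually_elim
      case (elim k)
      have bs: "0 < real (block_start k)" using elim(4) block_start_ge[of k] by simp
      have "\<bar>(\<Sum>j<k. X j (\<omega> j)) - (\<Sum>j<k. \<integral>x. X j x \<partial>\<nu>)\<bar> \<le> \<delta> / 2 * real (block_start k)"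
        using elim(1) bs by (simp add: field_simps sum_subtractf)
      moreover have "c * real k \<le> c * (real k + 1)" using c0 by (intro mult_left_mono) auto
      ultimately have 1: "(rate - 2 * \<delta>) * real (block_start k) - \<delta> / 2 * real (block_start k)
          - \<delta> / 2 * real (block_start k) \<le> (\<Sum>j<k. X j (\<omega> j))"
        using elim(3) EX_sum[of k] by linarith
      have "\<bar>(\<Sum>j<k. birkhoff_sum f (Suc j) \<psi> (\<omega> j)) - real (block_start k) * I\<bar> \<le> \<delta> * real (block_start k)"
        using elim(2) bs by (simp add: field_simps)
      then have 2: "(I - \<delta>) * real (block_start k) \<le> (\<Sum>j<k. birkhoff_sum f (Suc j) \<psi> (\<omega> j))"
        by (simp add: algebra_simps abs_le_iff)
      show ?case using 1 2 by (simp add: good_def algebra_simps)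
    qed
    then show ?case using elim(3) by (auto simp: A_def eventually_sequentially)
  qed
  from P.P.AE_eventually_imp_positive[OF this A] obtain K where K: "emeasure ?\<Omega> (A K) > 0" .
  \<comment> \<open>The event that \<open>Y \<omega>\<close> is generic need not be measurable; a
    null set containing its complement is removed instead.\<close>
  from gen obtain N0 where N0: "N0 \<in> null_sets ?\<Omega>" "{\<omega> \<in> space ?\<Omega>. Y \<omega> \<notin> generic_points f \<nu>} \<subseteq> N0"
    unfolding eventually_ae_filter by (elim bexE)
  show ?thesis
  proof (rule that[of "A K - N0" K])
    show "A K - N0 \<in> sets ?\<Omega>" using A N0 by auto
    show "emeasure ?\<Omega> (A K - N0) > 0" using K A N0 by (simp add: emeasure_Diff_null_set)
    show "Y \<omega> \<in> generic_points f \<nu>" if "\<omega> \<in> A K - N0" for \<omega> using that N0 by (auto simp: A_def)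
  qed (auto simp: A_def good_def X_def I_def)
qed

text \<open>A mass distribution argument on the space of sequences: \<open>G\<close> has positive
  measure, \<open>Y\<close> maps it into the generic points, and the preimage of a long Bowen ball
  has at most the measure of its summand in the pressure sum. Hence the sum over any cover is at
  least the measure of \<open>G\<close>.\<close>

proposition pressure_scale_lower_bound:
  assumes shadowing: "jump_shadowing f" and \<psi>: "continuous_on UNIV (\<psi> :: 'a \<Rightarrow> real)"
    and t: "t < rate + (\<integral>x. \<psi> x \<partial>\<nu>)"
  shows "\<forall>\<^sub>F \<rho> in at_right 0. ereal t \<le> pressure_scale f (generic_points f \<nu>) \<psi> \<rho>"
proof -
  let ?\<Omega> = "PiM UNIV (\<lambda>_::nat. \<nu>)" and ?Z = "generic_points f \<nu>"
  interpret P: product_prob_space "\<lambda>_::nat. \<nu>" UNIV by unfold_locales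
  define I where "I = (\<integral>x. \<psi> x \<partial>\<nu>)"
  \<comment> \<open>The seven parts: three for the information, one for the averages of
    \<open>\<psi>\<close>, two for passing from \<open>block_start k\<close> to \<open>m\<close> in
    these two estimates, and one for gluing.\<close>
  define \<delta> where "\<delta> = (rate + I - t) / 7"
  have \<delta>: "\<delta> > 0" "t = rate + I - 7 * \<delta>" using t by (auto simp: \<delta>_def I_def field_simps)
  obtain B where B: "B > 0" "\<And>x. \<bar>\<psi> x\<bar> \<le> B" using bounded_continuous[OF \<psi>] by blast
  obtain \<epsilon> C where \<epsilon>: "\<epsilon> > 0" "C \<ge> 0"
    and info: "\<And>N. H N - 2 * \<delta> * real N - ln 2 \<le> (\<integral>x. ball_info \<epsilon> C N x \<partial>\<nu>)"
    using bowen_ball_entropy[OF \<delta>(1)] unfolding ball_info_def by metis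
  obtain L Y where glue: "glues f L Y" by (rule jump_shadowing_glue[OF shadowing])
  \<comment> \<open>The factor 4 counts the distances from one segment to another through the ball:
    two errors of gluing and two radii \<open>\<rho>\<close>.\<close>
  have "ereal t \<le> pressure_scale f ?Z \<psi> \<rho>" if \<rho>: "0 < \<rho>" "\<rho> < \<epsilon> / 4" for \<rho>
  proof -
    define l where "l = L \<rho>"
    define X where "X j x = ball_info \<epsilon> C (Suc j - 2 * l) ((f ^^ l) x)" for j x
    obtain G K where G: "G \<in> sets ?\<Omega>" "emeasure ?\<Omega> G > 0"
      and gen: "\<And>\<omega>. \<omega> \<in> G \<Longrightarrow> Y \<omega> \<in> ?Z"
      and GX: "\<And>\<omega> k. \<omega> \<in> G \<Longrightarrow> K \<le> k \<Longrightarrow> (rate - 3 * \<delta>) * real (block_start k) \<le> (\<Sum>j<k. X j (\<omega> j))"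
      and GS: "\<And>\<omega> k. \<omega> \<in> G \<Longrightarrow> K \<le> k \<Longrightarrow>
         (I - \<delta>) * real (block_start k) \<le> (\<Sum>j<k. birkhoff_sum f (Suc j) \<psi> (\<omega> j))"
      unfolding X_def I_def by (rule typical_sequences[OF glue \<psi> \<delta>(1) \<epsilon>(2) info]) blast
    obtain K' where K': "\<And>\<omega> k m. K' \<le> k \<Longrightarrow> block_start k \<le> m \<Longrightarrow> m < block_start (Suc k) \<Longrightarrow>
        \<bar>birkhoff_sum f m \<psi> (Y \<omega>) - (\<Sum>j<k. birkhoff_sum f (Suc j) \<psi> (\<omega> j))\<bar> \<le> \<delta> * real m"
      by (rule glued_birkhoff_sum[OF glue \<psi> \<delta>(1)]) blast
    define a where "a = \<bar>rate - 3 * \<delta>\<bar> + \<bar>I - \<delta>\<bar>"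
    have "\<forall>\<^sub>F k in sequentially. K \<le> k \<and> K' \<le> k \<and> a * (real k + 1) \<le> \<delta> * real (block_start k)"
      using \<delta> by (intro eventually_conj eventually_ge_at_top eventually_linear_le_block_start)
    then have "\<forall>\<^sub>F m in sequentially. K \<le> block_index m \<and> K' \<le> block_index m
        \<and> a * (real (block_index m) + 1) \<le> \<delta> * real (block_start (block_index m))"
      by (rule eventually_compose_filterlim[OF _ filterlim_block_index])
    then obtain n1 where n1: "\<And>m. n1 \<le> m \<Longrightarrow> K \<le> block_index m \<and> K' \<le> block_index m
        \<and> a * (real (block_index m) + 1) \<le> \<delta> * real (block_start (block_index m))"
      unfolding eventually_sequentially by blast
    define w where "w t' m x = exp (- t' * real m + (SUP y\<in>bowen_ball f m x \<rho>. birkhoff_sum f m \<psi> y))" for t' m x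
    \<comment> \<open>\<open>Y\<close> arises from a choice and need not be measurable, so its
      preimage of the ball is enclosed in a measurable cylinder \<open>D\<close>.\<close>
    have cyl: "\<exists>D\<in>sets ?\<Omega>. {\<omega> \<in> G. Y \<omega> \<in> bowen_ball f m x \<rho>} \<subseteq> D \<and> emeasure ?\<Omega> D \<le> ennreal (w t' m x)"
      if m: "n1 \<le> m" and t': "t' \<le> t" for m x t'
    proof (cases "{\<omega> \<in> G. Y \<omega> \<in> bowen_ball f m x \<rho>} = {}")
      case True
      then show ?thesis by (intro bexI[of _ "{}"]) auto
    next
      case False
      \<comment> \<open>The center \<open>x\<close> need not be a glued point. A glued point
        \<open>Y v\<close> of the same ball supplies the segments about which the cylinder is
        built.\<close>
      then obtain v where v: "v \<in> G" "Y v \<in> bowen_ball f m x \<rho>" by blast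
      define k where "k = block_index m"
      have k: "K \<le> k" "K' \<le> k" "a * (real k + 1) \<le> \<delta> * real (block_start k)"
        using n1[OF m] by (simp_all add: k_def)
      have bs: "block_start k \<le> m" "m < block_start (Suc k)"
        using block_index[of m] by (simp_all add: k_def)
      have gap: "real m - real (block_start k) \<le> real k + 1" "0 \<le> real m - real (block_start k)"
        using bs by (simp_all add: block_start_Suc)
      \<comment> \<open>Replaces \<open>m\<close> by \<open>block_start k\<close> at the cost
        \<open>\<delta> * m\<close>; the absolute values in \<open>a\<close> allow either sign of
        \<open>b\<close>.\<close>
      have lin: "b * real m - \<delta> * real m \<le> b * real (block_start k)" if "\<bar>b\<bar> \<le> a" for b
      proof -
        have "b * (real m - real (block_start k)) \<le> a * (real k + 1)"
          using that gap by (intro mult_mono) auto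
        also have "\<dots> \<le> \<delta> * real m" using k(3) bs(1) \<delta>(1) by (rule_tac order_trans) auto
        finally show ?thesis by (simp add: algebra_simps)
      qed
      \<comment> \<open>For short segments the length \<open>Suc j - 2 * l\<close> is 0, the ball is
        the whole space, and no condition is imposed.\<close>
      let ?A = "\<lambda>j. (f ^^ l) -` bowen_ball f (Suc j - 2 * l) ((f ^^ l) (v j)) \<epsilon>"
      let ?D = "{\<omega> \<in> space ?\<Omega>. \<forall>j\<in>{..<k}. \<omega> j \<in> ?A j}"
      have A: "?A j \<in> sets \<nu>" for j
        using measurable_sets[OF measurable_iter[of l] measurable_bowen_ball] by (simp add: sets_nu)
      have D: "?D \<in> sets ?\<Omega>" using A by measurable
      have sub: "{\<omega> \<in> G. Y \<omega> \<in> bowen_ball f m x \<rho>} \<subseteq> ?D"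
      proof safe
        fix \<omega> assume \<omega>: "\<omega> \<in> G" "Y \<omega> \<in> bowen_ball f m x \<rho>"
        show "\<omega> \<in> space ?\<Omega>" using \<omega>(1) G(1) sets.sets_into_space by blast
        fix j assume j: "j < k"
        show "\<omega> j \<in> ?A j"
          unfolding vimage_eq bowen_ball_def mem_Collect_eq
        proof (intro allI impI)
          fix i assume i: "i < Suc j - 2 * l"
          let ?t = "block_start j + (i + l)"
          have "block_start (Suc j) \<le> block_start k" using j by (intro block_start_mono) simp
          then have "?t < m" using i bs(1) by (simp add: block_start_Suc)
          then have "dist ((f ^^ ?t) x) ((f ^^ ?t) (Y \<omega>)) < \<rho>" "dist ((f ^^ ?t) x) ((f ^^ ?t) (Y v)) < \<rho>"
            using \<omega>(2) v(2) by (auto simp: bowen_ball_def)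
          moreover have "dist ((f ^^ ?t) (Y u)) ((f ^^ (i + l)) (u j)) < \<rho>" for u
            by (rule gluesD[OF glue \<rho>(1)]) (use i in \<open>auto simp: l_def\<close>)
          note this[of \<omega>] this[of v]
          ultimately have "dist ((f ^^ (i + l)) (v j)) ((f ^^ (i + l)) (\<omega> j)) < 4 * \<rho>"
            by metric
          then show "dist ((f ^^ i) ((f ^^ l) (v j))) ((f ^^ i) ((f ^^ l) (\<omega> j))) < \<epsilon>"
            using \<rho>(2) by (simp add: funpow_add)
        qed
      qed
      have "emeasure ?\<Omega> ?D = (\<Prod>j<k. emeasure \<nu> (?A j))"
        by (rule P.emeasure_PiM_Collect) (use A in auto)
      also have "\<dots> = (\<Prod>j<k. ennreal (prob (bowen_ball f (Suc j - 2 * l) ((f ^^ l) (v j)) \<epsilon>)))"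
        by (simp add: emeasure_eq_measure prob_iter)
      also have "\<dots> = ennreal (\<Prod>j<k. prob (bowen_ball f (Suc j - 2 * l) ((f ^^ l) (v j)) \<epsilon>))"
        by (simp add: prod_ennreal)
      also have "\<dots> \<le> ennreal (\<Prod>j<k. exp (- X j (v j)))"
        unfolding X_def by (intro ennreal_leI prod_mono conjI prob_bowen_ball_le measure_nonneg)
      also have "\<dots> = ennreal (exp (- (\<Sum>j<k. X j (v j))))"
        by (simp add: exp_sum sum_negf[symmetric])
      also have "\<dots> \<le> ennreal (w t' m x)"
      proof -
        have 1: "(rate - 3 * \<delta>) * real m - \<delta> * real m \<le> (\<Sum>j<k. X j (v j))"
          using lin[of "rate - 3 * \<delta>"] GX[OF v(1) k(1)] by (simp add: a_def)
        have 2: "(I - \<delta>) * real m - \<delta> * real m - \<delta> * real m \<le> birkhoff_sum f m \<psi> (Y v)"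
          using lin[of "I - \<delta>"] GS[OF v(1) k(1)] K'[OF k(2) bs, of v] by (simp add: a_def)
        have "bdd_above (birkhoff_sum f m \<psi> ` bowen_ball f m x \<rho>)"
          using abs_birkhoff_sum_le[OF B(2), of f m] by (intro bdd_aboveI[of _ "B * real m"]) (auto simp: abs_le_iff)
        then have 3: "birkhoff_sum f m \<psi> (Y v) \<le> (SUP y\<in>bowen_ball f m x \<rho>. birkhoff_sum f m \<psi> y)"
          using v(2) by (intro cSUP_upper)
        have 4: "t' * real m \<le> (rate + I - 7 * \<delta>) * real m"
          using t' \<delta>(2) by (intro mult_right_mono) auto
        have "- (\<Sum>j<k. X j (v j)) \<le> - t' * real m + (SUP y\<in>bowen_ball f m x \<rho>. birkhoff_sum f m \<psi> y)"
          using 1 2 3 4 by (simp add: algebra_simps)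
        then show ?thesis unfolding w_def by (intro ennreal_leI) simp
      qed
      finally show ?thesis using D sub by blast
    qed
    \<comment> \<open>All \<open>t' \<le> t\<close> are treated at once, because
      \<open>pressure_scale\<close> is an infimum and every smaller exponent has to be
      excluded.\<close>
    have cover: "emeasure ?\<Omega> G \<le> pressure_sum f ?Z t' \<psi> n \<rho>" if n: "n1 \<le> n" and t': "t' \<le> t" for n t'
      unfolding pressure_sum_def
    proof (rule INF_greatest)
      fix C assume C: "C \<in> bowen_covers f ?Z n \<rho>"
      then have C': "countable C" "\<And>x m. (x, m) \<in> C \<Longrightarrow> n \<le> m" "?Z \<subseteq> (\<Union>(x, m)\<in>C. bowen_ball f m x \<rho>)"
        by (auto simp: bowen_covers_def)
      have "\<forall>c\<in>C. \<exists>D. D \<in> sets ?\<Omega> \<and> {\<omega> \<in> G. Y \<omega> \<in> bowen_ball f (snd c) (fst c) \<rho>} \<subseteq> D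
          \<and> emeasure ?\<Omega> D \<le> ennreal (w t' (snd c) (fst c))"
      proof
        fix c assume "c \<in> C"
        then have "n1 \<le> snd c" using C'(2)[of "fst c" "snd c"] n by simp
        then show "\<exists>D. D \<in> sets ?\<Omega> \<and> {\<omega> \<in> G. Y \<omega> \<in> bowen_ball f (snd c) (fst c) \<rho>} \<subseteq> D
          \<and> emeasure ?\<Omega> D \<le> ennreal (w t' (snd c) (fst c))"
          using cyl[OF _ t', of "snd c" "fst c"] by blast
      qed
      from bchoice[OF this] obtain D where D: "\<forall>c\<in>C. D c \<in> sets ?\<Omega>
          \<and> {\<omega> \<in> G. Y \<omega> \<in> bowen_ball f (snd c) (fst c) \<rho>} \<subseteq> D c
          \<and> emeasure ?\<Omega> (D c) \<le> ennreal (w t' (snd c) (fst c))" by (rule exE)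
      have "G \<subseteq> (\<Union>c\<in>C. D c)"
      proof
        fix \<omega> assume \<omega>: "\<omega> \<in> G"
        then obtain c where "c \<in> C" "Y \<omega> \<in> bowen_ball f (snd c) (fst c) \<rho>"
          using gen[OF \<omega>] C'(3) by fastforce
        then show "\<omega> \<in> (\<Union>c\<in>C. D c)" using D \<omega> by blast
      qed
      then have "emeasure ?\<Omega> G \<le> emeasure ?\<Omega> (\<Union>c\<in>C. D c)"
        using D C'(1) by (intro emeasure_mono sets.countable_UN') auto
      also have "\<dots> \<le> (\<Sum>\<^sub>\<infinity>c\<in>C. emeasure ?\<Omega> (D c))"
        by (rule emeasure_UN_le_infsum[OF C'(1)]) (use D in auto)
      also have "\<dots> \<le> (\<Sum>\<^sub>\<infinity>(x, m)\<in>C. ennreal (w t' m x))"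
        using D by (intro infsum_mono) (auto simp: case_prod_unfold nonneg_summable_on_complete)
      finally show "emeasure ?\<Omega> G \<le> (\<Sum>\<^sub>\<infinity>(x, m)\<in>C. ennreal (exp (- t' * real m
          + (SUP y\<in>bowen_ball f m x \<rho>. birkhoff_sum f m \<psi> y))))"
        unfolding w_def .
    qed
    show "ereal t \<le> pressure_scale f ?Z \<psi> \<rho>"
      unfolding pressure_scale_def
    proof (rule Inf_greatest, clarify)
      fix t' assume zero: "pressure_outer f ?Z t' \<psi> \<rho> = 0"
      show "ereal t \<le> ereal t'"
      proof (rule ccontr)
        assume "\<not> ereal t \<le> ereal t'"
        then have "emeasure ?\<Omega> G \<le> pressure_sum f ?Z t' \<psi> n1 \<rho>" by (intro cover) auto
        also have "\<dots> \<le> pressure_outer f ?Z t' \<psi> \<rho>"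
          unfolding pressure_outer_eq_SUP by (rule SUP_upper) simp
        finally show False using zero G(2) by simp
      qed
    qed
  qed
  then show ?thesis using \<epsilon>(1) unfolding eventually_at_right_field by (intro exI[of _ "\<epsilon> / 4"]) auto
qed

end

section \<open>The upper bound\<close>

lemma sum_residue_classes:
  fixes G :: "nat \<Rightarrow> real"
  shows "(\<Sum>t<k * N. G t) = (\<Sum>j<N. \<Sum>i<k. G (j + i * N))"
proof -
  have "sum G {i * N..<i * N + N} = (\<Sum>j<N. G (j + i * N))" for i
    using sum.shift_bounds_nat_ivl[of G 0 "i * N" N] by (simp add: add.commute atLeast0LessThan)
  then show ?thesis
    using sum.nat_group[of G N k] by (subst sum.swap) simp
qed

section \<open>Fine partitions and separated sets\<close>

context compact_system
begin

text \<open>A finite cover by balls of radius \<open>e / 2\<close>, made disjoint by assigning each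
  point to the first ball that contains it.\<close>

lemma fine_partition:
  assumes "e > 0"
  obtains P :: "'a set set" where "finite P" "P \<subseteq> sets borel" "partition_on UNIV P"
    "\<And>c x y. c \<in> P \<Longrightarrow> x \<in> c \<Longrightarrow> y \<in> c \<Longrightarrow> dist x y < e"
proof -
  have "\<exists>N :: 'a set. finite N \<and> UNIV \<subseteq> (\<Union>q\<in>N. ball q (e / 2))"
    using compact_UNIV compact_eq_totally_bounded[of UNIV] assms half_gt_zero by blast
  then obtain N :: "'a set" where N: "finite N" "UNIV \<subseteq> (\<Union>q\<in>N. ball q (e / 2))" by blast
  obtain xs where xs: "set xs = N" using finite_list[OF N(1)] by blast
  define a where "a x = (LEAST i. i < length xs \<and> x \<in> ball (xs ! i) (e / 2))" for x
  have ex: "\<exists>i. i < length xs \<and> x \<in> ball (xs ! i) (e / 2)" for x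
  proof -
    obtain q where q: "q \<in> set xs" "x \<in> ball q (e / 2)" using N(2) xs by blast
    then show ?thesis by (metis in_set_conv_nth)
  qed
  have a: "a x < length xs" "x \<in> ball (xs ! a x) (e / 2)" for x
    using LeastI_ex[OF ex[of x]] by (simp_all add: a_def)
  have a_iff: "{x. a x = i} = ball (xs ! i) (e / 2) - (\<Union>j<i. ball (xs ! j) (e / 2))" if "i < length xs" for i
  proof (intro equalityI subsetI)
    fix x assume "x \<in> {x. a x = i}"
    then have i: "a x = i" by simp
    have "x \<notin> ball (xs ! j) (e / 2)" if j: "j < i" for j
    proof
      assume "x \<in> ball (xs ! j) (e / 2)"
      then have "a x \<le> j" unfolding a_def using j \<open>i < length xs\<close> by (intro Least_le) simp
      then show False using i j by simp
    qed
    then show "x \<in> ball (xs ! i) (e / 2) - (\<Union>j<i. ball (xs ! j) (e / 2))"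
      using a(2)[of x] i by blast
  next
    fix x assume x: "x \<in> ball (xs ! i) (e / 2) - (\<Union>j<i. ball (xs ! j) (e / 2))"
    have "a x = i" unfolding a_def
      by (rule Least_equality) (use x that in \<open>auto simp: not_less[symmetric]\<close>)
    then show "x \<in> {x. a x = i}" by simp
  qed
  show ?thesis
  proof (rule that[of "(\<lambda>x. {y. a y = a x}) ` UNIV"])
    have "(\<lambda>x. {y. a y = a x}) ` UNIV \<subseteq> (\<lambda>i. {y. a y = i}) ` {..<length xs}" using a(1) by auto
    then show "finite ((\<lambda>x. {y. a y = a x}) ` UNIV)" by (rule finite_subset) simp
    show "(\<lambda>x. {y. a y = a x}) ` UNIV \<subseteq> sets borel"
    proof clarify
      fix x
      show "{y. a y = a x} \<in> sets borel" unfolding a_iff[OF a(1)] by (intro sets.Diff sets.finite_UN) auto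
    qed
    show "partition_on UNIV ((\<lambda>x. {y. a y = a x}) ` UNIV)"
      by (rule partition_onI) (auto simp: disjnt_def)
    fix c x y assume "c \<in> (\<lambda>x. {y. a y = a x}) ` UNIV" "x \<in> c" "y \<in> c"
    then have "x \<in> ball (xs ! a x) (e / 2)" "y \<in> ball (xs ! a x) (e / 2)"
      using a(2)[of x] a(2)[of y] by auto
    then show "dist x y < e" using dist_triangle[of x y "xs ! a x"] by (simp add: dist_commute)
  qed
qed

end

text \<open>The potential \<open>- ln b\<close>, where \<open>b\<close> is a continuous upper approximation of the measure of the cell
  of a point, turns the counting of orbit segments into a statement on its Birkhoff sums. The summand
  \<open>\<delta> / card R\<close> of the weights keeps \<open>b\<close> away from 0.\<close>

locale fine_partitioned_system = partitioned_system \<nu> f P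
  for \<nu> :: "'a::polish_space measure" and f P +
  fixes \<rho> \<delta> :: real and N :: nat
  assumes \<rho>: "\<rho> > 0" and \<delta>: "\<delta> > 0" and N: "N > 0"
    and fine: "\<And>c x y. c \<in> P \<Longrightarrow> x \<in> c \<Longrightarrow> y \<in> c \<Longrightarrow> dist x y < \<rho> / 4"
begin

definition "R = range (itin N)"

definition "center l = (SOME x. itin N x = l)"

definition "weight l = prob (fiber N l) + \<delta> / card R"

text \<open>A continuous substitute for the indicator of the cell \<open>l\<close>: it equals 1 up
  to the distance \<open>\<rho> / 4\<close> from the orbit of the center, which covers the cell, and
  vanishes from \<open>\<rho> / 2\<close> on, so that any two points of its support stay
  \<open>\<rho>\<close>-close for \<open>N\<close> steps.\<close>

definition "bump l x = (\<Prod>i<N. max 0 (min 1 (2 - dist ((f ^^ i) x) ((f ^^ i) (center l)) * 4 / \<rho>)))"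

definition "b x = (\<Sum>l\<in>R. weight l * bump l x)"

lemma finite_R: "finite R" and card_R: "card R > 0"
  using finite_range_itin by (simp_all add: R_def card_gt_0_iff)

lemma center: "l \<in> R \<Longrightarrow> itin N (center l) = l"
  unfolding center_def by (rule someI_ex) (auto simp: R_def)

lemma same_itin_close: "itin N x = itin N y \<Longrightarrow> i < N \<Longrightarrow> dist ((f ^^ i) x) ((f ^^ i) y) < \<rho> / 4"
  using fine[OF itin_cell(1)[of i N x] itin_cell(2)[of i N x]] itin_cell(2)[of i N y] by simp

lemma weight_ge: "prob (fiber N l) \<le> weight l" and weight_pos: "0 < weight l"
  using \<delta> card_R by (simp_all add: weight_def add_nonneg_pos)

lemma sum_weight: "(\<Sum>l\<in>R. weight l) = 1 + \<delta>"
proof -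
  have "(\<Sum>l\<in>R. prob (fiber N l)) = 1"
    using integral_itin(2)[of "\<lambda>_. 1" N] prob_space by (simp add: R_def)
  then show ?thesis using card_R by (simp add: weight_def sum.distrib)
qed

lemma bump_bounds: "0 \<le> bump l x" "bump l x \<le> 1"
  unfolding bump_def by (auto intro!: prod_nonneg prod_le_1)

lemma bump_eq_1: "bump (itin N x) x = 1"
proof -
  have "dist ((f ^^ i) x) ((f ^^ i) (center (itin N x))) * 4 / \<rho> < 1" if "i < N" for i
    using same_itin_close[of x "center (itin N x)" i] center[of "itin N x"] that \<rho>
    by (simp add: R_def field_simps)
  then show ?thesis unfolding bump_def by (intro prod.neutral) (auto simp: less_imp_le min_def max_def)
qed

lemma bump_nonzero_close:
  assumes "bump l x \<noteq> 0" "i < N"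
  shows "dist ((f ^^ i) x) ((f ^^ i) (center l)) < \<rho> / 2"
proof -
  have "max 0 (min 1 (2 - dist ((f ^^ i) x) ((f ^^ i) (center l)) * 4 / \<rho>)) \<noteq> 0"
    using assms unfolding bump_def by (auto simp: prod_zero_iff)
  then have "dist ((f ^^ i) x) ((f ^^ i) (center l)) * 4 / \<rho> < 2" by (auto simp: max_def min_def split: if_splits)
  then show ?thesis using \<rho> by (simp add: field_simps)
qed

lemma b_ge: "weight (itin N x) \<le> b x"
proof -
  have "weight (itin N x) * bump (itin N x) x \<le> b x"
    unfolding b_def using finite_R bump_bounds weight_pos
    by (intro member_le_sum) (auto simp: R_def less_imp_le)
  then show ?thesis by (simp add: bump_eq_1)
qed

lemma b_pos: "0 < b x"
  using weight_pos b_ge by (rule less_le_trans)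

lemma cont_b: "continuous_on UNIV b"
  unfolding b_def bump_def by (intro continuous_intros cont_iter) (use \<rho> in auto)

lemma cont_ln_b: "continuous_on UNIV (\<lambda>x. - ln (b x))"
  using b_pos cont_b by (intro continuous_intros) (auto simp: less_le)

lemma integral_ln_b: "(\<integral>x. - ln (b x) \<partial>\<nu>) \<le> H N"
  unfolding H_eq_integral
proof (rule integral_mono_AE)
  show "integrable \<nu> (\<lambda>x. - ln (b x))" by (rule integrable_continuous[OF cont_ln_b])
  show "integrable \<nu> (\<lambda>x. - ln (prob (fiber N (itin N x))))"
    by (rule integral_itin(1)[of "\<lambda>l. - ln (prob (fiber N l))"])
  show "AE x in \<nu>. - ln (b x) \<le> - ln (prob (fiber N (itin N x)))"
    using AE_fiber_pos[of N]
  proof eventually_elim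
    case (elim x)
    then show ?case using order_trans[OF weight_ge b_ge, of x] by simp
  qed
qed

text \<open>Expanding the product of sums gives a sum over words \<open>\<sigma>\<close> of cells.
  Points at which all bumps of one word are nonzero follow the same centers and cannot be separated,
  so each word counts at most one point of \<open>E\<close>. What remains is the sum of the weights
  of all words.\<close>

lemma sum_prod_b_le:
  assumes "finite E" "j < N"
    and E: "\<And>x y. x \<in> E \<Longrightarrow> y \<in> E \<Longrightarrow> itin N x = itin N y"
    and sep: "\<And>x y. x \<in> E \<Longrightarrow> y \<in> E \<Longrightarrow> x \<noteq> y \<Longrightarrow> y \<notin> bowen_ball f (k * N) x \<rho>"
  shows "(\<Sum>x\<in>E. \<Prod>i<k. b ((f ^^ (j + i * N)) x)) \<le> (1 + \<delta>) ^ k"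
proof -
  let ?S = "{..<k} \<rightarrow>\<^sub>E R"
  have one: "(\<Sum>x\<in>E. \<Prod>i<k. bump (\<sigma> i) ((f ^^ (j + i * N)) x)) \<le> 1" for \<sigma>
  proof -
    let ?c = "\<lambda>x. \<Prod>i<k. bump (\<sigma> i) ((f ^^ (j + i * N)) x)"
    have c: "0 \<le> ?c x" "?c x \<le> 1" for x using bump_bounds by (auto intro!: prod_nonneg prod_le_1)
    have same: "x = y" if "x \<in> E" "y \<in> E" "?c x \<noteq> 0" "?c y \<noteq> 0" for x y
    proof (rule ccontr)
      assume "x \<noteq> y"
      moreover have "y \<in> bowen_ball f (k * N) x \<rho>"
        unfolding bowen_ball_def mem_Collect_eq
      proof (intro allI impI)
        fix t assume t: "t < k * N"
        show "dist ((f ^^ t) x) ((f ^^ t) y) < \<rho>"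
        \<comment> \<open>The blocks start at time \<open>j\<close>; the common first itinerary
          takes care of the earlier times, since \<open>j < N\<close>.\<close>
        proof (cases "t < N")
          case True
          then show ?thesis using same_itin_close[OF E[OF that(1,2)]] \<rho> by fastforce
        next
          case False
          define i where "i = (t - j) div N"
          define s where "s = (t - j) mod N"
          have t_eq: "t = s + (j + i * N)" using False \<open>j < N\<close> by (simp add: i_def s_def)
          have s: "s < N" using N by (simp add: s_def)
          have "t - j < k * N" using t by simp
          then have "i < k" using N by (simp add: i_def less_mult_imp_div_less)
          have "dist ((f ^^ s) ((f ^^ (j + i * N)) u)) ((f ^^ s) (center (\<sigma> i))) < \<rho> / 2"
            if "?c u \<noteq> 0" for u
            using that \<open>i < k\<close> s by (intro bump_nonzero_close) auto
          from this[OF that(3)] this[OF that(4)] show ?thesis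
            unfolding t_eq funpow_add comp_apply by metric
        qed
      qed
      ultimately show False using sep that by blast
    qed
    show ?thesis
    proof (cases "\<exists>x\<in>E. ?c x \<noteq> 0")
      case True
      then obtain x where x: "x \<in> E" "?c x \<noteq> 0" by blast
      have "(\<Sum>y\<in>E. ?c y) = (\<Sum>y\<in>{x}. ?c y)"
        by (rule sum.mono_neutral_right) (use assms(1) x same in auto)
      then show ?thesis using c(2)[of x] by simp
    next
      case False
      then have "(\<Sum>y\<in>E. ?c y) = 0" by (intro sum.neutral) blast
      then show ?thesis by simp
    qed
  qed
  have "(\<Sum>x\<in>E. \<Prod>i<k. b ((f ^^ (j + i * N)) x))
      = (\<Sum>x\<in>E. \<Sum>\<sigma>\<in>?S. \<Prod>i<k. weight (\<sigma> i) * bump (\<sigma> i) ((f ^^ (j + i * N)) x))"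
    unfolding b_def using finite_R by (intro sum.cong refl prod_sum_PiE) auto
  also have "\<dots> = (\<Sum>\<sigma>\<in>?S. (\<Prod>i<k. weight (\<sigma> i)) * (\<Sum>x\<in>E. \<Prod>i<k. bump (\<sigma> i) ((f ^^ (j + i * N)) x)))"
    by (subst sum.swap) (simp add: prod.distrib sum_distrib_left)
  also have "\<dots> \<le> (\<Sum>\<sigma>\<in>?S. (\<Prod>i<k. weight (\<sigma> i)) * 1)"
    using weight_pos by (intro sum_mono mult_left_mono one prod_nonneg) (auto simp: less_imp_le)
  also have "\<dots> = (\<Sum>\<sigma>\<in>?S. \<Prod>i<k. weight (\<sigma> i))" by simp
  also have "\<dots> = (\<Prod>i<k. \<Sum>l\<in>R. weight l)"
    by (rule prod_sum_PiE[symmetric]) (use finite_R in auto)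
  also have "\<dots> = (1 + \<delta>) ^ k" by (simp add: sum_weight)
  finally show ?thesis .
qed

text \<open>Among the residue classes \<open>j\<close> modulo \<open>N\<close> there is one along which the sum of \<open>- ln b\<close> is at most
  the average over all classes.\<close>

lemma card_separated_le:
  assumes "finite E"
    and Z: "\<And>x. x \<in> E \<Longrightarrow> birkhoff_sum f (k * N) (\<lambda>x. - ln (b x)) x \<le> real (k * N) * a"
    and sep: "\<And>x y. x \<in> E \<Longrightarrow> y \<in> E \<Longrightarrow> x \<noteq> y \<Longrightarrow> y \<notin> bowen_ball f (k * N) x \<rho>"
  shows "real (card E) \<le> real (N * card R) * exp (real k * (a + \<delta>))"
proof -
  \<comment> \<open>Fixing the first cell \<open>l\<close> provides the common itinerary needed in
    \<open>sum_prod_b_le\<close>. The number \<open>N * card R\<close> of pieces does not depend on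
    \<open>k\<close>.\<close>
  define E' where "E' j l = {x \<in> E. itin N x = l \<and> (\<Sum>i<k. - ln (b ((f ^^ (j + i * N)) x))) \<le> real k * a}" for j l
  have fin: "finite (E' j l)" for j l using assms(1) by (simp add: E'_def)
  have card_E': "real (card (E' j l)) \<le> exp (real k * (a + \<delta>))" if "j < N" for j l
  proof -
    have "real (card (E' j l)) * exp (- (real k * a)) = (\<Sum>x\<in>E' j l. exp (- (real k * a)))" by simp
    also have "\<dots> \<le> (\<Sum>x\<in>E' j l. \<Prod>i<k. b ((f ^^ (j + i * N)) x))"
    proof (rule sum_mono)
      fix x assume "x \<in> E' j l"
      then have "- (real k * a) \<le> (\<Sum>i<k. ln (b ((f ^^ (j + i * N)) x)))" by (simp add: E'_def sum_negf)
      then have "exp (- (real k * a)) \<le> exp (\<Sum>i<k. ln (b ((f ^^ (j + i * N)) x)))" by simp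
      also have "\<dots> = (\<Prod>i<k. b ((f ^^ (j + i * N)) x))" using b_pos by (simp add: exp_sum)
      finally show "exp (- (real k * a)) \<le> (\<Prod>i<k. b ((f ^^ (j + i * N)) x))" .
    qed
    also have "\<dots> \<le> (1 + \<delta>) ^ k"
      by (rule sum_prod_b_le[OF fin that]) (auto simp: E'_def sep)
    also have "\<dots> \<le> exp \<delta> ^ k" using \<delta> by (intro power_mono) auto
    also have "\<dots> = exp (real k * \<delta>)" by (simp add: exp_of_nat_mult)
    finally have "real (card (E' j l)) * exp (- (real k * a)) * exp (real k * a)
        \<le> exp (real k * \<delta>) * exp (real k * a)"
      by (intro mult_right_mono) simp_all
    moreover have "exp (- (real k * a)) * exp (real k * a) = 1" by (simp add: mult_exp_exp)
    ultimately have "real (card (E' j l)) \<le> exp (real k * \<delta>) * exp (real k * a)"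
      by (simp only: mult.assoc mult_1_right)
    also have "\<dots> = exp (real k * (a + \<delta>))" by (simp add: mult_exp_exp algebra_simps)
    finally show ?thesis .
  qed
  have "E \<subseteq> (\<Union>p\<in>{..<N} \<times> R. E' (fst p) (snd p))"
  proof
    fix x assume x: "x \<in> E"
    have "\<exists>j<N. (\<Sum>i<k. - ln (b ((f ^^ (j + i * N)) x))) \<le> real k * a"
    proof (rule ccontr)
      assume "\<not> ?thesis"
      then have "(\<Sum>j<N. real k * a) < (\<Sum>j<N. \<Sum>i<k. - ln (b ((f ^^ (j + i * N)) x)))"
        using N by (intro sum_strict_mono) auto
      also have "\<dots> = birkhoff_sum f (k * N) (\<lambda>x. - ln (b x)) x"
        unfolding birkhoff_sum_def by (rule sum_residue_classes[symmetric])
      finally show False using Z[OF x] by (simp add: mult_ac)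
    qed
    then show "x \<in> (\<Union>p\<in>{..<N} \<times> R. E' (fst p) (snd p))"
      using x by (auto simp: E'_def R_def)
  qed
  then have "card E \<le> card (\<Union>p\<in>{..<N} \<times> R. E' (fst p) (snd p))"
    using fin finite_R by (intro card_mono) auto
  also have "\<dots> \<le> (\<Sum>p\<in>{..<N} \<times> R. card (E' (fst p) (snd p)))"
    using finite_R by (intro card_UN_le) auto
  finally have "real (card E) \<le> real (\<Sum>p\<in>{..<N} \<times> R. card (E' (fst p) (snd p)))"
    by (simp only: of_nat_le_iff)
  also have "\<dots> = (\<Sum>p\<in>{..<N} \<times> R. real (card (E' (fst p) (snd p))))" by (rule of_nat_sum)
  also have "\<dots> \<le> (\<Sum>p\<in>{..<N} \<times> R. exp (real k * (a + \<delta>)))"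
    by (intro sum_mono card_E') auto
  finally show ?thesis by (simp add: card_cartesian_product)
qed

text \<open>A separated set of maximal size is spanning, for otherwise an uncovered point could be
  added. The bound on the size also ensures that a maximum exists.\<close>

lemma separated_cover:
  assumes Z: "\<And>x. x \<in> Z \<Longrightarrow> birkhoff_sum f (k * N) (\<lambda>x. - ln (b x)) x \<le> real (k * N) * a"
  obtains E where "finite E" "E \<subseteq> Z" "Z \<subseteq> (\<Union>x\<in>E. bowen_ball f (k * N) x \<rho>)"
    "real (card E) \<le> real (N * card R) * exp (real k * (a + \<delta>))"
proof -
  define sep where "sep E \<longleftrightarrow> finite E \<and> E \<subseteq> Z \<and>
    (\<forall>x\<in>E. \<forall>y\<in>E. x \<noteq> y \<longrightarrow> y \<notin> bowen_ball f (k * N) x \<rho>)" for E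
  have card_le: "real (card E) \<le> real (N * card R) * exp (real k * (a + \<delta>))" if "sep E" for E
    using that Z by (intro card_separated_le) (auto simp: sep_def)
  obtain m :: nat where m: "real (N * card R) * exp (real k * (a + \<delta>)) < real m"
    using reals_Archimedean2 by blast
  have "\<forall>E. sep E \<longrightarrow> card E < m" using card_le m by (metis le_less_trans of_nat_less_iff)
  moreover have "sep {}" by (simp add: sep_def)
  ultimately obtain E where E: "sep E" "\<And>E'. sep E' \<Longrightarrow> card E' \<le> card E"
    using ex_has_greatest_nat[of sep "{}" card m] by (metis less_imp_le)
  have "x \<in> (\<Union>x\<in>E. bowen_ball f (k * N) x \<rho>)" if x: "x \<in> Z" for x
  proof (rule ccontr)
    assume x': "x \<notin> (\<Union>x\<in>E. bowen_ball f (k * N) x \<rho>)"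
    then have "sep (insert x E)"
      using E(1) x by (auto simp: sep_def bowen_ball_def dist_commute)
    moreover have "x \<notin> E" using x' \<rho> by (force simp: bowen_ball_def)
    ultimately show False using E(2)[of "insert x E"] E(1) by (simp add: sep_def)
  qed
  then have "Z \<subseteq> (\<Union>x\<in>E. bowen_ball f (k * N) x \<rho>)" by blast
  moreover have "finite E" "E \<subseteq> Z" using E(1) by (simp_all add: sep_def)
  ultimately show ?thesis using card_le[OF E(1)] by (intro that[of E])
qed

end

text \<open>An unordered sum is the supremum over finite subfamilies, each of which meets finitely
  many levels and is bounded by a piece of the geometric series. Coinciding members of different
  levels are counted repeatedly, which only increases the bound.\<close>

lemma infsum_cover_le:
  fixes E :: "nat \<Rightarrow> 'b set" and w :: "'b \<times> nat \<Rightarrow> ennreal"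
  assumes fin: "\<And>k. finite (E k)" and C: "C = (\<Union>k\<in>{n..}. (\<lambda>x. (x, g k)) ` E k)"
    and le: "\<And>k. n \<le> k \<Longrightarrow> (\<Sum>x\<in>E k. w (x, g k)) \<le> ennreal (D * q ^ k)"
    and D: "0 \<le> D" and q: "0 \<le> q" "q < 1"
  shows "(\<Sum>\<^sub>\<infinity>c\<in>C. w c) \<le> ennreal (D / (1 - q) * q ^ n)"
proof -
  have geo: "(\<Sum>k\<in>{n..<m}. D * q ^ k) \<le> D / (1 - q) * q ^ n" for m
  proof -
    have "(\<Sum>k\<in>{n..<m}. q ^ k) \<le> q ^ n / (1 - q)"
    proof (cases "n \<le> m")
      case True
      then have "(\<Sum>k\<in>{n..<m}. q ^ k) = (q ^ n - q ^ m) / (1 - q)"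
        using q sum_gp[of q n "m - 1"] by (cases "n = m") (auto simp: atLeastLessThanSuc_atLeastAtMost[symmetric])
      then show ?thesis using q by (simp add: divide_right_mono)
    qed (use q in simp)
    then have "D * (\<Sum>k\<in>{n..<m}. q ^ k) \<le> D * (q ^ n / (1 - q))" using D by (rule mult_left_mono)
    then show ?thesis by (simp add: sum_distrib_left)
  qed
  have "sum w F \<le> ennreal (D / (1 - q) * q ^ n)" if F: "finite F" "F \<subseteq> C" for F
  proof -
    have "\<forall>c\<in>F. \<exists>k\<ge>n. \<exists>x\<in>E k. c = (x, g k)" using F(2) unfolding C by blast
    then obtain \<kappa> where \<kappa>: "\<And>c. c \<in> F \<Longrightarrow> n \<le> \<kappa> c \<and> (\<exists>x\<in>E (\<kappa> c). c = (x, g (\<kappa> c)))" by metis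
    define m where "m = Suc (Max (insert 0 (\<kappa> ` F)))"
    have \<kappa>m: "\<kappa> c < m" if "c \<in> F" for c
      unfolding m_def using F(1) that by (simp add: less_Suc_eq_le)
    have "F \<subseteq> (\<lambda>(k, x). (x, g k)) ` (SIGMA k:{n..<m}. E k)"
    proof
      fix c assume c: "c \<in> F"
      then obtain x where "x \<in> E (\<kappa> c)" "c = (x, g (\<kappa> c))" using \<kappa> by blast
      then show "c \<in> (\<lambda>(k, x). (x, g k)) ` (SIGMA k:{n..<m}. E k)"
        using \<kappa>[OF c] \<kappa>m[OF c] by (intro image_eqI[of _ _ "(\<kappa> c, x)"]) auto
    qed
    then have "sum w F \<le> sum w ((\<lambda>(k, x). (x, g k)) ` (SIGMA k:{n..<m}. E k))"
      using fin by (intro sum_mono2) auto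
    also have "\<dots> \<le> (\<Sum>p\<in>(SIGMA k:{n..<m}. E k). w ((\<lambda>(k, x). (x, g k)) p))"
      using fin by (intro order_trans[OF sum_image_le]) (auto simp: comp_def)
    also have "\<dots> = (\<Sum>k\<in>{n..<m}. \<Sum>x\<in>E k. w (x, g k))"
      using fin by (subst sum.Sigma) (auto simp: case_prod_unfold)
    also have "\<dots> \<le> (\<Sum>k\<in>{n..<m}. ennreal (D * q ^ k))" by (intro sum_mono le) auto
    also have "\<dots> = ennreal (\<Sum>k\<in>{n..<m}. D * q ^ k)" using D q by (intro sum_ennreal) auto
    also have "\<dots> \<le> ennreal (D / (1 - q) * q ^ n)" by (intro ennreal_leI geo)
    finally show ?thesis .
  qed
  then have "(SUP F\<in>{F. finite F \<and> F \<subseteq> C}. sum w F) \<le> ennreal (D / (1 - q) * q ^ n)"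
    by (intro SUP_least) blast
  then show ?thesis by (simp add: nonneg_infsum_complete)
qed

section \<open>The upper estimate and the pressure formula\<close>

context compact_system
begin

lemma metric_entropy_ge:
  assumes "finite P" "P \<subseteq> sets borel" "partition_on UNIV P"
  shows "ereal (partitioned_system.rate \<nu> f P) \<le> metric_entropy f \<nu>"
proof -
  interpret partitioned_system \<nu> f P by unfold_locales fact+
  show ?thesis unfolding metric_entropy_def rate_def using assms by (intro SUP_upper) auto
qed

text \<open>\<open>Z k\<close> collects the points whose averages of \<open>- ln b\<close> and of
  \<open>\<psi>\<close> are nearly right at time \<open>k * N\<close>: the first bounds the number
  of balls covering \<open>Z k\<close>, the second bounds their weights.\<close>

proposition pressure_scale_upper_bound:
  assumes \<psi>: "continuous_on UNIV (\<psi> :: 'a \<Rightarrow> real)"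
    and t: "metric_entropy f \<nu> + ereal (\<integral>x. \<psi> x \<partial>\<nu>) < ereal t"
  shows "\<forall>\<^sub>F \<rho> in at_right 0. pressure_scale f (generic_points f \<nu>) \<psi> \<rho> \<le> ereal t"
proof -
  let ?Z = "generic_points f \<nu>"
  define I where "I = (\<integral>x. \<psi> x \<partial>\<nu>)"
  have "metric_entropy f \<nu> < ereal (t - I)"
    using t by (cases "metric_entropy f \<nu>") (auto simp: I_def)
  then obtain r where r: "metric_entropy f \<nu> < ereal r" "r < t - I"
    using ereal_dense2 by (metis less_ereal.simps(1))
  \<comment> \<open>Per time step \<open>2 * \<delta>\<close> are spent on \<open>\<psi>\<close>,
    for its average and for its oscillation inside a ball. The other four outweigh, over the
    \<open>N\<close> steps of a level, the loss \<open>2 * \<delta>\<close> from counting and leave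
    at least the decay \<open>exp (- \<delta>)\<close> per level.\<close>
  define \<delta> where "\<delta> = (t - I - r) / 6"
  have \<delta>: "\<delta> > 0" "t = I + r + 6 * \<delta>" using r(2) by (auto simp: \<delta>_def field_simps)
  obtain \<eta> where \<eta>: "\<eta> > 0" "\<And>x y. dist x y < \<eta> \<Longrightarrow> \<bar>\<psi> x - \<psi> y\<bar> < \<delta>"
    using uniform_continuity[OF \<psi> \<delta>(1)] by blast
  have "pressure_scale f ?Z \<psi> \<rho> \<le> ereal t" if \<rho>: "0 < \<rho>" "\<rho> < \<eta>" for \<rho>
  proof -
    obtain P :: "'a set set" where P: "finite P" "P \<subseteq> sets borel" "partition_on UNIV P"
      and fine: "\<And>c x y. c \<in> P \<Longrightarrow> x \<in> c \<Longrightarrow> y \<in> c \<Longrightarrow> dist x y < \<rho> / 4"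
      using fine_partition[of "\<rho> / 4"] \<rho>(1) by auto
    interpret P: partitioned_system \<nu> f P by unfold_locales fact+
    have "ereal P.rate < ereal r" using metric_entropy_ge[OF P] r(1) by (rule le_less_trans)
    then have "\<forall>\<^sub>F n in sequentially. P.H n / real n < r"
      using P.H_limit by (intro order_tendstoD) auto
    then obtain N where N: "N > 0" "P.H N / real N < r"
      by (metis (no_types, lifting) eventually_sequentially le_Suc_eq nat_le_linear zero_less_Suc)
    interpret Q: fine_partitioned_system \<nu> f P \<rho> \<delta> N
      by unfold_locales (use \<rho>(1) \<delta>(1) N(1) fine in auto)
    let ?g = "\<lambda>x. - ln (Q.b x)"
    define Z where "Z k = {x. birkhoff_sum f (k * N) ?g x \<le> real (k * N) * (real N * r + \<delta>)
        \<and> birkhoff_sum f (k * N) \<psi> x \<le> real (k * N) * (I + \<delta>)}" for k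
    have "\<forall>k. \<exists>E. finite E \<and> E \<subseteq> Z k \<and> Z k \<subseteq> (\<Union>x\<in>E. bowen_ball f (k * N) x \<rho>)
        \<and> real (card E) \<le> real (N * card Q.R) * exp (real k * (real N * r + \<delta> + \<delta>))"
    proof
      fix k
      show "\<exists>E. finite E \<and> E \<subseteq> Z k \<and> Z k \<subseteq> (\<Union>x\<in>E. bowen_ball f (k * N) x \<rho>)
        \<and> real (card E) \<le> real (N * card Q.R) * exp (real k * (real N * r + \<delta> + \<delta>))"
        by (rule Q.separated_cover[of "Z k" k "real N * r + \<delta>"]) (auto simp: Z_def)
    qed
    from choice[OF this] obtain E where E: "\<forall>k. finite (E k) \<and> E k \<subseteq> Z k
        \<and> Z k \<subseteq> (\<Union>x\<in>E k. bowen_ball f (k * N) x \<rho>)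
        \<and> real (card (E k)) \<le> real (N * card Q.R) * exp (real k * (real N * r + \<delta> + \<delta>))"
      by (rule exE)
    define w where "w = (\<lambda>(x, m). ennreal (exp (- t * real m
        + (SUP y\<in>bowen_ball f m x \<rho>. birkhoff_sum f m \<psi> y))))"
    define D where "D = real (N * card Q.R)"
    define q where "q = exp (- \<delta>)"
    have q: "0 \<le> q" "q < 1" using \<delta>(1) by (simp_all add: q_def)
    have w_le: "w (x, k * N) \<le> ennreal (exp (real (k * N) * (I + 2 * \<delta> - t)))" if "x \<in> E k" for x k
    proof -
      have "(SUP y\<in>bowen_ball f (k * N) x \<rho>. birkhoff_sum f (k * N) \<psi> y) \<le> real (k * N) * (I + 2 * \<delta>)"
      proof (rule cSUP_least)
        show "bowen_ball f (k * N) x \<rho> \<noteq> {}" using \<rho>(1) by (auto simp: bowen_ball_def intro!: exI[of _ x])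
        fix y assume "y \<in> bowen_ball f (k * N) x \<rho>"
        then have "\<psi> ((f ^^ i) y) \<le> \<psi> ((f ^^ i) x) + \<delta>" if "i < k * N" for i
          using \<eta>(2)[of "(f ^^ i) x" "(f ^^ i) y"] that \<rho>(2) by (force simp: bowen_ball_def)
        then have "birkhoff_sum f (k * N) \<psi> y \<le> (\<Sum>i<k * N. \<psi> ((f ^^ i) x) + \<delta>)"
          unfolding birkhoff_sum_def by (intro sum_mono) auto
        also have "\<dots> = birkhoff_sum f (k * N) \<psi> x + real (k * N) * \<delta>"
          by (simp add: birkhoff_sum_def sum.distrib)
        also have "birkhoff_sum f (k * N) \<psi> x \<le> real (k * N) * (I + \<delta>)"
          using E that by (auto simp: Z_def)
        finally show "birkhoff_sum f (k * N) \<psi> y \<le> real (k * N) * (I + 2 * \<delta>)" by (simp add: algebra_simps)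
      qed
      then show ?thesis unfolding w_def by (auto intro!: ennreal_leI simp: algebra_simps)
    qed
    have level: "(\<Sum>x\<in>E k. w (x, k * N)) \<le> ennreal (D * q ^ k)" for k
    proof -
      have "(\<Sum>x\<in>E k. w (x, k * N)) \<le> (\<Sum>x\<in>E k. ennreal (exp (real (k * N) * (I + 2 * \<delta> - t))))"
        by (rule sum_mono[OF w_le])
      also have "\<dots> = ennreal (real (card (E k)) * exp (real (k * N) * (I + 2 * \<delta> - t)))"
        by (simp add: ennreal_mult' ennreal_of_nat_eq_real_of_nat)
      also have "\<dots> \<le> ennreal (D * q ^ k)"
      proof (rule ennreal_leI)
        have "real (card (E k)) * exp (real (k * N) * (I + 2 * \<delta> - t))
            \<le> D * exp (real k * (real N * r + \<delta> + \<delta>)) * exp (real (k * N) * (I + 2 * \<delta> - t))"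
          unfolding D_def using E by (intro mult_right_mono) auto
        also have "\<dots> = D * exp (real k * (real N * r + \<delta> + \<delta>) + real (k * N) * (I + 2 * \<delta> - t))"
          by (simp only: mult.assoc mult_exp_exp)
        also have "\<dots> \<le> D * exp (real k * (- \<delta>))"
        proof -
          have "real N * r + \<delta> + \<delta> + real N * (I + 2 * \<delta> - t) = 2 * \<delta> - 4 * (real N * \<delta>)"
            unfolding \<delta>(2) by (simp add: algebra_simps)
          also have "\<dots> \<le> - \<delta>" using N(1) \<delta>(1) mult_right_mono[of 1 "real N" \<delta>] by simp
          finally have "real k * (real N * r + \<delta> + \<delta> + real N * (I + 2 * \<delta> - t)) \<le> real k * (- \<delta>)"
            by (rule mult_left_mono) simp
          moreover have "real k * (real N * r + \<delta> + \<delta>) + real (k * N) * (I + 2 * \<delta> - t)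
              = real k * (real N * r + \<delta> + \<delta> + real N * (I + 2 * \<delta> - t))"
            by (simp add: algebra_simps)
          ultimately show ?thesis unfolding D_def by (intro mult_left_mono) simp_all
        qed
        also have "\<dots> = D * q ^ k" by (simp only: q_def exp_of_nat_mult)
        finally show "real (card (E k)) * exp (real (k * N) * (I + 2 * \<delta> - t)) \<le> D * q ^ k" .
      qed
      finally show ?thesis .
    qed
    have le: "pressure_sum f ?Z t \<psi> n \<rho> \<le> ennreal (D / (1 - q) * q ^ n)" for n
    proof -
      \<comment> \<open>All levels from \<open>n\<close> on are used, because the time after which a
        generic point belongs to \<open>Z k\<close> varies with the point.\<close>
      define C where "C = (\<Union>k\<in>{n..}. (\<lambda>x. (x, k * N)) ` E k)"
      have "countable C" unfolding C_def using E by (intro countable_UN) (auto intro: countable_finite)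
      moreover have "n \<le> m" if "(x, m) \<in> C" for x m
        using that N(1) by (auto simp: C_def intro: order_trans)
      moreover have "?Z \<subseteq> (\<Union>(x, m)\<in>C. bowen_ball f m x \<rho>)"
      proof
        fix x assume "x \<in> ?Z"
        then have lim: "(\<lambda>n. birkhoff_sum f n ?g x / real n) \<longlonglongrightarrow> (\<integral>x. ?g x \<partial>\<nu>)"
          "(\<lambda>n. birkhoff_sum f n \<psi> x / real n) \<longlonglongrightarrow> I"
          using Q.cont_ln_b \<psi> unfolding generic_points_iff I_def by blast+
        have "(\<integral>x. ?g x \<partial>\<nu>) \<le> P.H N" by (rule Q.integral_ln_b)
        also have "\<dots> < real N * r" using N by (simp add: field_simps)
        finally have "(\<integral>x. ?g x \<partial>\<nu>) < real N * r + \<delta>" using \<delta>(1) by simp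
        then have "\<forall>\<^sub>F n in sequentially. birkhoff_sum f n ?g x / real n < real N * r + \<delta>"
          using lim(1) by (rule order_tendstoD(2)[rotated])
        moreover have "\<forall>\<^sub>F n in sequentially. birkhoff_sum f n \<psi> x / real n < I + \<delta>"
          using lim(2) \<delta>(1) by (intro order_tendstoD(2)) auto
        ultimately have "\<forall>\<^sub>F n in sequentially. 0 < n \<and> birkhoff_sum f n ?g x \<le> real n * (real N * r + \<delta>)
            \<and> birkhoff_sum f n \<psi> x \<le> real n * (I + \<delta>)"
          using eventually_gt_at_top[of 0] by eventually_elim (simp add: field_simps)
        then obtain M where M: "\<And>n. M \<le> n \<Longrightarrow> birkhoff_sum f n ?g x \<le> real n * (real N * r + \<delta>)
            \<and> birkhoff_sum f n \<psi> x \<le> real n * (I + \<delta>)"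
          unfolding eventually_sequentially by blast
        define k where "k = max n M"
        have "M \<le> k * 1" by (simp add: k_def)
        also have "\<dots> \<le> k * N" using N(1) by (intro mult_left_mono) auto
        finally have "M \<le> k * N" .
        from M[OF this] have "x \<in> Z k" by (simp add: Z_def)
        then obtain e where "e \<in> E k" "x \<in> bowen_ball f (k * N) e \<rho>" using E by blast
        moreover have "n \<le> k" by (simp add: k_def)
        ultimately show "x \<in> (\<Union>(x, m)\<in>C. bowen_ball f m x \<rho>)"
          unfolding C_def by (intro UN_I[of "(e, k * N)"]) auto
      qed
      ultimately have "C \<in> bowen_covers f ?Z n \<rho>" by (auto simp: bowen_covers_def)
      then have "pressure_sum f ?Z t \<psi> n \<rho> \<le> (\<Sum>\<^sub>\<infinity>c\<in>C. w c)"
        unfolding pressure_sum_def w_def by (rule INF_lower)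
      also have "\<dots> \<le> ennreal (D / (1 - q) * q ^ n)"
        by (rule infsum_cover_le[where E = E and g = "\<lambda>k. k * N"]) (use E level q in \<open>auto simp: C_def D_def\<close>)
      finally show ?thesis .
    qed
    have "(\<lambda>n. D / (1 - q) * q ^ n) \<longlonglongrightarrow> D / (1 - q) * 0"
      using q by (intro tendsto_mult_left LIMSEQ_realpow_zero)
    then have "(\<lambda>n. ennreal (D / (1 - q) * q ^ n)) \<longlonglongrightarrow> ennreal (D / (1 - q) * 0)"
      by (rule tendsto_ennrealI)
    then have "(\<lambda>n. ennreal (D / (1 - q) * q ^ n)) \<longlonglongrightarrow> 0" by simp
    from tendsto_sandwich[OF always_eventually always_eventually tendsto_const this,
        of "\<lambda>n. pressure_sum f ?Z t \<psi> n \<rho>"] le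
    have "(\<lambda>n. pressure_sum f ?Z t \<psi> n \<rho>) \<longlonglongrightarrow> 0" by simp
    then have "pressure_outer f ?Z t \<psi> \<rho> = 0" unfolding pressure_outer_def by (rule limI)
    then show ?thesis unfolding pressure_scale_def by (intro Inf_lower) blast
  qed
  then show ?thesis using \<eta>(1) unfolding eventually_at_right_field by blast
qed

text \<open>Both bounds are tested against real numbers \<open>t\<close> on either side of the
  limit, which also covers infinite entropy. The partition in the lower bound is chosen after
  \<open>t\<close>, as a near-maximizer of the entropy.\<close>

theorem pressure_generic_points:
  assumes shadowing: "jump_shadowing f" and \<psi>: "continuous_on UNIV (\<psi> :: 'a \<Rightarrow> real)"
  shows "pressure f (generic_points f \<nu>) \<psi> = metric_entropy f \<nu> + ereal (\<integral>x. \<psi> x \<partial>\<nu>)"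
proof -
  let ?I = "\<integral>x. \<psi> x \<partial>\<nu>"
  have "((\<lambda>\<rho>. pressure_scale f (generic_points f \<nu>) \<psi> \<rho>) \<longlongrightarrow> metric_entropy f \<nu> + ereal ?I) (at_right 0)"
  proof (rule order_tendstoI)
    fix u assume "u < metric_entropy f \<nu> + ereal ?I"
    then obtain t where t: "u < ereal t" "ereal t < metric_entropy f \<nu> + ereal ?I"
      using ereal_dense2 by blast
    then have "ereal (t - ?I) < metric_entropy f \<nu>"
      by (cases "metric_entropy f \<nu>") auto
    then obtain P where P: "finite P" "P \<subseteq> sets borel" "partition_on UNIV P"
      and less: "ereal (t - ?I) < ereal (lim (\<lambda>n. partition_entropy \<nu> (iterated_join f n P) / real n))"
      unfolding metric_entropy_def less_SUP_iff by blast
    interpret partitioned_system \<nu> f P by unfold_locales fact+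
    have "t < rate + ?I" using less by (simp add: rate_def)
    from pressure_scale_lower_bound[OF shadowing \<psi> this]
    show "\<forall>\<^sub>F \<rho> in at_right 0. u < pressure_scale f (generic_points f \<nu>) \<psi> \<rho>"
      by eventually_elim (use t(1) in \<open>rule less_le_trans\<close>)
  next
    fix u assume "metric_entropy f \<nu> + ereal ?I < u"
    then obtain t where t: "metric_entropy f \<nu> + ereal ?I < ereal t" "ereal t < u"
      using ereal_dense2 by blast
    from pressure_scale_upper_bound[OF \<psi> t(1)]
    show "\<forall>\<^sub>F \<rho> in at_right 0. pressure_scale f (generic_points f \<nu>) \<psi> \<rho> < u"
      by eventually_elim (use t(2) in \<open>auto intro: le_less_trans\<close>)
  qed
  then show ?thesis unfolding pressure_def by (rule tendsto_Lim[rotated]) simp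
qed

end

section \<open>Conjugates of the cat map\<close>

lemma jump_shadowing_cat_map: "jump_shadowing cat_map"
proof -
  define c where "c = inverse cat_eigenvalue"
  have c: "0 \<le> c" "c < 1" using cat_eigenvalue_gt_1 by (auto simp: c_def inverse_less_1_iff)
  have "\<exists>L. 4 / (1 - c) * c ^ L < \<epsilon>" if "\<epsilon> > 0" for \<epsilon>
  proof -
    have "(\<lambda>L. 4 / (1 - c) * c ^ L) \<longlonglongrightarrow> 4 / (1 - c) * 0"
      using c by (intro tendsto_mult_left LIMSEQ_realpow_zero)
    then have "\<forall>\<^sub>F L in sequentially. 4 / (1 - c) * c ^ L < \<epsilon>"
      using that by (intro order_tendstoD) auto
    then show ?thesis by (auto simp: eventually_sequentially)
  qed
  then obtain L where L: "\<And>\<epsilon>. \<epsilon> > 0 \<Longrightarrow> 4 / (1 - c) * c ^ L \<epsilon> < \<epsilon>" by metis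
  show ?thesis
    unfolding jump_shadowing_def
  proof (intro exI[of _ L] allI)
    fix p :: "nat \<Rightarrow> torus"
    obtain y where y: "\<And>t L. (\<And>s. s < t + L \<Longrightarrow> t \<le> s + L \<Longrightarrow> p (Suc s) = cat_map (p s)) \<Longrightarrow>
        dist ((cat_map ^^ t) y) (p t) \<le> 4 / (1 - c) * c ^ L"
      unfolding c_def by (rule cat_map_shadowing_estimate[of p]) blast
    show "\<exists>y. \<forall>\<epsilon>>0. \<forall>t. (\<forall>s. s < t + L \<epsilon> \<and> t \<le> s + L \<epsilon> \<longrightarrow> p (Suc s) = cat_map (p s)) \<longrightarrow>
        dist ((cat_map ^^ t) y) (p t) < \<epsilon>"
      using y L by (intro exI[of _ y] allI impI) (meson le_less_trans)
  qed
qed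

text \<open>A conjugacy distorts the sizes of jumps but keeps their times, and only the times enter
  the property. The modulus of uniform continuity \<open>d\<close> of \<open>\<pi>\<close>
  translates the errors, which changes \<open>L\<close> to \<open>L (d \<epsilon>)\<close>.\<close>

lemma jump_shadowing_conjugate:
  fixes f g \<pi> :: "'a::metric_space \<Rightarrow> 'a"
  assumes "jump_shadowing g" and homeo: "homeomorphism UNIV UNIV \<pi> (inv \<pi>)"
    and conj: "\<pi> \<circ> g = f \<circ> \<pi>" and compact: "compact (UNIV :: 'a set)"
  shows "jump_shadowing f"
proof -
  obtain L where L: "\<forall>p. \<exists>y. \<forall>\<epsilon>>0. \<forall>t.
     (\<forall>s. s < t + L \<epsilon> \<and> t \<le> s + L \<epsilon> \<longrightarrow> p (Suc s) = g (p s)) \<longrightarrow> dist ((g ^^ t) y) (p t) < \<epsilon>"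
    using assms(1) unfolding jump_shadowing_def by (rule exE)
  have inv: "\<pi> (inv \<pi> x) = x" "inv \<pi> (\<pi> x) = x" for x
    using homeo by (simp_all add: homeomorphism_def)
  have iter: "(f ^^ t) (\<pi> x) = \<pi> ((g ^^ t) x)" for t x
    by (induction t) (simp_all add: fun_cong[OF conj, unfolded comp_def, symmetric])
  have "uniformly_continuous_on UNIV \<pi>"
    using homeo compact by (intro compact_uniformly_continuous) (auto simp: homeomorphism_def)
  then have "\<forall>\<epsilon>>0. \<exists>d>0. \<forall>x y. dist x y < d \<longrightarrow> dist (\<pi> x) (\<pi> y) < \<epsilon>"
    by (auto simp: uniformly_continuous_on_def dist_commute)
  then obtain d where d: "\<And>\<epsilon>. \<epsilon> > 0 \<Longrightarrow> d \<epsilon> > 0 \<and> (\<forall>x y. dist x y < d \<epsilon> \<longrightarrow> dist (\<pi> x) (\<pi> y) < \<epsilon>)"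
    by metis
  show ?thesis
    unfolding jump_shadowing_def
  proof (intro exI[of _ "\<lambda>\<epsilon>. L (d \<epsilon>)"] allI)
    fix p :: "nat \<Rightarrow> 'a"
    obtain y where y: "\<forall>\<epsilon>>0. \<forall>t. (\<forall>s. s < t + L \<epsilon> \<and> t \<le> s + L \<epsilon> \<longrightarrow> inv \<pi> (p (Suc s)) = g (inv \<pi> (p s)))
        \<longrightarrow> dist ((g ^^ t) y) (inv \<pi> (p t)) < \<epsilon>"
      using spec[OF L, of "\<lambda>t. inv \<pi> (p t)"] by (rule exE)
    show "\<exists>y. \<forall>\<epsilon>>0. \<forall>t. (\<forall>s. s < t + L (d \<epsilon>) \<and> t \<le> s + L (d \<epsilon>) \<longrightarrow> p (Suc s) = f (p s)) \<longrightarrow>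
        dist ((f ^^ t) y) (p t) < \<epsilon>"
    proof (intro exI[of _ "\<pi> y"] allI impI)
      fix \<epsilon> t assume \<epsilon>: "0 < (\<epsilon> :: real)"
        and quiet: "\<forall>s. s < t + L (d \<epsilon>) \<and> t \<le> s + L (d \<epsilon>) \<longrightarrow> p (Suc s) = f (p s)"
      have "inv \<pi> (p (Suc s)) = g (inv \<pi> (p s))" if "s < t + L (d \<epsilon>) \<and> t \<le> s + L (d \<epsilon>)" for s
        using quiet that fun_cong[OF conj, of "inv \<pi> (p s)"] inv by (metis comp_apply)
      then have "dist ((g ^^ t) y) (inv \<pi> (p t)) < d \<epsilon>" using y d[OF \<epsilon>] by blast
      then have "dist (\<pi> ((g ^^ t) y)) (\<pi> (inv \<pi> (p t))) < \<epsilon>" using d[OF \<epsilon>] by blast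
      then show "dist ((f ^^ t) (\<pi> y)) (p t) < \<epsilon>" by (simp add: iter inv)
    qed
  qed
qed

text \<open>Lifts that realise the distance on the torus make the map Lipschitz with the bound
  \<open>K\<close> of the matrix.\<close>

lemma continuous_on_cat_map: "continuous_on UNIV cat_map"
proof (rule continuous_onI)
  fix p :: torus and e :: real assume e: "e > 0"
  obtain K where K: "K > 0" "\<And>x. norm (cat_matrix *v x) \<le> norm x * K"
    using bounded_linear.pos_bounded[OF matrix_vector_mul_bounded_linear[of cat_matrix]] by blast
  show "\<exists>d>0. \<forall>q\<in>UNIV. dist q p < d \<longrightarrow> dist (cat_map q) (cat_map p) \<le> e"
  proof (intro exI[of _ "e / K"] conjI ballI impI)
    fix q assume "dist q p < e / K"
    obtain x y where xy: "proj x = q" "proj y = p" by (metis proj_surj)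
    obtain z where z: "z \<in> int_lattice" "infdist (x - y) int_lattice = dist (x - y) z"
      using infdist_attains_inf[OF closed_int_lattice, of "x - y"] int_lattice_0 by blast
    have "dist q p = norm (x - (y + z))"
      using z(2) dist_proj[of x y] xy by (simp add: dist_norm algebra_simps)
    moreover have "cat_map p = proj (cat_matrix *v (y + z))"
      using proj_add_lattice[OF z(1), of y] xy(2) by (metis cat_map_proj)
    then have "dist (cat_map q) (cat_map p) \<le> norm (cat_matrix *v (x - (y + z)))"
      using dist_proj_le[of "cat_matrix *v x" "cat_matrix *v (y + z)"] xy(1)
      by (simp add: cat_map_proj[symmetric] dist_norm matrix_vector_mult_diff_distrib)
    ultimately have "dist (cat_map q) (cat_map p) \<le> dist q p * K" using K(2) by (metis order_trans)
    also have "\<dots> \<le> e" using \<open>dist q p < e / K\<close> K(1) by (simp add: field_simps)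
    finally show "dist (cat_map q) (cat_map p) \<le> e" .
  qed (use e K in auto)
qed

theorem corollary4p1:
  fixes f \<pi> :: "torus \<Rightarrow> torus"
    and chi :: "real \<Rightarrow> real"
    and r\<^sub>0 r\<^sub>1 \<alpha> \<beta> :: real
    and \<mu>\<^sub>1 \<nu>\<^sub>0 :: "torus measure"
  assumes katok: "katok_map chi r\<^sub>0 r\<^sub>1 f"
    and holder: "0 < \<alpha>" "\<alpha> \<le> 1" "C1_holder_diffeo \<alpha> f"
    and mme: "max_entropy_measure cat_map \<mu>\<^sub>1"
    and conj: "homeomorphism UNIV UNIV \<pi> (inv \<pi>)" "\<pi> \<circ> cat_map = f \<circ> \<pi>"
    and \<nu>\<^sub>0: "\<nu>\<^sub>0 = distr \<mu>\<^sub>1 borel \<pi>"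
    and \<beta>: "0 < \<beta>"
  shows "\<exists>\<epsilon>\<^sub>0>0. \<forall>\<epsilon>. 0 < \<epsilon> \<and> \<epsilon> < \<epsilon>\<^sub>0 \<and> 3 * \<epsilon> < \<beta> \<and>
           (\<exists>U. openin (subtopology weak_star (M_inv UNIV f)) U \<and> \<nu>\<^sub>0 \<in> U \<and>
                (\<forall>\<nu>\<in>U. ergodic f \<nu> \<longrightarrow> \<nu> \<in> M_inv (pesin_support f \<nu>\<^sub>0 \<beta> \<beta> \<epsilon>) f)) \<longrightarrow>
           (\<forall>\<nu>\<in>M_inv (pesin_support f \<nu>\<^sub>0 \<beta> \<beta> \<epsilon>) f.
              \<forall>\<psi> :: torus \<Rightarrow> real. continuous_on UNIV \<psi> \<longrightarrow>
                pressure f (generic_points f \<nu>) \<psi> = metric_entropy f \<nu> + ereal (\<integral>x. \<psi> x \<partial>\<nu>))"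
proof -
  have "pressure f (generic_points f \<nu>) \<psi> = metric_entropy f \<nu> + ereal (\<integral>x. \<psi> x \<partial>\<nu>)"
    if \<nu>: "\<nu> \<in> M_inv Z f" and \<psi>: "continuous_on UNIV \<psi>" for Z \<nu> and \<psi> :: "torus \<Rightarrow> real"
  proof -
    have f_eq: "f = (\<lambda>x. \<pi> (cat_map (inv \<pi> x)))"
      using conj by (simp add: fun_eq_iff homeomorphism_def)
    have \<pi>: "continuous_on UNIV \<pi>" "continuous_on UNIV (inv \<pi>)"
      using conj(1) by (simp_all add: homeomorphism_def)
    have cont: "continuous_on UNIV f"
      unfolding f_eq
      by (rule continuous_on_compose2[OF \<pi>(1) continuous_on_compose2[OF continuous_on_cat_map \<pi>(2)]]) simp_all
    interpret compact_system \<nu> f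
      using \<nu> compact_torus cont
      by (simp add: compact_system_def compact_system_axioms_def M_inv_def borel_probs_def)
    show ?thesis
      by (rule pressure_generic_points[OF jump_shadowing_conjugate[OF jump_shadowing_cat_map conj compact_torus] \<psi>])
  qed
  note formula = this
  show ?thesis
  \<comment> \<open>\<open>formula\<close> is uniform in \<open>\<epsilon>\<close>, so any positive
    number serves as the threshold.\<close>
  proof (intro exI[of _ 1] conjI allI impI ballI)
    show "(0::real) < 1" by simp
  qed (rule formula)
qed

end
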